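(* There is an algorithm that, given $n$, constructs in time polynomial in $n$ a monotone Boolean circuit that computes $\mathrm{MAJ}_n$, has size polynomial in $n$, and has depth $O(\log^{5/3} n)$.
   Context: A monotone Boolean circuit has as inputs the variables $x_1,\dots,x_n$ and the constants $0,1$, and its gates are $\mathrm{AND}$ and $\mathrm{OR}$ of fan-in $2$; its size is the number of gates and its depth is the length of a longest path from an input to the output. $\mathrm{MAJ}_n:\{0,1\}^n\to\{0,1\}$ outputs $1$ iff more than half of its input bits are $1$. Logarithms are base $2$. *)

theory Defs
  imports
    Complex_Main
    "HOL-Library.Landau_Symbols"
    "HOL-Computational_Algebra.Polynomial"
begin

section \<open>Monotone Boolean circuits\<close>

text \<open>
  A circuit is given by its gates in a topological order, together with the wire that carries
  the output. Wire \<open>Var i\<close> carries input bit number \<open>i\<close> (counted from \<open>0\<close>) and wire \<open>Gate k\<close> the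
  value of gate number \<open>k\<close>. As gates are referred to by their position, fan-out is unrestricted.
\<close>

datatype wire = Var nat | Const bool | Gate nat

datatype gate = And wire wire | Or wire wire

datatype circuit = Circuit (gates: "gate list") (out_wire: wire)

fun gate_inputs :: "gate \<Rightarrow> wire set" where
  "gate_inputs (And u v) = {u, v}"
| "gate_inputs (Or u v) = {u, v}"

text \<open>\<open>wf_wire n m w\<close>: the wire \<open>w\<close> is available when there are \<open>n\<close> variables and \<open>m\<close> gates.\<close>

fun wf_wire :: "nat \<Rightarrow> nat \<Rightarrow> wire \<Rightarrow> bool" where
  "wf_wire n m (Var i) \<longleftrightarrow> i < n"
| "wf_wire n m (Const b) \<longleftrightarrow> True"
| "wf_wire n m (Gate k) \<longleftrightarrow> k < m"

definition wf_circuit :: "nat \<Rightarrow> circuit \<Rightarrow> bool" where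
  "wf_circuit n C \<longleftrightarrow>
     (\<forall>k < length (gates C). \<forall>w \<in> gate_inputs (gates C ! k). wf_wire n k w) \<and>
     wf_wire n (length (gates C)) (out_wire C)"

fun wire_val :: "bool list \<Rightarrow> bool list \<Rightarrow> wire \<Rightarrow> bool" where
  "wire_val xs vs (Var i) = xs ! i"
| "wire_val xs vs (Const b) = b"
| "wire_val xs vs (Gate k) = vs ! k"

fun gate_val :: "bool list \<Rightarrow> bool list \<Rightarrow> gate \<Rightarrow> bool" where
  "gate_val xs vs (And u v) \<longleftrightarrow> wire_val xs vs u \<and> wire_val xs vs v"
| "gate_val xs vs (Or u v) \<longleftrightarrow> wire_val xs vs u \<or> wire_val xs vs v"

definition gate_vals :: "bool list \<Rightarrow> gate list \<Rightarrow> bool list" where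
  "gate_vals xs gs = foldl (\<lambda>vs g. vs @ [gate_val xs vs g]) [] gs"

definition circuit_val :: "circuit \<Rightarrow> bool list \<Rightarrow> bool" where
  "circuit_val C xs = wire_val xs (gate_vals xs (gates C)) (out_wire C)"

definition computes :: "nat \<Rightarrow> circuit \<Rightarrow> (bool list \<Rightarrow> bool) \<Rightarrow> bool" where
  "computes n C f \<longleftrightarrow> wf_circuit n C \<and> (\<forall>xs. length xs = n \<longrightarrow> circuit_val C xs = f xs)"

definition circuit_size :: "circuit \<Rightarrow> nat" where
  "circuit_size C = length (gates C)"

text \<open>
  \<open>input_path gs w l\<close>: there is a path with \<open>l\<close> edges from an input (a variable or a constant)
  to the wire \<open>w\<close>. In a well-formed circuit the lengths of the paths to the output wire form a
  finite nonempty set, so that the maximum below is meaningful.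
\<close>

inductive input_path :: "gate list \<Rightarrow> wire \<Rightarrow> nat \<Rightarrow> bool" for gs where
  "input_path gs (Var i) 0"
| "input_path gs (Const b) 0"
| "k < length gs \<Longrightarrow> w \<in> gate_inputs (gs ! k) \<Longrightarrow> input_path gs w l \<Longrightarrow>
     input_path gs (Gate k) (Suc l)"

definition circuit_depth :: "circuit \<Rightarrow> nat" where
  "circuit_depth C = Max {l. input_path (gates C) (out_wire C) l}"

definition MAJ :: "bool list \<Rightarrow> bool" where
  "MAJ xs \<longleftrightarrow> 2 * count_list xs True > length xs"


section \<open>Random access machines\<close>

text \<open>
  Algorithms are while programs for a random access machine with natural number registers,
  arrays with indirect addressing, and a write-only output tape. The only arithmetic operations
  are addition and truncated subtraction; every operation takes one unit of time. A program
  mentions finitely many registers and arrays, and in \<open>t\<close> steps it creates only numbers with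
  \<open>O(t)\<close> more bits than the input and the constants of the program. Hence polynomial time is the
  same as on Turing machines (Cook and Reckhow, Time bounded random access machines, 1973).
\<close>

datatype expr =
    Num nat
  | Reg nat
  | Elem nat expr
  | Plus expr expr
  | Minus expr expr

datatype prog =
    Assign nat expr
  | Store nat expr expr
  | Print expr
  | Seq prog prog
  | Cond expr prog prog
  | While expr prog

record state =
  reg :: "nat \<Rightarrow> nat"
  arr :: "nat \<Rightarrow> nat \<Rightarrow> nat"
  tape :: "nat list"

fun expr_val :: "expr \<Rightarrow> state \<Rightarrow> nat" where
  "expr_val (Num c) s = c"
| "expr_val (Reg x) s = reg s x"
| "expr_val (Elem a e) s = arr s a (expr_val e s)"
| "expr_val (Plus e e') s = expr_val e s + expr_val e' s"
| "expr_val (Minus e e') s = expr_val e s - expr_val e' s"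

fun expr_time :: "expr \<Rightarrow> nat" where
  "expr_time (Num c) = 1"
| "expr_time (Reg x) = 1"
| "expr_time (Elem a e) = 1 + expr_time e"
| "expr_time (Plus e e') = 1 + expr_time e + expr_time e'"
| "expr_time (Minus e e') = 1 + expr_time e + expr_time e'"

text \<open>
  \<open>exec c s t s'\<close>: started in state \<open>s\<close>, program \<open>c\<close> terminates after \<open>t\<close> steps in state \<open>s'\<close>.
  A test succeeds iff its value is positive.
\<close>

inductive exec :: "prog \<Rightarrow> state \<Rightarrow> nat \<Rightarrow> state \<Rightarrow> bool" where
  Assign: "exec (Assign x e) s (1 + expr_time e)
             (s\<lparr>reg := (reg s)(x := expr_val e s)\<rparr>)"
| Store: "exec (Store a i e) s (1 + expr_time i + expr_time e)
            (s\<lparr>arr := (arr s)(a := (arr s a)(expr_val i s := expr_val e s))\<rparr>)"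
| Print: "exec (Print e) s (1 + expr_time e) (s\<lparr>tape := tape s @ [expr_val e s]\<rparr>)"
| Seq: "exec c s t s' \<Longrightarrow> exec c' s' t' s'' \<Longrightarrow> exec (Seq c c') s (t + t') s''"
| CondTrue: "expr_val e s > 0 \<Longrightarrow> exec c s t s' \<Longrightarrow>
               exec (Cond e c c') s (1 + expr_time e + t) s'"
| CondFalse: "expr_val e s = 0 \<Longrightarrow> exec c' s t s' \<Longrightarrow>
                exec (Cond e c c') s (1 + expr_time e + t) s'"
| WhileTrue: "expr_val e s > 0 \<Longrightarrow> exec c s t s' \<Longrightarrow> exec (While e c) s' t' s'' \<Longrightarrow>
                exec (While e c) s (1 + expr_time e + t + t') s''"
| WhileFalse: "expr_val e s = 0 \<Longrightarrow> exec (While e c) s (1 + expr_time e) s"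

definition init_state :: "nat \<Rightarrow> state" where
  "init_state n = \<lparr>reg = (\<lambda>_. 0)(0 := n), arr = (\<lambda>_ _. 0), tape = []\<rparr>"

definition poly_bounded :: "(nat \<Rightarrow> nat) \<Rightarrow> bool" where
  "poly_bounded f \<longleftrightarrow> (\<exists>p :: nat poly. \<forall>n. f n \<le> poly p n)"

text \<open>The running time is measured in the number \<open>n\<close> itself, not in its bit length.\<close>

definition outputs_in_time :: "prog \<Rightarrow> (nat \<Rightarrow> nat list) \<Rightarrow> (nat \<Rightarrow> nat) \<Rightarrow> bool" where
  "outputs_in_time c f T \<longleftrightarrow>
     (\<forall>n. \<exists>t s. exec c (init_state n) t s \<and> t \<le> T n \<and> tape s = f n)"

lemma exec_deterministic:
  assumes "exec c s t s'" and "exec c s u s''"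
  shows "t = u \<and> s' = s''"
  using assms
proof (induction arbitrary: u s'' rule: exec.induct)
  case (Seq c s t s' c' t' s1)
  from Seq.prems obtain v r v' where "exec c s v r" "exec c' r v' s''" "u = v + v'"
    by (cases rule: exec.cases) auto
  with Seq.IH show ?case by blast
next
  case (CondTrue e s c t s' c')
  from CondTrue.prems CondTrue.hyps obtain v where "exec c s v s''" "u = 1 + expr_time e + v"
    by (cases rule: exec.cases) auto
  with CondTrue.IH show ?case by blast
next
  case (CondFalse e s c' t s' c)
  from CondFalse.prems CondFalse.hyps obtain v where "exec c' s v s''" "u = 1 + expr_time e + v"
    by (cases rule: exec.cases) auto
  with CondFalse.IH show ?case by blast
next
  case (WhileTrue e s c t s' t' s1)
  from WhileTrue.prems WhileTrue.hyps obtain v r v'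
    where "exec c s v r" "exec (While e c) r v' s''" "u = 1 + expr_time e + v + v'"
    by (cases rule: exec.cases) auto
  with WhileTrue.IH show ?case by blast
next
  case (WhileFalse e s c)
  then show ?case by (cases rule: exec.cases[OF WhileFalse.prems]) auto
next
  case (Assign x e s)
  then show ?case by (cases rule: exec.cases) auto
next
  case (Store a i e s)
  then show ?case by (cases rule: exec.cases) auto
next
  case (Print e s)
  then show ?case by (cases rule: exec.cases) auto
qed


section \<open>Circuits as output\<close>

fun encode_wire :: "wire \<Rightarrow> nat list" where
  "encode_wire (Const b) = [0, of_bool b]"
| "encode_wire (Var i) = [1, i]"
| "encode_wire (Gate k) = [2, k]"

fun encode_gate :: "gate \<Rightarrow> nat list" where
  "encode_gate (And u v) = 0 # encode_wire u @ encode_wire v"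
| "encode_gate (Or u v) = 1 # encode_wire u @ encode_wire v"

definition encode_circuit :: "circuit \<Rightarrow> nat list" where
  "encode_circuit C = concat (map encode_gate (gates C)) @ encode_wire (out_wire C)"

lemma length_encode_wire: "length (encode_wire w) = 2"
  by (cases w) auto

lemma encode_wire_inject: "encode_wire w = encode_wire w' \<longleftrightarrow> w = w'"
  by (cases w; cases w') auto

lemma length_encode_gate: "length (encode_gate g) = 5"
  by (cases g) (auto simp: length_encode_wire)

lemma encode_gate_inject: "encode_gate g = encode_gate g' \<longleftrightarrow> g = g'"
  by (cases g; cases g') (auto simp: length_encode_wire encode_wire_inject)

lemma encode_circuit_inject: "encode_circuit C = encode_circuit C' \<longleftrightarrow> C = C'"
proof -
  have "concat (map encode_gate gs) @ encode_wire w = concat (map encode_gate gs') @ encode_wire w'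
        \<Longrightarrow> gs = gs' \<and> w = w'" for gs gs' w w'
  proof (induction gs arbitrary: gs')
    case Nil
    then show ?case
      by (cases gs')
        (auto simp: encode_wire_inject length_encode_gate length_encode_wire
          dest: arg_cong[of _ _ length])
  next
    case (Cons g gs)
    then show ?case
      by (cases gs')
        (auto simp: encode_gate_inject length_encode_gate length_encode_wire
          dest: arg_cong[of _ _ length])
  qed
  then show ?thesis
    by (cases C; cases C') (auto simp: encode_circuit_def)
qed

end

theory Submission imports Defs "HOL-Number_Theory.Number_Theory" begin

text \<open>
  A network of k-ary merges, with \<open>k = 2 ^ l\<close> and \<open>l\<close> about the square root of \<open>log n\<close>, sorts the
  input bits in \<open>l * l\<close> rounds, each of which replaces every bit by the majority of a window of
  \<open>2 * k\<^sup>2 + 1\<close> bits. A window majority is computed in depth \<open>O(l)\<close> by Valiant's layers of random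
  three-input majorities, derandomized by pairwise independent hashing: with \<open>O(l)\<close> fresh seed bits
  per layer, all but a small fraction of the seeds give the right value. There are \<open>2 ^ O(l * l)\<close>
  seeds, polynomially many in \<open>n\<close>, so every bit is kept in one copy per seed. A round multiplies the
  fraction of wrong copies by the window size; to reduce it again, the seeds are viewed as vectors
  over a prime field, and each copy is replaced by a tree of three-input majorities over the points
  of a line. Lines whose directions lie on a moment curve sample every set of vectors well, since
  averages along distinct directions are commuting projections, \<open>m\<close> of which average over the whole
  space. Idle rounds at the end remove all errors. The total depth is \<open>O(l ^ 3)\<close>, which is even
  \<open>O(log n powr (3 / 2))\<close>.
\<close>

text \<open>Polynomial size allows seeds of only \<open>O(l * l)\<close> bits in all, so the same
  seeds serve in every round. This is sound because errors are measured against the run of the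
  errorless network, which does not depend on seeds: for each fixed window only few seeds fail.
  Which seeds fail at which position is uncontrolled, and a window collects the errors of all its
  entries, a factor of about \<open>2 * 4 ^ l\<close>. Hence the correction must work for arbitrary
  error sets. Lines with a free base point and a free direction would need more labels than there
  are copies. Giving up one coordinate of the base point in exchange for the position on the moment
  curve yields exactly as many lines as vectors, so that the corrected bits again form one copy per
  seed. A tree of depth \<open>hp\<close> is not a majority of its \<open>3 ^ hp\<close> leaves; it
  is only sure to be right with fewer than \<open>2 ^ hp\<close> wrong ones. The second moment bound
  then still gains a factor of about \<open>(4 / 3) ^ hp\<close>, up to a factor linear in
  \<open>l\<close>, and \<open>hp\<close> of at least \<open>10 * l\<close> outweighs the loss of a
  round.\<close>

definition maj3 :: "bool \<Rightarrow> bool \<Rightarrow> bool \<Rightarrow> bool" where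
  "maj3 a b c \<longleftrightarrow> (a \<and> b) \<or> ((a \<or> b) \<and> c)"

lemma sum_of_bool_less: "(\<Sum>i<g. of_bool (i < L)) = min g (L :: nat)"
  by (induction g) (auto simp: min_def)

lemma sum_lessThan_mult:
  fixes f :: "nat \<Rightarrow> 'a :: comm_monoid_add"
  shows "(\<Sum>i<G * k. f i) = (\<Sum>p<G. \<Sum>r<k. f (p * k + r))"
  by (simp add: sum.atLeastLessThan_shift_0[of _ "_ * k"] atLeast0LessThan flip: sum.nat_group)

lemma sum_mod_shift:
  fixes F :: "nat \<Rightarrow> real"
  assumes "Q > 0"
  shows "(\<Sum>b<Q. F ((c + b) mod Q)) = (\<Sum>x<Q. F x)"
proof (rule sum.reindex_bij_betw)
  have inj: "inj_on (\<lambda>b. (c + b) mod Q) {..<Q}"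
  proof (rule inj_onI)
    fix a b assume "a \<in> {..<Q}" "b \<in> {..<Q}" "(c + a) mod Q = (c + b) mod Q"
    then show "a = b" by (metis cong_add_lcancel_nat cong_def lessThan_iff mod_less)
  qed
  moreover have "(\<lambda>b. (c + b) mod Q) ` {..<Q} = {..<Q}"
    using assms by (intro card_subset_eq) (auto simp: card_image[OF inj])
  ultimately show "bij_betw (\<lambda>b. (c + b) mod Q) {..<Q} {..<Q}" by (simp add: bij_betw_def)
qed

lemma card_of_bool_sum: fixes n :: nat shows "real (card {c \<in> {..<n}. P c}) = (\<Sum>c<n. of_bool (P c))"
  by (simp add: of_bool_def sum.If_cases Int_def)

section \<open>Layered circuits of three-input majorities\<close>

text \<open>Sources of a gate are numbers: 0 and 1 are the constants, u + 2 is wire u of the previous layer.\<close>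

definition read_source :: "(nat \<Rightarrow> bool) \<Rightarrow> nat \<Rightarrow> bool" where
  "read_source V u \<longleftrightarrow> (if u < 2 then u = 1 else V (u - 2))"

fun layer_val :: "(nat \<Rightarrow> nat \<Rightarrow> nat \<Rightarrow> nat) \<Rightarrow> (nat \<Rightarrow> bool) \<Rightarrow> nat \<Rightarrow> nat \<Rightarrow> bool" where
  "layer_val src V 0 w = V w"
| "layer_val src V (Suc L) w =
     maj3 (read_source (layer_val src V L) (src L w 0))
          (read_source (layer_val src V L) (src L w 1))
          (read_source (layer_val src V L) (src L w 2))"

locale layered =
  fixes W :: nat and D :: nat and src :: "nat \<Rightarrow> nat \<Rightarrow> nat \<Rightarrow> nat" and inp :: "nat \<Rightarrow> nat" and n :: nat
  assumes src: "\<And>L w r. L < D \<Longrightarrow> w < W \<Longrightarrow> r < 3 \<Longrightarrow> src L w r < W + 2"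
    and W: "W > 0" and D: "D > 0"
begin

text \<open>An input number of \<open>n\<close> or more becomes false: this pads the input with
  zeros up to the full width. On later layers the value of a block is its fourth gate, hence the
  offset 3.\<close>

definition source_wire :: "nat \<Rightarrow> nat \<Rightarrow> wire" where
  "source_wire L u = (if u < 2 then Const (u = 1)
     else if L = 0 then (if inp (u - 2) < n then Var (inp (u - 2)) else Const False)
     else Gate (4 * ((L - 1) * W + (u - 2)) + 3))"

text \<open>The four gates follow the shape of \<open>maj3\<close>; block \<open>G\<close> occupies
  the positions \<open>4 * G\<close> to \<open>4 * G + 3\<close>.\<close>

definition maj3_gates :: "nat \<Rightarrow> gate list" where
  "maj3_gates G = (let L = G div W; w = G mod W; a = source_wire L (src L w 0);
      b = source_wire L (src L w 1); c = source_wire L (src L w 2)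
    in [And a b, Or a b, And (Gate (4 * G + 1)) c, Or (Gate (4 * G)) (Gate (4 * G + 2))])"

definition layered_circuit :: "nat \<Rightarrow> circuit" where
  "layered_circuit w = Circuit (concat (map maj3_gates [0..<D * W])) (Gate (4 * ((D - 1) * W + w) + 3))"

lemma length_gates: "length (gates (layered_circuit w)) = 4 * (D * W)"
proof -
  have "length (concat (map maj3_gates [0..<k])) = 4 * k" for k
    by (induction k) (auto simp: maj3_gates_def Let_def)
  then show ?thesis by (simp add: layered_circuit_def)
qed

lemma nth_gates:
  assumes "G < D * W" "r < 4"
  shows "gates (layered_circuit w) ! (4 * G + r) = maj3_gates G ! r"
proof -
  have len: "length (concat (map maj3_gates [0..<k])) = 4 * k" for k
    by (induction k) (auto simp: maj3_gates_def Let_def)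
  have "G < k \<Longrightarrow> concat (map maj3_gates [0..<k]) ! (4 * G + r) = maj3_gates G ! r" for k
  proof (induction k)
    case (Suc k)
    show ?case
    proof (cases "G = k")
      case True
      then show ?thesis using len[of k] by (simp add: nth_append)
    next
      case False
      with Suc.prems have "G < k" by simp
      moreover from this have "4 * G + r < 4 * k" using assms by linarith
      ultimately show ?thesis using Suc.IH len[of k] by (simp add: nth_append)
    qed
  qed simp
  from this[OF assms(1)] show ?thesis by (simp add: layered_circuit_def)
qed

lemma gate_index:
  assumes "k < 4 * (D * W)"
  obtains L w r where "k = 4 * (L * W + w) + r" "L < D" "w < W" "r < 4" "L * W + w < D * W"
proof
  have "k div 4 < D * W" using assms by (simp add: less_mult_imp_div_less mult.commute)
  moreover have "k div 4 = (k div 4 div W) * W + k div 4 mod W" by simp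
  ultimately show "k = 4 * ((k div 4 div W) * W + k div 4 mod W) + k mod 4"
    "(k div 4 div W) * W + k div 4 mod W < D * W" by simp_all
  show "k div 4 div W < D" using \<open>k div 4 < D * W\<close> by (simp add: less_mult_imp_div_less)
  show "k div 4 mod W < W" using W by simp
qed simp

lemma gate_cases:
  assumes "L < D" "w < W" "r < 4"
  shows "gates (layered_circuit v) ! (4 * (L * W + w) + r) =
    [And (source_wire L (src L w 0)) (source_wire L (src L w 1)),
     Or (source_wire L (src L w 0)) (source_wire L (src L w 1)),
     And (Gate (4 * (L * W + w) + 1)) (source_wire L (src L w 2)),
     Or (Gate (4 * (L * W + w))) (Gate (4 * (L * W + w) + 2))] ! r"
proof -
  have "L * W + w < Suc L * W" using assms by simp
  also have "\<dots> \<le> D * W" using assms by (intro mult_right_mono) auto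
  finally show ?thesis
    using assms W by (subst nth_gates) (auto simp: maj3_gates_def Let_def)
qed

lemma wf_source:
  assumes "L < D" "u < W + 2" "k \<ge> 4 * (L * W)"
  shows "wf_wire n k (source_wire L u)"
proof (cases "u < 2 \<or> L = 0")
  case False
  then have "(L - 1) * W + (u - 2) < (L - 1) * W + W" using assms by auto
  also have "\<dots> = L * W" using False by (cases L) auto
  finally show ?thesis using assms False by (auto simp: source_wire_def)
qed (auto simp: source_wire_def)

lemma less4_cases: "r < 4 \<Longrightarrow> r = 0 \<or> r = 1 \<or> r = 2 \<or> r = (3::nat)"
  by auto

lemma wf_gates:
  assumes k: "k < length (gates (layered_circuit v))" and w: "w \<in> gate_inputs (gates (layered_circuit v) ! k)"
  shows "wf_wire n k w"
proof -
  from k obtain L u r where *: "k = 4 * (L * W + u) + r" "L < D" "u < W" "r < 4"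
    unfolding length_gates by (rule gate_index)
  note g = gate_cases[OF *(2-4), of v]
  have s: "wf_wire n k (source_wire L (src L u q))" if "q < 3" for q
    using * src that by (intro wf_source) auto
  show ?thesis
    using less4_cases[OF *(4)] w s[of 0] s[of 1] s[of 2] unfolding *(1) g by auto
qed

lemma wf_layered: "w < W \<Longrightarrow> wf_circuit n (layered_circuit w)"
proof -
  assume w: "w < W"
  have "(D - 1) * W + w < (D - 1) * W + W" using w by simp
  also have "\<dots> = D * W" using D by (cases D) auto
  finally show ?thesis
    unfolding wf_circuit_def using wf_gates
    by (auto simp: length_gates) (simp add: layered_circuit_def)
qed

section \<open>Values of the gates\<close>

lemma gate_vals_snoc: "gate_vals xs (gs @ [g]) = gate_vals xs gs @ [gate_val xs (gate_vals xs gs) g]"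
  by (simp add: gate_vals_def)

lemma length_gate_vals: "length (gate_vals xs gs) = length gs"
  by (induction gs rule: rev_induct) (auto simp: gate_vals_snoc, simp add: gate_vals_def)

lemma nth_gate_vals_append:
  "k < length gs \<Longrightarrow> gate_vals xs (gs @ hs) ! k = gate_vals xs gs ! k"
proof (induction hs rule: rev_induct)
  case (snoc h hs)
  then show ?case
    by (simp flip: append_assoc add: gate_vals_snoc nth_append length_gate_vals)
qed simp

text \<open>A gate reads only earlier positions, so the prefix on which it was evaluated may be
  replaced by the complete list of values. This turns the fold into an equation.\<close>

lemma nth_gate_vals:
  assumes "k < length gs" "\<And>w. w \<in> gate_inputs (gs ! k) \<Longrightarrow> wf_wire m k w"
  shows "gate_vals xs gs ! k = gate_val xs (gate_vals xs gs) (gs ! k)"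
proof -
  have tk: "gate_vals xs gs ! j = gate_vals xs (take i gs) ! j" if "j < i" "i \<le> length gs" for i j
    using nth_gate_vals_append[of j "take i gs" xs "drop i gs"] that by simp
  have w: "wire_val xs (gate_vals xs (take k gs)) w = wire_val xs (gate_vals xs gs) w"
    if "w \<in> gate_inputs (gs ! k)" for w
    using assms(1) assms(2)[OF that] tk[of _ k] by (cases w) auto
  have "gate_vals xs gs ! k = gate_vals xs (take k gs @ [gs ! k]) ! k"
    using tk[of k "Suc k"] assms(1) by (simp add: take_Suc_conv_app_nth)
  also have "\<dots> = gate_val xs (gate_vals xs (take k gs)) (gs ! k)"
    using assms by (simp add: gate_vals_snoc nth_append length_gate_vals)
  also have "\<dots> = gate_val xs (gate_vals xs gs) (gs ! k)"
    using w by (cases "gs ! k") auto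
  finally show ?thesis .
qed

lemma gate_vals_layer:
  fixes xs v
  defines "vs \<equiv> gate_vals xs (gates (layered_circuit v))"
    and "V \<equiv> \<lambda>w. inp w < n \<and> xs ! inp w"
  shows "L < D \<Longrightarrow> w < W \<Longrightarrow> vs ! (4 * (L * W + w) + 3) = layer_val src V (Suc L) w"
proof (induction L arbitrary: w rule: less_induct)
  case (less L)
  have lt: "L * W + w < D * W"
  proof -
    have "L * W + w < Suc L * W" using less.prems by simp
    also have "\<dots> \<le> D * W" using less.prems by (intro mult_right_mono) auto
    finally show ?thesis .
  qed
  have src_val: "wire_val xs vs (source_wire L u) = read_source (layer_val src V L) u"
    if u: "u < W + 2" for u
  proof (cases "u < 2 \<or> L = 0")
    case True
    then show ?thesis by (auto simp: source_wire_def read_source_def V_def)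
  next
    case False
    then obtain L' where L': "L = Suc L'" by (cases L) auto
    obtain u' where "u = Suc (Suc u')" using False by (metis add_2_eq_Suc le_Suc_ex not_less)
    then show ?thesis using less.IH[of L' u'] less.prems u
      by (simp add: L' source_wire_def read_source_def del: layer_val.simps)
  qed
  have step: "vs ! (4 * (L * W + w) + r) = gate_val xs vs (gates (layered_circuit v) ! (4 * (L * W + w) + r))"
    if "r < 4" for r
  proof -
    have "4 * G + r < 4 * H" if "G < H" for G H :: nat
      using that \<open>r < 4\<close> by linarith
    from this[OF lt] have k: "4 * (L * W + w) + r < length (gates (layered_circuit v))"
      by (simp only: length_gates)
    show ?thesis unfolding vs_def by (rule nth_gate_vals[OF k wf_gates[OF k]])
  qed
  note gc = gate_cases[OF less.prems, of _ v]
  let ?G = "4 * (L * W + w)"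
  have s: "src L w r < W + 2" if "r < 3" for r using src less.prems that by auto
  have "vs ! (?G + 0) = (wire_val xs vs (source_wire L (src L w 0)) \<and> wire_val xs vs (source_wire L (src L w 1)))"
    using step[of 0] gc[of 0] by simp
  moreover have "vs ! (?G + 1) = (wire_val xs vs (source_wire L (src L w 0)) \<or> wire_val xs vs (source_wire L (src L w 1)))"
    by (subst step) (simp_all only: gc, simp_all)
  moreover have "vs ! (?G + 2) = (vs ! (?G + 1) \<and> wire_val xs vs (source_wire L (src L w 2)))"
    by (subst step) (simp_all only: gc, simp_all)
  moreover have "vs ! (?G + 3) = (vs ! (?G + 0) \<or> vs ! (?G + 2))"
    by (subst step) (simp_all only: gc, simp_all)
  ultimately show ?case
    using src_val[OF s[of 0]] src_val[OF s[of 1]] src_val[OF s[of 2]]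
    by (simp add: maj3_def)
qed

lemma circuit_val_layered:
  assumes "w < W"
  shows "circuit_val (layered_circuit w) xs = layer_val src (\<lambda>w. inp w < n \<and> xs ! inp w) D w"
  using gate_vals_layer[of "D - 1" w xs w] assms D
  by (simp add: circuit_val_def) (simp add: layered_circuit_def)

section \<open>Depth of a layered circuit\<close>

fun height_bound :: "wire \<Rightarrow> nat" where
  "height_bound (Gate k) = 3 * (k div 4 div W) + [1, 1, 2, 3] ! (k mod 4)"
| "height_bound _ = 0"

lemma height_bound_Gate:
  assumes "w < W" "r < 4"
  shows "height_bound (Gate (4 * (L * W + w) + r)) = 3 * L + [1, 1, 2, 3] ! r"
proof -
  have "(4 * y + r) div 4 = y" "(4 * y + r) mod 4 = r" for y
    using assms by auto
  then have "(4 * (L * W + w) + r) div 4 = L * W + w" "(4 * (L * W + w) + r) mod 4 = r"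
    by blast+
  then show ?thesis using assms W by simp
qed

lemma height_bound_source:
  assumes "u < W + 2"
  shows "height_bound (source_wire L u) \<le> 3 * L"
proof (cases "u < 2 \<or> L = 0")
  case False
  then obtain L' where L': "L = Suc L'" by (cases L) auto
  obtain u' where u': "u = Suc (Suc u')" using False by (metis Suc_1 add_2_eq_Suc le_Suc_ex not_less)
  have "u' < W" using assms u' by linarith
  from height_bound_Gate[OF this, of 3 L'] have "height_bound (source_wire L u) = 3 * L' + 3"
    by (simp add: source_wire_def L' u' del: height_bound.simps)
  then show ?thesis by (simp add: L')
qed (auto simp: source_wire_def)

text \<open>\<open>height_bound\<close> is a potential that increases along every edge: three per
  layer, with 1, 1, 2, 3 for the four gates of a block.\<close>

lemma input_path_le: "input_path (gates (layered_circuit v)) w l \<Longrightarrow> l \<le> height_bound w"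
proof (induction rule: input_path.induct)
  case (3 k w l)
  from 3(1) obtain L u r where *: "k = 4 * (L * W + u) + r" "L < D" "u < W" "r < 4"
    unfolding length_gates by (rule gate_index)
  have s: "height_bound (source_wire L (src L u q)) \<le> 3 * L" if "q < 3" for q
    using * src that by (intro height_bound_source) auto
  have G: "height_bound (Gate (4 * (L * W + u) + q)) = 3 * L + [1, 1, 2, 3] ! q" if "q < 4" for q
    by (rule height_bound_Gate) (use * that in auto)
  have "height_bound w < height_bound (Gate k)"
    using less4_cases[OF *(4)] 3(2) s[of 0] s[of 1] s[of 2] G[of 0] G[of 1] G[of 2] G[of 3]
    unfolding *(1) gate_cases[OF *(2-4), of v]
    by (auto simp del: height_bound.simps)
  then show ?case using 3 by simp
qed auto

lemma ex_input_path: "wf_wire n (length (gates (layered_circuit v))) w \<Longrightarrow>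
  \<exists>l. input_path (gates (layered_circuit v)) w l"
proof (induction w)
  case (Gate k)
  then have "k < length (gates (layered_circuit v))" by simp
  then show ?case
  proof (induction k rule: less_induct)
    case (less k)
    obtain w where w: "w \<in> gate_inputs (gates (layered_circuit v) ! k)"
      by (cases "gates (layered_circuit v) ! k") auto
    then have "wf_wire n k w" using wf_gates less by auto
    then have "\<exists>l. input_path (gates (layered_circuit v)) w l"
      using less by (cases w) (auto intro: input_path.intros)
    then show ?case using less w by (auto intro: input_path.intros)
  qed
qed (auto intro: input_path.intros)

lemma depth_layered:
  assumes "w < W"
  shows "circuit_depth (layered_circuit w) \<le> 3 * D"
proof -
  let ?C = "layered_circuit w"
  have "height_bound (out_wire ?C) \<le> 3 * D"
    using height_bound_Gate[OF assms, of 3 "D - 1"] D by (simp add: layered_circuit_def)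
  then have sub: "{l. input_path (gates ?C) (out_wire ?C) l} \<subseteq> {..3 * D}"
    using input_path_le by fastforce
  moreover have "{l. input_path (gates ?C) (out_wire ?C) l} \<noteq> {}"
    using ex_input_path[of w "out_wire ?C"] wf_layered[OF assms] by (auto simp: wf_circuit_def)
  ultimately have "Max {l. input_path (gates ?C) (out_wire ?C) l} \<in> {..3 * D}"
    using finite_subset by (intro subsetD[OF sub] Max_in) auto
  then show ?thesis by (simp add: circuit_depth_def)
qed

section \<open>The circuit as a list of numbers\<close>

definition src_tag :: "nat \<Rightarrow> nat \<Rightarrow> nat" where
  "src_tag L u = (if u < 2 then 0 else if L = 0 then (if inp (u - 2) < n then 1 else 0) else 2)"

definition src_arg :: "nat \<Rightarrow> nat \<Rightarrow> nat" where
  "src_arg L u = (if u < 2 then u else if L = 0 then (if inp (u - 2) < n then inp (u - 2) else 0)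
     else 4 * ((L - 1) * W + (u - 2)) + 3)"

lemma encode_source: "encode_wire (source_wire L u) = [src_tag L u, src_arg L u]"
  by (auto simp: source_wire_def src_tag_def src_arg_def)

text \<open>Twenty numbers per block, four gates of five each, by a pattern that depends only on
  \<open>G\<close>: the form that a printing loop can produce.\<close>

lemma encode_layered:
  "encode_circuit (layered_circuit v) =
    concat (map (\<lambda>G. let L = G div W; t = \<lambda>r. src_tag L (src L (G mod W) r); a = \<lambda>r. src_arg L (src L (G mod W) r)
      in [0, t 0, a 0, t 1, a 1, 1, t 0, a 0, t 1, a 1,
          0, 2, 4 * G + 1, t 2, a 2, 1, 2, 4 * G, 2, 4 * G + 2]) [0..<D * W]) @
    [2, 4 * ((D - 1) * W + v) + 3]"
proof -
  have "concat (map encode_gate (concat (map maj3_gates [0..<k]))) =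
    concat (map (\<lambda>G. let L = G div W; t = \<lambda>r. src_tag L (src L (G mod W) r); a = \<lambda>r. src_arg L (src L (G mod W) r)
      in [0, t 0, a 0, t 1, a 1, 1, t 0, a 0, t 1, a 1,
          0, 2, 4 * G + 1, t 2, a 2, 1, 2, 4 * G, 2, 4 * G + 2]) [0..<k])" for k
    by (induction k) (simp_all add: maj3_gates_def Let_def encode_source)
  then show ?thesis by (simp add: encode_circuit_def layered_circuit_def)
qed

end

section \<open>Functions computable in polynomial time\<close>

text \<open>The base is at least 2, so constants and sums can be absorbed into a larger
  exponent.\<close>

definition pbound :: "nat \<Rightarrow> (nat list \<Rightarrow> nat) \<Rightarrow> bool" where
  "pbound a f \<longleftrightarrow> (\<exists>C. \<forall>xs. length xs = a \<longrightarrow> f xs \<le> (sum_list xs + 2) ^ C)"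

lemma pbound_mono: "pbound a g \<Longrightarrow> (\<And>xs. length xs = a \<Longrightarrow> f xs \<le> g xs) \<Longrightarrow> pbound a f"
  unfolding pbound_def by (meson order_trans)

lemma pbound_const: "pbound a (\<lambda>_. c)"
  unfolding pbound_def
proof (intro exI allI impI)
  fix xs :: "nat list"
  have "c \<le> 2 ^ c" by (simp add: less_imp_le)
  also have "\<dots> \<le> (sum_list xs + 2) ^ c" by (intro power_mono) auto
  finally show "c \<le> (sum_list xs + 2) ^ c" .
qed

lemma pbound_add:
  assumes "pbound a f" "pbound a g"
  shows "pbound a (\<lambda>xs. f xs + g xs)"
proof -
  from assms obtain C D where C: "\<And>xs. length xs = a \<Longrightarrow> f xs \<le> (sum_list xs + 2) ^ C"
    and D: "\<And>xs. length xs = a \<Longrightarrow> g xs \<le> (sum_list xs + 2) ^ D"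
    unfolding pbound_def by blast
  have "f xs + g xs \<le> (sum_list xs + 2) ^ (Suc (C + D))" if "length xs = a" for xs
  proof -
    let ?s = "sum_list xs + 2"
    have "f xs \<le> ?s ^ (C + D)" "g xs \<le> ?s ^ (C + D)"
      using C[OF that] D[OF that] by (auto elim!: order_trans intro!: power_increasing)
    then have "f xs + g xs \<le> 2 * ?s ^ (C + D)" by linarith
    also have "\<dots> \<le> ?s ^ Suc (C + D)" by simp
    finally show ?thesis .
  qed
  then show ?thesis unfolding pbound_def by blast
qed

lemma pbound_mult:
  assumes "pbound a f" "pbound a g"
  shows "pbound a (\<lambda>xs. f xs * g xs)"
proof -
  from assms obtain C D where C: "\<And>xs. length xs = a \<Longrightarrow> f xs \<le> (sum_list xs + 2) ^ C"
    and D: "\<And>xs. length xs = a \<Longrightarrow> g xs \<le> (sum_list xs + 2) ^ D"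
    unfolding pbound_def by blast
  have "f xs * g xs \<le> (sum_list xs + 2) ^ (C + D)" if "length xs = a" for xs
    unfolding power_add using C[OF that] D[OF that] by (rule mult_le_mono)
  then show ?thesis unfolding pbound_def by blast
qed

lemma pbound_power: "pbound a f \<Longrightarrow> pbound a (\<lambda>xs. f xs ^ C)"
proof (induction C)
  case (Suc C)
  then show ?case unfolding power_Suc by (intro pbound_mult) auto
qed (simp add: pbound_const)

lemma pbound_sum_list: "pbound a sum_list"
  unfolding pbound_def by (intro exI[of _ 1]) simp

lemma pbound_nth: "i < a \<Longrightarrow> pbound a (\<lambda>xs. xs ! i)"
  by (rule pbound_mono[OF pbound_sum_list]) (simp add: elem_le_sum_list)

lemma pbound_sum_map:
  "(\<And>g. g \<in> set gs \<Longrightarrow> pbound a (T g)) \<Longrightarrow> pbound a (\<lambda>xs. sum_list (map (\<lambda>g. T g xs) gs))"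
  by (induction gs) (auto intro: pbound_const pbound_add)

lemma pbound_comp:
  assumes f: "pbound b f" and gs: "\<And>g. g \<in> set gs \<Longrightarrow> pbound a g" and len: "length gs = b"
  shows "pbound a (\<lambda>xs. f (map (\<lambda>g. g xs) gs))"
proof -
  have s: "pbound a (\<lambda>xs. sum_list (map (\<lambda>g. g xs) gs) + 2)"
    by (intro pbound_add pbound_const pbound_sum_map gs)
  have p: "pbound a (\<lambda>xs. (sum_list (map (\<lambda>g. g xs) gs) + 2) ^ C)" for C
    by (rule pbound_power[OF s])
  from f obtain C where "\<And>xs. length xs = b \<Longrightarrow> f xs \<le> (sum_list xs + 2) ^ C"
    unfolding pbound_def by blast
  then show ?thesis using len by (intro pbound_mono[OF p[of C]]) auto
qed

text \<open>
  The program reads its arguments from the registers \<open>is\<close>, all of them below \<open>b\<close>, and leaves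
  the result in register \<open>b\<close>; the registers above \<open>b\<close> are its scratch space.
\<close>

definition computes_fun :: "nat \<Rightarrow> (nat list \<Rightarrow> nat) \<Rightarrow> (nat list \<Rightarrow> nat) \<Rightarrow> (nat list \<Rightarrow> nat \<Rightarrow> prog) \<Rightarrow> bool" where
  "computes_fun a f T P \<longleftrightarrow> (\<forall>is b s. length is = a \<longrightarrow> (\<forall>i\<in>set is. i < b) \<longrightarrow>
     (\<exists>t s'. exec (P is b) s t s' \<and> t \<le> T (map (reg s) is) \<and> reg s' b = f (map (reg s) is) \<and>
        (\<forall>r<b. reg s' r = reg s r) \<and> arr s' = arr s \<and> tape s' = tape s))"

text \<open>Time alone would not bound the value, since addition at unit cost can double a register
  in every step. Compositions need both bounds.\<close>

definition ptime :: "nat \<Rightarrow> (nat list \<Rightarrow> nat) \<Rightarrow> bool" where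
  "ptime a f \<longleftrightarrow> pbound a f \<and> (\<exists>T P. pbound a T \<and> computes_fun a f T P)"

lemma ptimeI: "pbound a f \<Longrightarrow> pbound a T \<Longrightarrow> computes_fun a f T P \<Longrightarrow> ptime a f"
  unfolding ptime_def by blast

lemma ptime_pbound: "ptime a f \<Longrightarrow> pbound a f" by (simp add: ptime_def)

lemma computes_funD:
  assumes "computes_fun a f T P" "length is = a" "\<And>i. i \<in> set is \<Longrightarrow> i < b"
  obtains t s' where "exec (P is b) s t s'" "t \<le> T (map (reg s) is)" "reg s' b = f (map (reg s) is)"
        "\<And>r. r < b \<Longrightarrow> reg s' r = reg s r" "arr s' = arr s" "tape s' = tape s"
proof -
  have "\<exists>t s'. exec (P is b) s t s' \<and> t \<le> T (map (reg s) is) \<and> reg s' b = f (map (reg s) is) \<and>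
        (\<forall>r<b. reg s' r = reg s r) \<and> arr s' = arr s \<and> tape s' = tape s"
    using assms unfolding computes_fun_def by blast
  then show ?thesis using that by blast
qed

lemma ptime_cong:
  assumes "ptime a f" "\<And>xs. length xs = a \<Longrightarrow> f xs = g xs"
  shows "ptime a g"
proof -
  have "pbound a g" using assms by (auto simp: ptime_def pbound_def)
  moreover have "computes_fun a f T P \<longleftrightarrow> computes_fun a g T P" for T P
    using assms(2) by (simp add: computes_fun_def)
  ultimately show ?thesis using assms by (auto simp: ptime_def)
qed

section \<open>Projections, composition and primitive recursion\<close>

lemma exec_AssignI:
  "t = 1 + expr_time e \<Longrightarrow> s' = s\<lparr>reg := (reg s)(x := expr_val e s)\<rparr> \<Longrightarrow> exec (Assign x e) s t s'"
  by (simp only: exec.Assign)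

lemma ptime_expr:
  assumes b: "pbound a f"
    and e: "\<And>is s. length is = a \<Longrightarrow> expr_val (e is) s = f (map (reg s) is) \<and> expr_time (e is) \<le> c"
  shows "ptime a f"
proof (rule ptimeI[OF b pbound_const[of a "1 + c"]])
  show "computes_fun a f (\<lambda>_. 1 + c) (\<lambda>is b. Assign b (e is))"
    unfolding computes_fun_def
  proof (intro allI impI)
    fix "is" :: "nat list" and b :: nat and s :: state assume *: "length is = a" "\<forall>i\<in>set is. i < b"
    show "\<exists>t s'. exec (Assign b (e is)) s t s' \<and> t \<le> 1 + c \<and> reg s' b = f (map (reg s) is) \<and>
        (\<forall>r<b. reg s' r = reg s r) \<and> arr s' = arr s \<and> tape s' = tape s"
      using exec.Assign[of b "e is" s] e[OF *(1), of s] *(2) by fastforce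
  qed
qed

lemma ptime_const: "ptime a (\<lambda>_. c)"
  by (rule ptime_expr[where e = "\<lambda>_. Num c" and c = 1]) (auto intro: pbound_const)

lemma ptime_nth: "i < a \<Longrightarrow> ptime a (\<lambda>xs. xs ! i)"
  by (rule ptime_expr[where e = "\<lambda>is. Reg (is ! i)" and c = 1]) (auto intro: pbound_nth)

lemma ptime_add0: "ptime 2 (\<lambda>xs. xs ! 0 + xs ! 1)"
  by (rule ptime_expr[where e = "\<lambda>is. Plus (Reg (is ! 0)) (Reg (is ! 1))" and c = 3])
    (auto intro!: pbound_add pbound_nth)

lemma ptime_sub0: "ptime 2 (\<lambda>xs. xs ! 0 - xs ! 1)"
  by (rule ptime_expr[where e = "\<lambda>is. Minus (Reg (is ! 0)) (Reg (is ! 1))" and c = 3])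
    (auto intro!: pbound_mono[OF pbound_nth[of 0]])

text \<open>The base register rises with each program, so the results land in consecutive registers,
  below the scratch space of the later programs.\<close>

fun run_all :: "(nat list \<Rightarrow> nat \<Rightarrow> prog) list \<Rightarrow> nat list \<Rightarrow> nat \<Rightarrow> prog" where
  "run_all [] is b = Assign b (Num 0)"
| "run_all (P # Ps) is b = Seq (P is b) (run_all Ps is (Suc b))"

lemma exec_run_all:
  assumes "list_all2 (\<lambda>(g, T) P. computes_fun a g T P) gTs Ps" "length is = a" "\<And>i. i \<in> set is \<Longrightarrow> i < b"
  shows "\<exists>t s'. exec (run_all Ps is b) s t s' \<and> t \<le> sum_list (map (\<lambda>(g, T). T (map (reg s) is)) gTs) + 2 \<and>
     (\<forall>j<length gTs. reg s' (b + j) = fst (gTs ! j) (map (reg s) is)) \<and>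
     (\<forall>r<b. reg s' r = reg s r) \<and> arr s' = arr s \<and> tape s' = tape s"
  using assms(1,3)
proof (induction gTs Ps arbitrary: b s rule: list_all2_induct)
  case Nil
  show ?case by (intro exI conjI, simp, rule exec.Assign) auto
next
  case (Cons gT gTs P Ps)
  obtain g T where gT: "gT = (g, T)" by force
  with Cons have c: "computes_fun a g T P" by simp
  from computes_funD[OF c assms(2) Cons.prems, where s = s]
  obtain t s' where 1: "exec (P is b) s t s'" "t \<le> T (map (reg s) is)" "reg s' b = g (map (reg s) is)"
    "\<And>r. r < b \<Longrightarrow> reg s' r = reg s r" "arr s' = arr s" "tape s' = tape s" by metis
  have m: "map (reg s') is = map (reg s) is" using 1(4) Cons.prems by auto
  from Cons.IH[of "Suc b" s'] Cons.prems less_SucI obtain t' s'' where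
    2: "exec (run_all Ps is (Suc b)) s' t' s''" "t' \<le> sum_list (map (\<lambda>(g, T). T (map (reg s) is)) gTs) + 2"
      "\<forall>j<length gTs. reg s'' (Suc b + j) = fst (gTs ! j) (map (reg s) is)"
      "\<forall>r<Suc b. reg s'' r = reg s' r" "arr s'' = arr s'" "tape s'' = tape s'"
    unfolding m by metis
  have "reg s'' (b + j) = fst ((gT # gTs) ! j) (map (reg s) is)" if "j < length (gT # gTs)" for j
    using that 1(3) 2(3,4) by (cases j) (auto simp: gT)
  with 1 2 show ?case
    by (intro exI[of _ "t + t'"] exI[of _ s'']) (auto simp: gT intro: exec.Seq)
qed

lemma ptime_comp:
  assumes f: "ptime b f" and gs: "\<And>g. g \<in> set gs \<Longrightarrow> ptime a g" and len: "length gs = b"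
  shows "ptime a (\<lambda>xs. f (map (\<lambda>g. g xs) gs))"
proof -
  from f obtain Tf Pf where f': "pbound b f" "pbound b Tf" "computes_fun b f Tf Pf"
    unfolding ptime_def by blast
  have "\<forall>g\<in>set gs. \<exists>TP. pbound a (fst TP) \<and> computes_fun a g (fst TP) (snd TP)"
    using gs unfolding ptime_def by auto
  then obtain F where F: "\<forall>g\<in>set gs. pbound a (fst (F g)) \<and> computes_fun a g (fst (F g)) (snd (F g))"
    by (rule bchoice[THEN exE])
  define T where "T = fst \<circ> F"
  define P where "P = snd \<circ> F"
  have TP: "\<And>g. g \<in> set gs \<Longrightarrow> pbound a (T g)"
      "\<And>g. g \<in> set gs \<Longrightarrow> computes_fun a g (T g) (P g)"
    using F by (auto simp: T_def P_def)
  define gTs where "gTs = map (\<lambda>g. (g, T g)) gs"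
  have la: "list_all2 (\<lambda>(g, T) P. computes_fun a g T P) gTs (map P gs)"
    unfolding gTs_def using TP(2) by (auto simp: list_all2_conv_all_nth)
  \<comment> \<open>Of the 4, two pay for the closing assignment of \<open>run_all\<close> and two
    for copying the result down to register \<open>c\<close>.\<close>
  define TT where "TT = (\<lambda>xs. sum_list (map (\<lambda>g. T g xs) gs) + (Tf (map (\<lambda>g. g xs) gs) + 4))"
  have s: "pbound a (\<lambda>xs. sum_list (map (\<lambda>g. T g xs) gs))"
    by (intro pbound_sum_map TP)
  have "pbound a TT" unfolding TT_def
    by (rule pbound_add[OF s pbound_add[OF pbound_comp[OF f'(2) ptime_pbound[OF gs] len] pbound_const]])
  moreover have "pbound a (\<lambda>xs. f (map (\<lambda>g. g xs) gs))"
    by (rule pbound_comp[OF f'(1) ptime_pbound[OF gs] len])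
  moreover have "computes_fun a (\<lambda>xs. f (map (\<lambda>g. g xs) gs)) TT
    (\<lambda>is c. Seq (run_all (map P gs) is c) (Seq (Pf [c..<c + b] (c + b)) (Assign c (Reg (c + b)))))"
    (is "computes_fun _ _ _ ?PP")
    unfolding computes_fun_def
  proof (intro allI impI)
    fix "is" :: "nat list" and c :: nat and s :: state assume *: "length is = a" "\<forall>i\<in>set is. i < c"
    let ?xs = "map (reg s) is"
    from exec_run_all[OF la *(1), of c s] *(2) obtain t s' where
      1: "exec (run_all (map P gs) is c) s t s'" "t \<le> sum_list (map (\<lambda>g. T g ?xs) gs) + 2"
      "\<forall>j<b. reg s' (c + j) = (gs ! j) ?xs" "\<forall>r<c. reg s' r = reg s r" "arr s' = arr s" "tape s' = tape s"
      by (auto simp: gTs_def len comp_def)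
    have m: "map (reg s') [c..<c + b] = map (\<lambda>g. g ?xs) gs"
      using 1(3) len by (intro nth_equalityI) auto
    obtain t' s'' where 2: "exec (Pf [c..<c + b] (c + b)) s' t' s''" "t' \<le> Tf (map (\<lambda>g. g ?xs) gs)"
      "reg s'' (c + b) = f (map (\<lambda>g. g ?xs) gs)" "\<And>r. r < c + b \<Longrightarrow> reg s'' r = reg s' r"
      "arr s'' = arr s'" "tape s'' = tape s'"
      using computes_funD[OF f'(3), of "[c..<c + b]" "c + b" s'] unfolding m by auto
    have 3: "exec (Assign c (Reg (c + b))) s'' (1 + expr_time (Reg (c + b)))
       (s''\<lparr>reg := (reg s'')(c := expr_val (Reg (c + b)) s'')\<rparr>)" by (rule exec.Assign)
    show "\<exists>t s'. exec (?PP is c) s t s' \<and> t \<le> TT ?xs \<and> reg s' c = f (map (\<lambda>g. g ?xs) gs) \<and>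
        (\<forall>r<c. reg s' r = reg s r) \<and> arr s' = arr s \<and> tape s' = tape s"
      by (intro exI conjI, rule exec.Seq[OF 1(1) exec.Seq[OF 2(1) 3]]) (use 1 2 in \<open>auto simp: TT_def\<close>)
  qed
  ultimately show ?thesis using ptimeI by blast
qed

lemma ptime_comp1: "ptime 1 f \<Longrightarrow> ptime a g \<Longrightarrow> ptime a (\<lambda>xs. f [g xs])"
  using ptime_comp[of 1 f "[g]" a] by auto

lemma ptime_comp2: "ptime 2 f \<Longrightarrow> ptime a g \<Longrightarrow> ptime a h \<Longrightarrow> ptime a (\<lambda>xs. f [g xs, h xs])"
  using ptime_comp[of 2 f "[g, h]" a] by auto

lemma ptime_add: "ptime a g \<Longrightarrow> ptime a h \<Longrightarrow> ptime a (\<lambda>xs. g xs + h xs)"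
  using ptime_comp2[OF ptime_add0] by simp

lemma ptime_sub: "ptime a g \<Longrightarrow> ptime a h \<Longrightarrow> ptime a (\<lambda>xs. g xs - h xs)"
  using ptime_comp2[OF ptime_sub0] by simp

text \<open>Iterating a polynomially bounded step can grow exponentially, hence the separate
  hypothesis on the values of \<open>f\<close>. It keeps the arguments of every call of
  \<open>h\<close> polynomial.\<close>

lemma ptime_rec:
  assumes g: "ptime a g" and h: "ptime (Suc (Suc a)) h"
    and f0: "\<And>xs. length xs = a \<Longrightarrow> f 0 xs = g xs"
    and fS: "\<And>i xs. length xs = a \<Longrightarrow> f (Suc i) xs = h (i # f i xs # xs)"
    and fb: "pbound (Suc a) (\<lambda>xs. f (hd xs) (tl xs))"
  shows "ptime (Suc a) (\<lambda>xs. f (hd xs) (tl xs))"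
proof -
  from g obtain Tg Pg where g': "pbound a Tg" "computes_fun a g Tg Pg"
    unfolding ptime_def by blast
  from h obtain Th Ph where h': "pbound (Suc (Suc a)) Th" "computes_fun (Suc (Suc a)) h Th Ph"
    unfolding ptime_def by blast
  from fb obtain B where B: "\<And>xs. length xs = Suc a \<Longrightarrow> f (hd xs) (tl xs) \<le> (sum_list xs + 2) ^ B"
    unfolding pbound_def by blast
  from h'(1) obtain H where H: "\<And>xs. length xs = Suc (Suc a) \<Longrightarrow> Th xs \<le> (sum_list xs + 2) ^ H"
    unfolding pbound_def by blast
  \<comment> \<open>One bound for the time of all \<open>n\<close> calls of \<open>h\<close>: the
    counter stays below \<open>n\<close> and the accumulator below the \<open>B\<close>-th
    power.\<close>
  define step :: "nat \<Rightarrow> nat list \<Rightarrow> nat" where "step = (\<lambda>n xs. (n + ((n + sum_list xs + 2) ^ B) + sum_list xs + 2) ^ H)"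
  define loop :: "nat \<Rightarrow> nat list \<Rightarrow> nat \<Rightarrow> prog" where "loop = (\<lambda>x is b. While (Minus (Reg x) (Reg (b + 1)))
     (Seq (Ph ((b + 1) # b # is) (b + 2)) (Seq (Assign b (Reg (b + 2))) (Assign (b + 1) (Plus (Reg (b + 1)) (Num 1))))))"
  \<comment> \<open>Register \<open>b\<close> accumulates and \<open>b + 1\<close> counts. Per
    iteration, 10 is 4 for the test and 2 + 4 for the two assignments; the last 4 is the failing
    test.\<close>
  have loop: "\<exists>t s'. exec (loop x is b) s t s' \<and> t \<le> k * (step n ys + 10) + 4 \<and>
      reg s' b = f n ys \<and> (\<forall>r<b. reg s' r = reg s r) \<and> arr s' = arr s \<and> tape s' = tape s"
    if "length is = a" "\<And>i. i \<in> set is \<Longrightarrow> i < b" "x < b" "reg s x = n" "map (reg s) is = ys"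
      "reg s (b + 1) + k = n" "reg s b = f (reg s (b + 1)) ys"
    for x "is" b n ys k and s :: state
    using that
  proof (induction k arbitrary: s)
    case 0
    have "exec (loop x is b) s (1 + expr_time (Minus (Reg x) (Reg (b + 1)))) s"
      unfolding loop_def using 0 by (intro exec.WhileFalse) auto
    then show ?case using 0 by (intro exI conjI) auto
  next
    case (Suc k)
    define i where "i = reg s (b + 1)"
    have lys: "length ys = a" using Suc.prems by auto
    obtain t s1 where 1: "exec (Ph ((b + 1) # b # is) (b + 2)) s t s1"
      "t \<le> Th (i # f i ys # ys)" "reg s1 (b + 2) = h (i # f i ys # ys)"
      "\<And>r. r < b + 2 \<Longrightarrow> reg s1 r = reg s r" "arr s1 = arr s" "tape s1 = tape s"
      using computes_funD[OF h'(2), of "(b + 1) # b # is" "b + 2" s] Suc.prems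
      by (auto simp: i_def less_Suc_eq)
    define s2 where "s2 = s1\<lparr>reg := (reg s1)(b := expr_val (Reg (b + 2)) s1)\<rparr>"
    define s3 where "s3 = s2\<lparr>reg := (reg s2)(b + 1 := expr_val (Plus (Reg (b + 1)) (Num 1)) s2)\<rparr>"
    have 2: "exec (Assign b (Reg (b + 2))) s1 2 s2" "exec (Assign (b + 1) (Plus (Reg (b + 1)) (Num 1))) s2 4 s3"
      by (auto simp: s2_def s3_def intro!: exec_AssignI)
    have r: "\<And>r. r < b \<Longrightarrow> reg s3 r = reg s r" "arr s3 = arr s" "tape s3 = tape s" "reg s3 (b + 1) = Suc i"
      "reg s3 b = f (Suc i) ys"
      using 1 fS[OF lys] by (auto simp: s3_def s2_def i_def)
    have "map (reg s3) is = ys" using r(1) Suc.prems by auto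
    moreover have "reg s3 x = n" using r(1) Suc.prems by auto
    ultimately obtain t' s' where 3: "exec (loop x is b) s3 t' s'" "t' \<le> k * (step n ys + 10) + 4"
      "reg s' b = f n ys" "\<forall>r<b. reg s' r = reg s3 r" "arr s' = arr s3" "tape s' = tape s3"
      using Suc.IH[of s3] Suc.prems r by (auto simp: i_def)
    have "exec (loop x is b) s (1 + expr_time (Minus (Reg x) (Reg (b + 1))) + (t + (2 + 4)) + t') s'"
      unfolding loop_def using Suc.prems
      by (intro exec.WhileTrue[OF _ exec.Seq[OF 1(1) exec.Seq[OF 2]]] 3(1)[unfolded loop_def]) auto
    moreover have "t \<le> step n ys"
    proof -
      have i: "i < n" using Suc.prems by (auto simp: i_def)
      have "f i ys \<le> (i + sum_list ys + 2) ^ B" using B[of "i # ys"] lys by simp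
      also have "\<dots> \<le> (n + sum_list ys + 2) ^ B" using i by (intro power_mono) auto
      finally have "i + (f i ys + sum_list ys) + 2 \<le> n + (n + sum_list ys + 2) ^ B + sum_list ys + 2"
        using i by simp
      then have "(i + (f i ys + sum_list ys) + 2) ^ H \<le> step n ys"
        unfolding step_def by (intro power_mono) auto
      then show ?thesis using 1(2) H[of "i # f i ys # ys"] lys by simp
    qed
    ultimately show ?case using 3 r by (intro exI[of _ "_ + t'"] exI[of _ s']) auto
  qed
  define TT where "TT = (\<lambda>xs. Tg (tl xs) + (hd xs * (step (hd xs) (tl xs) + 10) + 10))"
  have tl: "pbound (Suc a) (\<lambda>xs. q (tl xs))" if "pbound a q" for q
  proof -
    from that obtain C where C: "\<And>xs. length xs = a \<Longrightarrow> q xs \<le> (sum_list xs + 2) ^ C"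
      unfolding pbound_def by blast
    have "q (tl xs) \<le> (sum_list xs + 2) ^ C" if "length xs = Suc a" for xs
    proof -
      have "q (tl xs) \<le> (sum_list (tl xs) + 2) ^ C" using C that by simp
      also have "\<dots> \<le> (sum_list xs + 2) ^ C" using that by (intro power_mono) (cases xs; auto)+
      finally show ?thesis .
    qed
    then show ?thesis unfolding pbound_def by blast
  qed
  have hd: "pbound (Suc a) hd"
    by (rule pbound_mono[OF pbound_nth[of 0]]) (auto simp: length_Suc_conv)
  have "pbound (Suc a) TT" unfolding TT_def step_def
    by (rule pbound_add[OF tl[OF g'(1)] pbound_add[OF pbound_mult[OF hd pbound_add[OF pbound_power pbound_const]] pbound_const]])
      (intro pbound_add pbound_power hd tl pbound_sum_list pbound_const)
  moreover have "computes_fun (Suc a) (\<lambda>xs. f (hd xs) (tl xs)) TT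
    (\<lambda>is b. Seq (Pg (tl is) b) (Seq (Assign (b + 1) (Num 0)) (loop (hd is) (tl is) b)))"
    (is "computes_fun _ _ _ ?PP")
    unfolding computes_fun_def
  proof (intro allI impI)
    fix "is" :: "nat list" and b :: nat and s :: state assume *: "length is = Suc a" "\<forall>i\<in>set is. i < b"
    obtain x js where js: "is = x # js" "length js = a" using *(1) by (cases "is") auto
    obtain t s1 where 1: "exec (Pg js b) s t s1" "t \<le> Tg (map (reg s) js)" "reg s1 b = g (map (reg s) js)"
      "\<And>r. r < b \<Longrightarrow> reg s1 r = reg s r" "arr s1 = arr s" "tape s1 = tape s"
      using computes_funD[OF g'(2) js(2), of b s] *(2) js by auto
    define s2 where "s2 = s1\<lparr>reg := (reg s1)(b + 1 := expr_val (Num 0) s1)\<rparr>"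
    have 2: "exec (Assign (b + 1) (Num 0)) s1 2 s2"
      by (auto simp: s2_def intro!: exec_AssignI)
    have m: "map (reg s2) js = map (reg s) js" "reg s2 x = reg s x"
      using 1(4) *(2) js by (auto simp: s2_def)
    obtain t' s' where 3: "exec (loop x js b) s2 t' s'"
      "t' \<le> reg s x * (step (reg s x) (map (reg s) js) + 10) + 4"
      "reg s' b = f (reg s x) (map (reg s) js)" "\<forall>r<b. reg s' r = reg s2 r" "arr s' = arr s2" "tape s' = tape s2"
      using loop[of js b x s2 "reg s x" "map (reg s) js" "reg s x"] m js *(2) 1 f0
      by (auto simp: s2_def)
    show "\<exists>t s'. exec (?PP is b) s t s' \<and> t \<le> TT (map (reg s) is) \<and>
        reg s' b = f (hd (map (reg s) is)) (tl (map (reg s) is)) \<and>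
        (\<forall>r<b. reg s' r = reg s r) \<and> arr s' = arr s \<and> tape s' = tape s"
      using exec.Seq[OF 1(1) exec.Seq[OF 2 3(1)]] 1 3 js
      by (intro exI[of _ "t + (2 + t')"] exI[of _ s']) (auto simp: TT_def s2_def)
  qed
  ultimately show ?thesis by (intro ptimeI fb)
qed


subsection \<open>Arithmetic\<close>

abbreviation pdec :: "nat \<Rightarrow> (nat list \<Rightarrow> bool) \<Rightarrow> bool" where
  "pdec a P \<equiv> ptime a (\<lambda>xs. of_bool (P xs))"

lemma ptime_nth_tl: "Suc i < a \<Longrightarrow> ptime a (\<lambda>xs. tl xs ! i)"
  by (rule ptime_cong[OF ptime_nth[of "Suc i"]]) (auto simp: nth_tl)

lemma ptime_mult0: "ptime 2 (\<lambda>xs. xs ! 0 * xs ! 1)"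
proof -
  have "ptime (Suc 1) (\<lambda>xs. (\<lambda>i ys. i * ys ! 0) (hd xs) (tl xs))"
  proof (rule ptime_rec)
    show "ptime (Suc (Suc 1)) (\<lambda>xs. xs ! 1 + xs ! 2)"
      by (intro ptime_add ptime_nth) auto
    show "pbound (Suc 1) (\<lambda>xs. hd xs * tl xs ! 0)"
      by (rule pbound_mono[OF pbound_mult[OF pbound_nth[of 0] pbound_nth[of 1]]])
        (auto simp: length_Suc_conv)
  qed (auto intro: ptime_const)
  then have "ptime 2 (\<lambda>xs. hd xs * tl xs ! 0)" by (simp add: numeral_2_eq_2)
  then show ?thesis
    by (rule ptime_cong) (auto simp: length_Suc_conv numeral_2_eq_2)
qed

lemma ptime_mult: "ptime a g \<Longrightarrow> ptime a h \<Longrightarrow> ptime a (\<lambda>xs. g xs * h xs)"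
  using ptime_comp2[OF ptime_mult0] by simp

lemma ptime_power_const: "ptime a g \<Longrightarrow> ptime a (\<lambda>xs. g xs ^ C)"
proof (induction C)
  case (Suc C)
  then show ?case unfolding power_Suc by (intro ptime_mult) auto
qed (simp add: ptime_const)

lemma pdec_less: "ptime a g \<Longrightarrow> ptime a h \<Longrightarrow> pdec a (\<lambda>xs. g xs < h xs)"
  by (rule ptime_cong[where f = "\<lambda>xs. 1 - (1 - (h xs - g xs))"])
    (auto intro!: ptime_sub ptime_const)

lemma pdec_not: "pdec a P \<Longrightarrow> pdec a (\<lambda>xs. \<not> P xs)"
  by (rule ptime_cong[where f = "\<lambda>xs. 1 - of_bool (P xs)"])
    (auto intro!: ptime_sub ptime_const)

lemma pdec_le: "ptime a g \<Longrightarrow> ptime a h \<Longrightarrow> pdec a (\<lambda>xs. g xs \<le> h xs)"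
  using pdec_not[OF pdec_less[of a h g]] by (simp add: not_less)

lemma pdec_conj: "pdec a P \<Longrightarrow> pdec a Q \<Longrightarrow> pdec a (\<lambda>xs. P xs \<and> Q xs)"
  by (rule ptime_cong[where f = "\<lambda>xs. of_bool (P xs) * of_bool (Q xs)"])
    (auto intro!: ptime_mult)

lemma pdec_eq: "ptime a g \<Longrightarrow> ptime a h \<Longrightarrow> pdec a (\<lambda>xs. g xs = h xs)"
  using pdec_conj[OF pdec_le[of a g h] pdec_le[of a h g]] by (simp add: eq_iff)

lemma ptime_if: "pdec a P \<Longrightarrow> ptime a g \<Longrightarrow> ptime a h \<Longrightarrow> ptime a (\<lambda>xs. if P xs then g xs else h xs)"
  by (rule ptime_cong[where f = "\<lambda>xs. of_bool (P xs) * g xs + of_bool (\<not> P xs) * h xs"])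
    (auto intro!: ptime_add ptime_mult pdec_not)

lemma ptime_min: "ptime a g \<Longrightarrow> ptime a h \<Longrightarrow> ptime a (\<lambda>xs. min (g xs) (h xs))"
  unfolding min_def by (intro ptime_if pdec_le)

lemma map_nth_upt: "length xs = a \<Longrightarrow> map (\<lambda>i. xs ! i) [0..<a] = xs"
  using map_nth[of xs] by auto

lemma ptime_comp_cons:
  assumes "ptime (Suc a) f" "ptime a g"
  shows "ptime a (\<lambda>xs. f (g xs # xs))"
proof -
  have "ptime a (\<lambda>xs. f (map (\<lambda>g. g xs) (g # map (\<lambda>i xs. xs ! i) [0..<a])))"
    using assms by (intro ptime_comp[of "Suc a"]) (auto intro: ptime_nth)
  then show ?thesis
    by (rule ptime_cong) (simp add: map_nth_upt comp_def)
qed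

lemma ptime_tl: "ptime a f \<Longrightarrow> ptime (Suc a) (\<lambda>xs. f (tl xs))"
proof -
  assume f: "ptime a f"
  have "ptime (Suc a) (\<lambda>xs. f (map (\<lambda>g. g xs) (map (\<lambda>i xs. xs ! Suc i) [0..<a])))"
    using f by (intro ptime_comp[of a]) (auto intro: ptime_nth)
  then show ?thesis
    by (rule ptime_cong) (auto simp: comp_def length_Suc_conv map_nth_upt)
qed

lemma ptime_sum:
  assumes f: "ptime (Suc a) (\<lambda>ys. f (ys ! 0) (tl ys))" and g: "ptime a g"
  shows "ptime a (\<lambda>xs. \<Sum>i<g xs. f i xs)"
proof -
  define F where "F = (\<lambda>i xs. \<Sum>j<i. f j xs)"
  have "ptime (Suc a) (\<lambda>xs. F (hd xs) (tl xs))"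
  proof (rule ptime_rec)
    have "ptime (Suc (Suc a)) (\<lambda>xs. (\<lambda>ys. f (ys ! 0) (tl ys)) (map (\<lambda>g. g xs) ((\<lambda>xs. xs ! 0) # map (\<lambda>i xs. xs ! Suc (Suc i)) [0..<a])))"
      by (rule ptime_comp[OF f]) (auto intro: ptime_nth)
    then have "ptime (Suc (Suc a)) (\<lambda>xs. f (xs ! 0) (tl (tl xs)))"
      by (rule ptime_cong) (auto simp: comp_def length_Suc_conv map_nth_upt)
    then show "ptime (Suc (Suc a)) (\<lambda>xs. xs ! 1 + f (xs ! 0) (tl (tl xs)))"
      by (intro ptime_add ptime_nth) auto
    from ptime_pbound[OF f] obtain C where C: "\<And>xs. length xs = Suc a \<Longrightarrow> f (xs ! 0) (tl xs) \<le> (sum_list xs + 2) ^ C"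
      unfolding pbound_def by blast
    have F: "F (hd xs) (tl xs) \<le> xs ! 0 * (sum_list xs + 2) ^ C" if len: "length xs = Suc a" for xs
    proof -
      obtain i ys where xs: "xs = i # ys" "length ys = a" using len by (auto simp: length_Suc_conv)
      have "f j ys \<le> (sum_list xs + 2) ^ C" if "j < i" for j
      proof -
        have "f j ys \<le> (sum_list (j # ys) + 2) ^ C" using C[of "j # ys"] xs by simp
        also have "\<dots> \<le> (sum_list xs + 2) ^ C" using that xs by (intro power_mono) auto
        finally show ?thesis .
      qed
      then have "F i ys \<le> (\<Sum>j<i. (sum_list xs + 2) ^ C)"
        unfolding F_def by (intro sum_mono) auto
      then show ?thesis by (simp add: xs)
    qed
    have "pbound (Suc a) (\<lambda>xs. xs ! 0 * (sum_list xs + 2) ^ C)"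
      by (intro pbound_mult pbound_nth pbound_power pbound_add pbound_sum_list pbound_const) simp
    then show "pbound (Suc a) (\<lambda>xs. F (hd xs) (tl xs))"
      by (rule pbound_mono) (rule F)
  qed (auto simp: F_def intro: ptime_const)
  from ptime_comp_cons[OF this g] show ?thesis by (simp add: F_def)
qed

lemma pdec_ball:
  assumes f: "pdec (Suc a) (\<lambda>ys. P (ys ! 0) (tl ys))" and g: "ptime a g"
  shows "pdec a (\<lambda>xs. \<forall>i<g xs. P i xs)"
proof (rule ptime_cong)
  show "pdec a (\<lambda>xs. (\<Sum>i<g xs. of_bool (\<not> P i xs)) = (0::nat))"
    by (intro pdec_eq ptime_const ptime_sum pdec_not f g)
qed auto

text \<open>The least witness is the number of indices with no witness at or below them, which turns
  bounded search into a bounded sum.\<close>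

lemma ptime_Least:
  assumes f: "pdec (Suc a) (\<lambda>ys. P (ys ! 0) (tl ys))" and g: "ptime a g"
    and ex: "\<And>xs. length xs = a \<Longrightarrow> \<exists>i\<le>g xs. P i xs"
  shows "ptime a (\<lambda>xs. LEAST i. P i xs)"
proof (rule ptime_cong)
  have "pdec (Suc (Suc a)) (\<lambda>ys. P (ys ! 0) (tl (tl ys)))"
  proof -
    have "ptime (Suc (Suc a)) (\<lambda>xs. (\<lambda>ys. of_bool (P (ys ! 0) (tl ys))) (map (\<lambda>g. g xs) ((\<lambda>xs. xs ! 0) # map (\<lambda>i xs. xs ! Suc (Suc i)) [0..<a])))"
      by (rule ptime_comp[OF f]) (auto intro: ptime_nth)
    then show ?thesis
      by (rule ptime_cong) (auto simp: comp_def length_Suc_conv map_nth_upt)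
  qed
  then show "ptime a (\<lambda>xs. \<Sum>i<g xs. of_bool (\<forall>j<i + 1. \<not> P j xs))"
    by (intro ptime_sum pdec_ball pdec_not ptime_add ptime_nth ptime_const g) auto
  fix xs :: "nat list" assume "length xs = a"
  with ex obtain i where i: "i \<le> g xs" "P i xs" by blast
  define L where "L = (LEAST i. P i xs)"
  have L: "P L xs" "\<And>j. j < L \<Longrightarrow> \<not> P j xs" "L \<le> i"
    unfolding L_def using i(2) by (auto intro: LeastI Least_le dest: not_less_Least)
  have "(\<Sum>i<g xs. of_bool (\<forall>j<i + 1. \<not> P j xs)) = (\<Sum>i<g xs. of_bool (i < L) :: nat)"
  proof (intro sum.cong refl arg_cong[where f = of_bool] iffI)
    fix i assume "\<forall>j<i + 1. \<not> P j xs"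
    with L(1) show "i < L" by (meson less_add_one not_less order_le_less_trans)
  qed (use L(2) in auto)
  also have "\<dots> = L" using L(3) i(1) by (simp add: sum_of_bool_less)
  finally show "(\<Sum>i<g xs. of_bool (\<forall>j<i + 1. \<not> P j xs)) = (LEAST i. P i xs)"
    by (simp add: L_def)
qed

text \<open>The quotient counts the positive multiples of the divisor up to the dividend; the
  conjunct \<open>0 < xs ! 1\<close> reproduces division by zero.\<close>

lemma ptime_div: "ptime a g \<Longrightarrow> ptime a h \<Longrightarrow> ptime a (\<lambda>xs. g xs div h xs)"
proof -
  assume gh: "ptime a g" "ptime a h"
  have "ptime 2 (\<lambda>xs. \<Sum>i<xs ! 0. of_bool (0 < xs ! 1 \<and> (i + 1) * xs ! 1 \<le> xs ! 0))"
    by (intro ptime_sum pdec_conj pdec_less pdec_le ptime_mult ptime_add ptime_const ptime_nth ptime_nth_tl) auto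
  moreover have "(\<Sum>i<x. of_bool (0 < y \<and> (i + 1) * y \<le> x)) = x div y" for x y :: nat
  proof (cases "y = 0")
    case False
    have "(\<Sum>i<x. of_bool (0 < y \<and> (i + 1) * y \<le> x)) = (\<Sum>i<x. of_bool (i < x div y) :: nat)"
      using False by (intro sum.cong refl) (simp add: less_eq_div_iff_mult_less_eq flip: Suc_le_eq)
    also have "\<dots> = x div y" by (simp add: sum_of_bool_less)
    finally show ?thesis by simp
  qed simp
  ultimately have "ptime 2 (\<lambda>xs. xs ! 0 div xs ! 1)" by simp
  from ptime_comp2[OF this gh] show ?thesis by simp
qed

lemma ptime_mod: "ptime a g \<Longrightarrow> ptime a h \<Longrightarrow> ptime a (\<lambda>xs. g xs mod h xs)"
  unfolding minus_mult_div_eq_mod[symmetric]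
  by (intro ptime_sub ptime_mult ptime_div)

text \<open>Capping after every multiplication keeps the intermediate values polynomial even where
  the full power is not.\<close>

lemma ptime_min_power:
  assumes "ptime a f" "ptime a g" "ptime a h"
  shows "ptime a (\<lambda>xs. min (f xs ^ g xs) (h xs))"
proof -
  have "ptime (Suc 2) (\<lambda>xs. (\<lambda>i ys. min (ys ! 0 ^ i) (ys ! 1)) (hd xs) (tl xs))"
  proof (rule ptime_rec)
    show "ptime 2 (\<lambda>xs. min 1 (xs ! 1))"
      by (intro ptime_min ptime_nth ptime_const) auto
    show "ptime (Suc (Suc 2)) (\<lambda>xs. min (xs ! 2 * xs ! 1) (xs ! 3))"
      by (intro ptime_min ptime_mult ptime_nth) auto
    show "pbound (Suc 2) (\<lambda>xs. min (tl xs ! 0 ^ hd xs) (tl xs ! 1))"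
      by (rule pbound_mono[OF ptime_pbound[OF ptime_nth_tl[of 1]]]) auto
    fix i and xs :: "nat list"
    have "min (x ^ Suc i) b = min (x * min (x ^ i) b) b" for x b :: nat
    proof (cases "x = 0")
      case False
      then have "b \<le> x * b" "x ^ i \<le> x * x ^ i" by simp_all
      then show ?thesis
        using order_trans[of b "x ^ i" "x * x ^ i"]
        by (cases "x ^ i \<le> b") (simp_all add: min_absorb1 min_absorb2 not_le del: mult_le_cancel2)
    qed simp
    then show "min (xs ! 0 ^ Suc i) (xs ! 1) =
      min ((i # min (xs ! 0 ^ i) (xs ! 1) # xs) ! 2 * (i # min (xs ! 0 ^ i) (xs ! 1) # xs) ! 1)
          ((i # min (xs ! 0 ^ i) (xs ! 1) # xs) ! 3)"
      by (simp add: numeral_2_eq_2 numeral_3_eq_3)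
  qed simp
  then have "ptime 3 (\<lambda>xs. min (tl xs ! 0 ^ hd xs) (tl xs ! 1))" by simp
  from ptime_comp[OF this, of "[g, f, h]" a] assms show ?thesis by auto
qed

lemma ptime_sum_list: "ptime a sum_list"
proof (rule ptime_cong)
  show "ptime a (\<lambda>xs. \<Sum>i<a. xs ! i)"
  proof -
    have "k \<le> a \<Longrightarrow> ptime a (\<lambda>xs. \<Sum>i<k. xs ! i)" for k
      by (induction k) (auto intro!: ptime_const ptime_add ptime_nth)
    then show ?thesis by simp
  qed
qed (simp add: sum_list_sum_nth atLeast0LessThan)

lemma ptime_power:
  assumes "ptime a f" "ptime a g" "pbound a (\<lambda>xs. f xs ^ g xs)"
  shows "ptime a (\<lambda>xs. f xs ^ g xs)"
proof -
  from assms(3) obtain C where C: "\<And>xs. length xs = a \<Longrightarrow> f xs ^ g xs \<le> (sum_list xs + 2) ^ C"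
    unfolding pbound_def by blast
  have "ptime a (\<lambda>xs. min (f xs ^ g xs) ((sum_list xs + 2) ^ C))"
    by (intro ptime_min_power assms ptime_power_const ptime_add ptime_sum_list ptime_const)
  then show ?thesis by (rule ptime_cong) (use C in auto)
qed

lemma pdec_prime: "pdec 1 (\<lambda>xs. prime (xs ! 0))"
proof (rule ptime_cong)
  show "pdec 1 (\<lambda>xs. 1 < xs ! 0 \<and> (\<forall>d<xs ! 0. \<not> (1 < d \<and> xs ! 0 mod d = 0)))"
    by (intro pdec_conj pdec_less pdec_ball pdec_not pdec_eq ptime_mod ptime_const ptime_nth ptime_nth_tl) auto
  fix xs :: "nat list"
  have "prime p \<longleftrightarrow> 1 < p \<and> (\<forall>d<p. \<not> (1 < d \<and> p mod d = 0))" for p :: nat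
    unfolding prime_nat_iff
    by (auto simp: mod_eq_0_iff_dvd) (metis Suc_lessI dvd_pos_nat dvd_imp_le le_neq_implies_less not_gr_zero less_trans zero_less_Suc)
  then show "of_bool (1 < xs ! 0 \<and> (\<forall>d<xs ! 0. \<not> (1 < d \<and> xs ! 0 mod d = 0))) = (of_bool (prime (xs ! 0)) :: nat)"
    by simp
qed

subsection \<open>Printing\<close>

fun print_all :: "(nat list \<Rightarrow> nat \<Rightarrow> prog) list \<Rightarrow> nat list \<Rightarrow> nat \<Rightarrow> prog" where
  "print_all [] is b = Assign b (Num 0)"
| "print_all (P # Ps) is b = Seq (P is b) (Seq (Print (Reg b)) (print_all Ps is b))"

lemma exec_print_all:
  assumes "\<And>f. f \<in> set fs \<Longrightarrow> ptime a f"
  shows "\<exists>P T. pbound a T \<and> (\<forall>is b s. length is = a \<longrightarrow> (\<forall>i\<in>set is. i < b) \<longrightarrow>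
     (\<exists>t s'. exec (P is b) s t s' \<and> t \<le> T (map (reg s) is) \<and>
        (\<forall>r<b. reg s' r = reg s r) \<and> tape s' = tape s @ map (\<lambda>f. f (map (reg s) is)) fs))"
  using assms
proof (induction fs)
  case Nil
  show ?case
    by (rule exI[of _ "\<lambda>is b. Assign b (Num 0)"], rule exI[of _ "\<lambda>_. 2"])
      (auto simp: pbound_const intro!: exI exec_AssignI)
next
  case (Cons f fs)
  from Cons.IH[OF Cons.prems[OF list.set_intros(2)]] obtain P T where PT: "pbound a T"
    "\<forall>is b s. length is = a \<longrightarrow> (\<forall>i\<in>set is. i < b) \<longrightarrow>
     (\<exists>t s'. exec (P is b) s t s' \<and> t \<le> T (map (reg s) is) \<and>
        (\<forall>r<b. reg s' r = reg s r) \<and> tape s' = tape s @ map (\<lambda>f. f (map (reg s) is)) fs)"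
    by blast
  from Cons.prems[OF list.set_intros(1)] obtain Tf Pf where f: "pbound a Tf" "computes_fun a f Tf Pf"
    unfolding ptime_def by blast
  let ?P = "\<lambda>is b. Seq (Pf is b) (Seq (Print (Reg b)) (P is b))"
  let ?T = "\<lambda>xs. Tf xs + (2 + T xs)"
  have "\<exists>t s'. exec (?P is b) s t s' \<and> t \<le> ?T (map (reg s) is) \<and>
        (\<forall>r<b. reg s' r = reg s r) \<and> tape s' = tape s @ map (\<lambda>f. f (map (reg s) is)) (f # fs)"
    if *: "length is = a" "\<forall>i\<in>set is. i < b" for "is" b and s :: state
  proof -
    obtain t s1 where 1: "exec (Pf is b) s t s1" "t \<le> Tf (map (reg s) is)" "reg s1 b = f (map (reg s) is)"
        "\<And>r. r < b \<Longrightarrow> reg s1 r = reg s r" "tape s1 = tape s"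
      using computes_funD[OF f(2) *(1), of b s] *(2) by metis
    define s2 where "s2 = s1\<lparr>tape := tape s1 @ [expr_val (Reg b) s1]\<rparr>"
    have 2: "exec (Print (Reg b)) s1 2 s2"
      using exec.Print[of "Reg b" s1] by (simp add: s2_def numeral_2_eq_2)
    have m: "map (reg s2) is = map (reg s) is" using 1(4) * by (auto simp: s2_def)
    obtain t' s3 where 3: "exec (P is b) s2 t' s3" "t' \<le> T (map (reg s) is)"
      "\<forall>r<b. reg s3 r = reg s2 r" "tape s3 = tape s2 @ map (\<lambda>f. f (map (reg s) is)) fs"
      using PT(2)[rule_format, OF *(1), of b s2] *(2) unfolding m by blast
    show ?thesis
      using exec.Seq[OF 1(1) exec.Seq[OF 2 3(1)]] 1 3
      by (intro exI[of _ "t + (2 + t')"] exI[of _ s3]) (auto simp: s2_def)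
  qed
  moreover have "pbound a ?T" by (intro pbound_add f PT pbound_const)
  ultimately show ?case by (intro exI[of _ ?P] exI[of _ ?T]) blast
qed

lemma pbound_poly_bounded:
  assumes "pbound 1 f" "\<And>n. g n \<le> f [n]"
  shows "poly_bounded g"
proof -
  from assms(1) obtain C where C: "\<And>xs. length xs = 1 \<Longrightarrow> f xs \<le> (sum_list xs + 2) ^ C"
    unfolding pbound_def by blast
  have "g n \<le> poly ([:2, 1:] ^ C) n" for n
    using assms(2)[of n] C[of "[n]"] by (auto simp: add.commute)
  then show ?thesis unfolding poly_bounded_def by blast
qed

text \<open>Register 0 keeps \<open>n\<close>, register 1 the number of iterations and register 2
  the counter; the loop body works from register 3 on.\<close>

theorem outputs_in_time_loop:
  assumes len: "ptime 1 len" and fs: "\<And>f. f \<in> set fs \<Longrightarrow> ptime 2 f" and es: "\<And>f. f \<in> set es \<Longrightarrow> ptime 1 f"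
  shows "\<exists>A T. outputs_in_time A (\<lambda>n. concat (map (\<lambda>G. map (\<lambda>f. f [n, G]) fs) [0..<len [n]]) @ map (\<lambda>f. f [n]) es) T
    \<and> poly_bounded T"
proof -
  from exec_print_all[of fs 2, OF fs] obtain P T where PT: "pbound 2 T"
    "\<forall>is b s. length is = 2 \<longrightarrow> (\<forall>i\<in>set is. i < b) \<longrightarrow>
     (\<exists>t s'. exec (P is b) s t s' \<and> t \<le> T (map (reg s) is) \<and>
        (\<forall>r<b. reg s' r = reg s r) \<and> tape s' = tape s @ map (\<lambda>f. f (map (reg s) is)) fs)"
    by blast
  from exec_print_all[of es 1, OF es] obtain P' T' where PT': "pbound 1 T'"
    "\<forall>is b s. length is = 1 \<longrightarrow> (\<forall>i\<in>set is. i < b) \<longrightarrow>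
     (\<exists>t s'. exec (P' is b) s t s' \<and> t \<le> T' (map (reg s) is) \<and>
        (\<forall>r<b. reg s' r = reg s r) \<and> tape s' = tape s @ map (\<lambda>f. f (map (reg s) is)) es)"
    by blast
  from len obtain Tl Pl where l: "pbound 1 Tl" "computes_fun 1 len Tl Pl"
    unfolding ptime_def by blast
  from PT(1) obtain C where C: "\<And>xs. length xs = 2 \<Longrightarrow> T xs \<le> (sum_list xs + 2) ^ C"
    unfolding pbound_def by blast
  define loop where "loop = While (Minus (Reg 1) (Reg 2)) (Seq (P [0, 2] 3) (Assign 2 (Plus (Reg 2) (Num 1))))"
  have loop: "\<exists>t s'. exec loop s t s' \<and> t \<le> k * ((n + N + 2) ^ C + 10) + 4 \<and> reg s' 0 = n \<and>
     tape s' = tape s @ concat (map (\<lambda>G. map (\<lambda>f. f [n, G]) fs) [N - k..<N])"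
    if "reg s 0 = n" "reg s 1 = N" "reg s 2 + k = N" for s n k N
    using that
  proof (induction k arbitrary: s)
    case 0
    have "exec loop s (1 + expr_time (Minus (Reg 1) (Reg 2))) s"
      unfolding loop_def using 0 by (intro exec.WhileFalse) auto
    then show ?case using 0 by (intro exI conjI) auto
  next
    case (Suc k)
    define G where "G = reg s 2"
    have G: "G < N" "N - Suc k = G" "N - k = Suc G" using Suc.prems by (auto simp: G_def)
    obtain t s1 where 1: "exec (P [0, 2] 3) s t s1" "t \<le> T [n, G]" "\<forall>r<3. reg s1 r = reg s r"
      "tape s1 = tape s @ map (\<lambda>f. f [n, G]) fs"
      using PT(2)[THEN spec[of _ "[0, 2]"], THEN spec[of _ 3], THEN spec[of _ s]] Suc.prems by (auto simp: G_def)
    define s2 where "s2 = s1\<lparr>reg := (reg s1)(2 := Suc G)\<rparr>"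
    have 2: "exec (Assign 2 (Plus (Reg 2) (Num 1))) s1 4 s2"
      using 1(3) by (auto simp: s2_def G_def intro!: exec_AssignI)
    obtain t' s3 where 3: "exec loop s2 t' s3" "t' \<le> k * ((n + N + 2) ^ C + 10) + 4" "reg s3 0 = n"
      "tape s3 = tape s2 @ concat (map (\<lambda>G. map (\<lambda>f. f [n, G]) fs) [N - k..<N])"
      using Suc.IH[of s2] Suc.prems 1(3) by (auto simp: s2_def G_def)
    have "exec loop s (1 + expr_time (Minus (Reg 1) (Reg 2)) + (t + 4) + t') s3"
      unfolding loop_def using Suc.prems
      by (intro exec.WhileTrue[OF _ exec.Seq[OF 1(1) 2]] 3(1)[unfolded loop_def]) auto
    moreover have "t \<le> (n + N + 2) ^ C"
    proof -
      have "t \<le> (n + G + 2) ^ C" using 1(2) C[of "[n, G]"] by simp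
      also have "\<dots> \<le> (n + N + 2) ^ C" using G by (intro power_mono) auto
      finally show ?thesis .
    qed
    moreover have "tape s3 = tape s @ concat (map (\<lambda>G. map (\<lambda>f. f [n, G]) fs) [N - Suc k..<N])"
      unfolding G(2) upt_conv_Cons[OF G(1)] using 3(4) 1(4) G(3) by (simp add: s2_def)
    ultimately show ?case using 3 by (intro exI[of _ "_ + t'"] exI[of _ s3]) auto
  qed
  define A where "A = Seq (Pl [0] 1) (Seq (Assign 2 (Num 0)) (Seq loop (P' [0] 1)))"
  define TT where "TT = (\<lambda>xs. Tl xs + (2 + ((len xs * ((xs ! 0 + len xs + 2) ^ C + 10) + 4) + T' xs)))"
  have "outputs_in_time A (\<lambda>n. concat (map (\<lambda>G. map (\<lambda>f. f [n, G]) fs) [0..<len [n]]) @ map (\<lambda>f. f [n]) es)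
     (\<lambda>n. TT [n])"
    unfolding outputs_in_time_def
  proof
    fix n
    let ?s = "init_state n"
    have s: "reg ?s 0 = n" "tape ?s = []" by (auto simp: init_state_def)
    obtain t s1 where 1: "exec (Pl [0] 1) ?s t s1" "t \<le> Tl [n]" "reg s1 1 = len [n]" "reg s1 0 = n" "tape s1 = []"
      by (rule computes_funD[OF l(2), of "[0]" 1 ?s]) (use s that in auto)
    define s2 where "s2 = s1\<lparr>reg := (reg s1)(2 := 0)\<rparr>"
    have 2: "exec (Assign 2 (Num 0)) s1 2 s2"
      by (auto simp: s2_def intro!: exec_AssignI)
    obtain t' s3 where 3: "exec loop s2 t' s3" "t' \<le> len [n] * ((n + len [n] + 2) ^ C + 10) + 4" "reg s3 0 = n"
      "tape s3 = concat (map (\<lambda>G. map (\<lambda>f. f [n, G]) fs) [0..<len [n]])"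
      using loop[of s2 n "len [n]" "len [n]"] 1 by (auto simp: s2_def)
    obtain t'' s4 where 4: "exec (P' [0] 1) s3 t'' s4" "t'' \<le> T' [n]" "tape s4 = tape s3 @ map (\<lambda>f. f [n]) es"
      using PT'(2)[THEN spec[of _ "[0]"], THEN spec[of _ 1], THEN spec[of _ s3]] 3(3) by auto
    show "\<exists>t s. exec A (init_state n) t s \<and> t \<le> TT [n] \<and>
      tape s = concat (map (\<lambda>G. map (\<lambda>f. f [n, G]) fs) [0..<len [n]]) @ map (\<lambda>f. f [n]) es"
      unfolding A_def using exec.Seq[OF 1(1) exec.Seq[OF 2 exec.Seq[OF 3(1) 4(1)]]] 1 3 4
      by (intro exI[of _ "t + (2 + (t' + t''))"] exI[of _ s4]) (auto simp: TT_def)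
  qed
  moreover have "pbound 1 TT"
    unfolding TT_def
    by (intro pbound_add pbound_mult pbound_power l PT' pbound_const ptime_pbound[OF len] pbound_nth) auto
  ultimately show ?thesis using pbound_poly_bounded[of TT "\<lambda>n. TT [n]"] by blast
qed

section \<open>A sorting network of windowed majorities\<close>

text \<open>
  Entry \<open>e\<close> of the window around position \<open>q\<close> of a group of size \<open>G\<close> is position \<open>q + e - B\<close>; positions
  below the group count as ones and those above it as zeros.
\<close>

definition window_val :: "nat \<Rightarrow> nat \<Rightarrow> (nat \<Rightarrow> bool) \<Rightarrow> nat \<Rightarrow> nat \<Rightarrow> bool" where
  "window_val B G Y q e \<longleftrightarrow> q + e < B \<or> (q + e - B < G \<and> Y (q + e - B))"

text \<open>Let \<open>T\<close> be the number of ones. A window near the mixed zone misses only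
  ones on its left and zeros on its right, so it holds \<open>B + T - q\<close> ones, more than
  \<open>B\<close> iff \<open>q < T\<close>. Otherwise its centre and the half turned away from the
  zone, \<open>B + 1\<close> entries, all agree, which decides both sides.\<close>

lemma window_majority_sorts:
  assumes dirty: "\<And>q. q < u \<Longrightarrow> q < G \<Longrightarrow> Y q" "\<And>q. u + B \<le> q \<Longrightarrow> q < G \<Longrightarrow> \<not> Y q"
    and q: "q < G"
  shows "B < card {e \<in> {..2 * B}. window_val B G Y q e} \<longleftrightarrow> q < card {p \<in> {..<G}. Y p}"
proof -
  let ?T = "card {p \<in> {..<G}. Y p}"
  have cardT: "finite {p \<in> {..<G}. Y p}" by simp
  consider (inside) "q \<le> u + B" "u \<le> q + 1" | (below) "u + B < q" | (above) "q + 1 < u"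
    by linarith
  then show ?thesis
  proof cases
    case below
    have "{e \<in> {..2 * B}. window_val B G Y q e} \<subseteq> {..<B}"
    proof safe
      fix e assume e: "e \<le> 2 * B" "window_val B G Y q e"
      show "e < B"
      proof (rule ccontr)
        assume "\<not> e < B"
        then have "u + B \<le> q + e - B" "\<not> q + e < B" using below by auto
        with e dirty(2)[of "q + e - B"] show False by (auto simp: window_val_def)
      qed
    qed
    then have "card {e \<in> {..2 * B}. window_val B G Y q e} \<le> B"
      using card_mono[of "{..<B}"] by fastforce
    moreover have "{p \<in> {..<G}. Y p} \<subseteq> {..<u + B}"
      using dirty(2) by (auto simp: not_less[symmetric])
    then have "?T \<le> u + B" using card_mono[of "{..<u + B}"] by fastforce
    ultimately show ?thesis using below by simp
  next
    case above
    have "{..B} \<subseteq> {e \<in> {..2 * B}. window_val B G Y q e}"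
    proof safe
      fix e assume e: "e \<le> B"
      show "window_val B G Y q e"
        using dirty(1)[of "q + e - B"] e above q by (auto simp: window_val_def)
    qed auto
    then have "B < card {e \<in> {..2 * B}. window_val B G Y q e}"
      using card_mono[of "{e \<in> {..2 * B}. window_val B G Y q e}" "{..B}"] by fastforce
    moreover have "{..q} \<subseteq> {p \<in> {..<G}. Y p}"
      using dirty(1) above q by auto
    then have "q < ?T" using card_mono[OF cardT, of "{..q}"] by fastforce
    ultimately show ?thesis by simp
  next
    case inside
    define A where "A = {e \<in> {..2 * B}. B \<le> q + e \<and> q + e - B < G \<and> Y (q + e - B)}"
    define P where "P = {e \<in> {..2 * B}. q + e < B}"
    have P: "card P = B - q"
    proof -
      have "P = {..<B - q}" unfolding P_def by auto
      then show ?thesis by simp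
    qed
    have "{e \<in> {..2 * B}. window_val B G Y q e} = P \<union> A"
      unfolding A_def P_def window_val_def by auto
    moreover have "card (P \<union> A) = card P + card A"
      by (rule card_Un_disjoint) (auto simp: A_def P_def)
    moreover have "card A = card {p \<in> {..<G}. Y p \<and> q - B \<le> p}"
    proof (rule bij_betw_same_card[of "\<lambda>e. q + e - B"])
      show "bij_betw (\<lambda>e. q + e - B) A {p \<in> {..<G}. Y p \<and> q - B \<le> p}"
      proof (rule bij_betwI[where g = "\<lambda>p. p + B - q"])
        show "(\<lambda>p. p + B - q) \<in> {p \<in> {..<G}. Y p \<and> q - B \<le> p} \<rightarrow> A"
        proof
          fix p assume p: "p \<in> {p \<in> {..<G}. Y p \<and> q - B \<le> p}"
          then have "p < u + B" using dirty(2)[of p] by (auto simp: not_less[symmetric])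
          then have "p + B - q \<le> 2 * B" using inside by auto
          moreover have "q + (p + B - q) = p + B" using p by auto
          ultimately show "p + B - q \<in> A" using p unfolding A_def by auto
        qed
      qed (auto simp: A_def)
    qed
    moreover have "?T = card {p \<in> {..<G}. Y p \<and> q - B \<le> p} + (q - B)"
    proof -
      have "{p \<in> {..<G}. Y p} = {p \<in> {..<G}. Y p \<and> q - B \<le> p} \<union> {..<q - B}"
        using dirty(1) inside q by auto
      moreover have "card ({p \<in> {..<G}. Y p \<and> q - B \<le> p} \<union> {..<q - B})
          = card {p \<in> {..<G}. Y p \<and> q - B \<le> p} + card {..<q - B}"
        by (rule card_Un_disjoint) auto
      ultimately show ?thesis by simp
    qed
    ultimately show ?thesis using P by (cases "q \<le> B") auto
  qed
qed

text \<open>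
  Position \<open>i = hi * k ^ (t + 1) + q * k ^ s + lo\<close> is entry \<open>q\<close> of the group \<open>(hi, lo)\<close>.
\<close>

definition phase_window :: "nat \<Rightarrow> nat \<Rightarrow> nat \<Rightarrow> (nat \<Rightarrow> bool) \<Rightarrow> nat \<Rightarrow> nat \<Rightarrow> bool" where
  "phase_window k t s X i e = (let q = (i mod k ^ (t + 1)) div k ^ s in
     if q + e < k\<^sup>2 then True else if q + e - k\<^sup>2 \<ge> k ^ (t + 1 - s) then False
     else X (i + e * k ^ s - k\<^sup>2 * k ^ s))"

definition window_majority :: "nat \<Rightarrow> (nat \<Rightarrow> bool) \<Rightarrow> bool" where
  "window_majority k y \<longleftrightarrow> k\<^sup>2 < card {e \<in> {..2 * k\<^sup>2}. y e}"

definition phase :: "nat \<Rightarrow> nat \<Rightarrow> nat \<Rightarrow> (nat \<Rightarrow> bool) \<Rightarrow> nat \<Rightarrow> bool" where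
  "phase k t s X i = window_majority k (phase_window k t s X i)"

definition group_index :: "nat \<Rightarrow> nat \<Rightarrow> nat \<Rightarrow> nat \<Rightarrow> nat \<Rightarrow> nat \<Rightarrow> nat" where
  "group_index k t s hi lo q = hi * k ^ (t + 1) + q * k ^ s + lo"

lemma group_index_q:
  assumes "k > 0" "s \<le> t" "lo < k ^ s" "q < k ^ (t + 1 - s)"
  shows "(group_index k t s hi lo q mod k ^ (t + 1)) div k ^ s = q"
proof -
  have e: "k ^ (t + 1) = k ^ (t + 1 - s) * k ^ s"
    using assms by (simp flip: power_add)
  have "q * k ^ s + lo < Suc q * k ^ s" using assms by simp
  also have "\<dots> \<le> k ^ (t + 1)" unfolding e using assms by (intro mult_right_mono) auto
  finally have "group_index k t s hi lo q mod k ^ (t + 1) = q * k ^ s + lo"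
    by (simp add: group_index_def add.assoc)
  then show ?thesis using assms by simp
qed

lemma phase_sorts:
  assumes k: "k > 0" and s: "s \<le> t" "lo < k ^ s"
    and dirty: "\<And>q. q < u \<Longrightarrow> q < k ^ (t + 1 - s) \<Longrightarrow> X (group_index k t s hi lo q)"
      "\<And>q. u + k\<^sup>2 \<le> q \<Longrightarrow> q < k ^ (t + 1 - s) \<Longrightarrow> \<not> X (group_index k t s hi lo q)"
    and q: "q < k ^ (t + 1 - s)"
  shows "phase k t s X (group_index k t s hi lo q) \<longleftrightarrow>
    q < card {p \<in> {..<k ^ (t + 1 - s)}. X (group_index k t s hi lo p)}"
proof -
  let ?Y = "\<lambda>p. X (group_index k t s hi lo p)"
  have "phase_window k t s X (group_index k t s hi lo q) e = window_val (k\<^sup>2) (k ^ (t + 1 - s)) ?Y q e" for e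
  proof -
    have "group_index k t s hi lo q + e * k ^ s - k\<^sup>2 * k ^ s = group_index k t s hi lo (q + e - k\<^sup>2)"
      if "\<not> q + e < k\<^sup>2"
    proof -
      have "(q + e - k\<^sup>2) * k ^ s = q * k ^ s + e * k ^ s - k\<^sup>2 * k ^ s"
        by (simp add: diff_mult_distrib add_mult_distrib)
      moreover have "k\<^sup>2 * k ^ s \<le> q * k ^ s + e * k ^ s"
        using that by (simp flip: add_mult_distrib)
      ultimately show ?thesis by (simp add: group_index_def)
    qed
    then show ?thesis
      using group_index_q[OF k s q, of hi] by (auto simp: phase_window_def window_val_def Let_def)
  qed
  then show ?thesis
    unfolding phase_def window_majority_def using window_majority_sorts[OF dirty q] by simp
qed

text \<open>
  The rows of a merge: if each of the \<open>k\<close> columns \<open>a\<close> begins with \<open>w (hi * k + a)\<close> ones, then so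
  many ones lie in rows congruent to \<open>lo\<close> modulo \<open>k ^ s\<close>.
\<close>

definition row_ones :: "nat \<Rightarrow> nat \<Rightarrow> (nat \<Rightarrow> nat) \<Rightarrow> nat \<Rightarrow> nat \<Rightarrow> nat" where
  "row_ones k s w hi lo = (\<Sum>a<k. (w (hi * k + a) + (k ^ s - 1 - lo)) div k ^ s)"

definition rows_sorted :: "nat \<Rightarrow> nat \<Rightarrow> nat \<Rightarrow> (nat \<Rightarrow> nat) \<Rightarrow> (nat \<Rightarrow> bool) \<Rightarrow> bool" where
  "rows_sorted k t s w X \<longleftrightarrow> (\<forall>hi lo q. lo < k ^ s \<longrightarrow> q < k ^ (t + 1 - s) \<longrightarrow>
     X (group_index k t s hi lo q) = (q < row_ones k s w hi lo))"

definition cols_sorted :: "nat \<Rightarrow> nat \<Rightarrow> (nat \<Rightarrow> nat) \<Rightarrow> (nat \<Rightarrow> bool) \<Rightarrow> bool" where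
  "cols_sorted k t w X \<longleftrightarrow> (\<forall>c. w c \<le> k ^ t) \<and> (\<forall>c p. p < k ^ t \<longrightarrow> X (c * k ^ t + p) = (p < w c))"

text \<open>Hermite's identity. Raising \<open>A\<close> by one shifts the sum by one term, which
  replaces \<open>A div k\<close> by \<open>(A + k) div k\<close>.\<close>

lemma hermite: "k > 0 \<Longrightarrow> (\<Sum>j<k. (A + j) div k) = (A :: nat)"
proof (induction A)
  case (Suc A)
  have "(\<Sum>j<k. (Suc A + j) div k) = (\<Sum>j<k. (A + Suc j) div k)" by simp
  also have "\<dots> = (\<Sum>j<Suc k. (A + j) div k) - A div k"
    by (subst sum.lessThan_Suc_shift) simp
  also have "\<dots> = (\<Sum>j<k. (A + j) div k) + 1" using Suc.prems by (simp add: div_add_self2)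
  finally show ?case using Suc by simp
qed simp

lemma sum_reverse: "(\<Sum>r<k. f (k - 1 - r)) = (\<Sum>r<(k::nat). f r)"
  by (simp add: sum.nat_diff_reindex)

text \<open>The rows congruent to \<open>lo\<close> modulo \<open>k ^ s\<close> split into
  \<open>k\<close> classes modulo \<open>k ^ (s + 1)\<close>; column by column the count is
  Hermite's identity.\<close>

lemma row_ones_split:
  assumes k: "k > 0" and lo: "lo < k ^ s"
  shows "(\<Sum>r<k. row_ones k (Suc s) w hi (r * k ^ s + lo)) = row_ones k s w hi lo"
proof -
  have "(\<Sum>r<k. (v + (k ^ Suc s - 1 - (r * k ^ s + lo))) div k ^ Suc s) = (v + (k ^ s - 1 - lo)) div k ^ s" for v
  proof -
    have "(v + (k ^ Suc s - 1 - (r * k ^ s + lo))) div k ^ Suc s =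
      ((v + (k ^ s - 1 - lo)) div k ^ s + (k - 1 - r)) div k" if r: "r < k" for r
    proof -
      have "k ^ Suc s = (k - 1 - r) * k ^ s + (r * k ^ s + k ^ s)"
      proof -
        have "k = (k - 1 - r) + (r + 1)" using r by simp
        then have "k * k ^ s = ((k - 1 - r) + (r + 1)) * k ^ s" by simp
        then show ?thesis by (simp add: algebra_simps)
      qed
      then have "v + (k ^ Suc s - 1 - (r * k ^ s + lo)) = (v + (k ^ s - 1 - lo)) + (k - 1 - r) * k ^ s"
        using lo by linarith
      then have "(v + (k ^ Suc s - 1 - (r * k ^ s + lo))) div k ^ s = (v + (k ^ s - 1 - lo)) div k ^ s + (k - 1 - r)"
        using k by (simp only: div_mult_self1 power_not_zero) simp
      then show ?thesis by (simp only: power_Suc2 div_mult2_eq)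
    qed
    then have "(\<Sum>r<k. (v + (k ^ Suc s - 1 - (r * k ^ s + lo))) div k ^ Suc s)
      = (\<Sum>r<k. ((v + (k ^ s - 1 - lo)) div k ^ s + (k - 1 - r)) div k)" by (intro sum.cong) auto
    also have "\<dots> = (\<Sum>r<k. ((v + (k ^ s - 1 - lo)) div k ^ s + r) div k)"
      by (rule sum_reverse)
    finally show ?thesis using k by (simp add: hermite)
  qed
  then show ?thesis unfolding row_ones_def by (subst sum.swap) simp
qed

text \<open>Rounding costs at most one per column, so together with \<open>row_ones_ge\<close> the
  residue classes of a group differ by at most \<open>k\<close>. This is the origin of the
  half-width \<open>k\<^sup>2\<close> of the windows: \<open>k\<close> rows of \<open>k\<close>
  interleaved classes.\<close>

lemma row_ones_le: "k > 0 \<Longrightarrow> lo < k ^ s \<Longrightarrow> row_ones k s w hi lo \<le> (\<Sum>a<k. w (hi * k + a) div k ^ s) + k"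
proof -
  assume k: "k > 0" "lo < k ^ s"
  have "(v + (k ^ s - 1 - lo)) div k ^ s \<le> v div k ^ s + 1" for v
  proof -
    have "(v + (k ^ s - 1 - lo)) div k ^ s \<le> (v + k ^ s) div k ^ s" by (intro div_le_mono) auto
    then show ?thesis using k by simp
  qed
  then have "row_ones k s w hi lo \<le> (\<Sum>a<k. w (hi * k + a) div k ^ s + 1)"
    unfolding row_ones_def by (intro sum_mono)
  then show ?thesis by (simp only: sum.distrib) simp
qed

lemma row_ones_ge: "(\<Sum>a<k. w (hi * k + a) div k ^ s) \<le> row_ones k s w hi lo"
  unfolding row_ones_def by (intro sum_mono div_le_mono) auto

lemma card_less_bound: "card {p \<in> {..<G}. p < (c::nat)} = min c G"
proof -
  have "{p \<in> {..<G}. p < c} = {..<min c G}" by auto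
  then show ?thesis by simp
qed

text \<open>A harmless repetition, used to pad every round to the same number of phases.\<close>

lemma phase_repeat:
  assumes "k > 0" "s \<le> t" "rows_sorted k t s w X" "\<And>hi lo. lo < k ^ s \<Longrightarrow> row_ones k s w hi lo \<le> k ^ (t + 1 - s)"
  shows "rows_sorted k t s w (phase k t s X)"
  unfolding rows_sorted_def
proof (intro allI impI)
  fix hi lo q assume lo: "lo < k ^ s" and q: "q < k ^ (t + 1 - s)"
  have X: "X (group_index k t s hi lo p) = (p < row_ones k s w hi lo)" if "p < k ^ (t + 1 - s)" for p
    using assms(3) lo that by (auto simp: rows_sorted_def)
  then have "{p \<in> {..<k ^ (t + 1 - s)}. X (group_index k t s hi lo p)} = {p \<in> {..<k ^ (t + 1 - s)}. p < row_ones k s w hi lo}"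
    by auto
  then have "card {p \<in> {..<k ^ (t + 1 - s)}. X (group_index k t s hi lo p)} = row_ones k s w hi lo"
    using assms(4)[OF lo, of hi] by (simp only: card_less_bound min_absorb1)
  moreover have "phase k t s X (group_index k t s hi lo q) =
    (q < card {p \<in> {..<k ^ (t + 1 - s)}. X (group_index k t s hi lo p)})"
    by (rule phase_sorts[OF assms(1,2) lo _ _ q, of "row_ones k s w hi lo"]) (use X in auto)
  ultimately show "phase k t s X (group_index k t s hi lo q) = (q < row_ones k s w hi lo)"
    by (simp only:)
qed

lemma row_ones_bound:
  assumes "k > 0" "s \<le> t" "lo < k ^ s" "\<And>c. w c \<le> k ^ t"
  shows "row_ones k s w hi lo \<le> k ^ (t + 1 - s)"
proof -
  have "(w c + (k ^ s - 1 - lo)) div k ^ s \<le> k ^ (t - s)" for c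
  proof -
    have "w c + (k ^ s - 1 - lo) < k ^ t + k ^ s" using assms(4)[of c] assms(1) by (simp add: add_le_less_mono)
    also have "\<dots> = Suc (k ^ (t - s)) * k ^ s" using assms(2) by (simp flip: power_add)
    finally have "(w c + (k ^ s - 1 - lo)) div k ^ s < Suc (k ^ (t - s))" by (rule less_mult_imp_div_less)
    then show ?thesis by simp
  qed
  then have "row_ones k s w hi lo \<le> (\<Sum>a<k. k ^ (t - s))" unfolding row_ones_def by (intro sum_mono)
  also have "\<dots> = k ^ (t + 1 - s)" using assms(2) by (simp add: Suc_diff_le)
  finally show ?thesis .
qed

text \<open>For \<open>s = t\<close> a group is a single row with one entry per column. Its length
  \<open>k\<close> is at most \<open>k\<^sup>2\<close>, so \<open>u = 0\<close> satisfies the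
  hypotheses of \<open>phase_sorts\<close> whatever the order of the row.\<close>

lemma phase_first:
  assumes k: "k > 0" and cols: "cols_sorted k t w X"
  shows "rows_sorted k t t w (phase k t t X)"
  unfolding rows_sorted_def
proof (intro allI impI)
  fix hi lo q assume lo: "lo < k ^ t" and q: "q < k ^ (t + 1 - t)"
  have gi: "group_index k t t hi lo p = (hi * k + p) * k ^ t + lo" for p
    by (simp add: group_index_def algebra_simps)
  have X: "X (group_index k t t hi lo p) = (lo < w (hi * k + p))" for p
    using cols lo by (auto simp: cols_sorted_def gi)
  have wt: "w c \<le> k ^ t" for c using cols by (auto simp: cols_sorted_def)
  have "(w c + (k ^ t - 1 - lo)) div k ^ t = of_bool (lo < w c)" for c
  proof (cases "lo < w c")
    case True
    then have "(w c + (k ^ t - 1 - lo)) div k ^ t = Suc 0"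
      using wt[of c] lo by (intro div_nat_eqI) auto
    then show ?thesis using True by simp
  next
    case False
    then show ?thesis using lo by simp
  qed
  then have "row_ones k t w hi lo = (\<Sum>a<k. of_bool (lo < w (hi * k + a)))"
    unfolding row_ones_def by simp
  also have "\<dots> = card {p \<in> {..<k ^ (t + 1 - t)}. X (group_index k t t hi lo p)}"
    using X by (simp add: Int_def)
  finally show "phase k t t X (group_index k t t hi lo q) = (q < row_ones k t w hi lo)"
    using k q by (subst phase_sorts[OF k order.refl lo, of 0]) (auto simp: power2_eq_square dest!: le_trans[OF le_square])
qed

text \<open>A group for \<open>s\<close> interleaves \<open>k\<close> sorted groups for
  \<open>s + 1\<close>, each with between \<open>c\<close> and \<open>c + k\<close> ones. So it is
  clean before \<open>c * k\<close> and from \<open>c * k + k\<^sup>2\<close> on, and window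
  majorities sort it.\<close>

lemma phase_step:
  assumes k: "k > 0" and s: "s < t" and rows: "rows_sorted k t (Suc s) w X" and wt: "\<And>c. w c \<le> k ^ t"
  shows "rows_sorted k t s w (phase k t s X)"
  unfolding rows_sorted_def
proof (intro allI impI)
  fix hi lo q assume lo: "lo < k ^ s" and q: "q < k ^ (t + 1 - s)"
  define R where "R = (\<lambda>r. row_ones k (Suc s) w hi (r * k ^ s + lo))"
  define c where "c = (\<Sum>a<k. w (hi * k + a) div k ^ Suc s)"
  let ?G = "k ^ (t + 1 - Suc s)"
  have G: "k ^ (t + 1 - s) = ?G * k"
    using s by (simp add: Suc_diff_le flip: power_Suc2)
  have lo': "r * k ^ s + lo < k ^ Suc s" if "r < k" for r
  proof -
    have "r * k ^ s + lo < Suc r * k ^ s" using lo by simp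
    also have "\<dots> \<le> k ^ Suc s" unfolding power_Suc using that by (intro mult_right_mono) auto
    finally show ?thesis .
  qed
  have X: "X (group_index k t s hi lo (p * k + r)) = (p < R r)" if "r < k" "p < ?G" for p r
  proof -
    have "group_index k t s hi lo (p * k + r) = group_index k t (Suc s) hi (r * k ^ s + lo) p"
      by (simp add: group_index_def algebra_simps)
    then show ?thesis using rows lo'[OF that(1)] that(2) by (auto simp: rows_sorted_def R_def)
  qed
  have Xp: "X (group_index k t s hi lo p) = (p div k < R (p mod k))" if "p < k ^ (t + 1 - s)" for p
  proof -
    have "p div k < ?G" using that unfolding G by (rule less_mult_imp_div_less)
    then show ?thesis using X[of "p mod k" "p div k"] k by simp
  qed
  have Rc: "c \<le> R r" "R r \<le> c + k" if "r < k" for r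
    unfolding R_def c_def using row_ones_le[OF k lo'[OF that]] by (simp_all add: row_ones_ge del: power_Suc)
  have "card {p \<in> {..<k ^ (t + 1 - s)}. X (group_index k t s hi lo p)} = row_ones k s w hi lo"
  proof -
    have "card {p \<in> {..<k ^ (t + 1 - s)}. X (group_index k t s hi lo p)}
       = (\<Sum>p<k ^ (t + 1 - s). of_bool (X (group_index k t s hi lo p)))"
      by (simp add: Int_def)
    also have "\<dots> = (\<Sum>p<?G. \<Sum>r<k. of_bool (X (group_index k t s hi lo (p * k + r))))"
      unfolding G by (rule sum_lessThan_mult)
    also have "\<dots> = (\<Sum>p<?G. \<Sum>r<k. of_bool (p < R r))"
      using X by (intro sum.cong) auto
    also have "\<dots> = (\<Sum>r<k. \<Sum>p<?G. of_bool (p < R r))" by (rule sum.swap)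
    also have "\<dots> = (\<Sum>r<k. R r)"
    proof (intro sum.cong refl)
      fix r assume "r \<in> {..<k}"
      then have "R r \<le> ?G"
        unfolding R_def using row_ones_bound[of k "Suc s" t "r * k ^ s + lo" w hi] k s lo' wt by simp
      then show "(\<Sum>p<?G. of_bool (p < R r)) = R r" by (simp only: sum_of_bool_less min_absorb2)
    qed
    also have "\<dots> = row_ones k s w hi lo"
      unfolding R_def using k lo by (rule row_ones_split)
    finally show ?thesis .
  qed
  moreover have "phase k t s X (group_index k t s hi lo q) =
    (q < card {p \<in> {..<k ^ (t + 1 - s)}. X (group_index k t s hi lo p)})"
  proof (rule phase_sorts[OF k _ lo _ _ q, of "c * k"])
    fix p assume p: "p < c * k" "p < k ^ (t + 1 - s)"
    then have "p div k < c" by (simp add: less_mult_imp_div_less)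
    also have "c \<le> R (p mod k)" using k by (intro Rc) simp
    finally show "X (group_index k t s hi lo p)" using Xp p by simp
  next
    fix p assume p: "c * k + k\<^sup>2 \<le> p" "p < k ^ (t + 1 - s)"
    then have "c + k \<le> p div k" using k
      by (simp add: less_eq_div_iff_mult_less_eq power2_eq_square algebra_simps)
    moreover have "R (p mod k) \<le> c + k" using k by (intro Rc) simp
    ultimately show "\<not> X (group_index k t s hi lo p)" using Xp p by simp
  qed (use s in simp)
  ultimately show "phase k t s X (group_index k t s hi lo q) = (q < row_ones k s w hi lo)" by simp
qed

lemma rows_sorted_0:
  assumes "rows_sorted k t 0 w X" "\<And>c. w c \<le> k ^ t" "k > 0"
  shows "cols_sorted k (Suc t) (\<lambda>hi. \<Sum>a<k. w (hi * k + a)) X"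
proof -
  have "(\<Sum>a<k. w (hi * k + a)) \<le> k ^ Suc t" for hi
  proof -
    have "(\<Sum>a<k. w (hi * k + a)) \<le> (\<Sum>a<k. k ^ t)" using assms(2) by (intro sum_mono)
    then show ?thesis by simp
  qed
  moreover have "X (c * k ^ Suc t + p) = (p < (\<Sum>a<k. w (c * k + a)))" if "p < k ^ Suc t" for c p
    using assms(1) that by (auto simp: rows_sorted_def group_index_def row_ones_def)
  ultimately show ?thesis by (simp add: cols_sorted_def)
qed

text \<open>Round \<open>t = j div l\<close> needs only the phases \<open>s = t, ..., 0\<close>.
  Each round gets \<open>l\<close> phases, the surplus ones repeating \<open>s = t\<close>, so that
  division recovers round and phase from \<open>j\<close>.\<close>

definition stage_s :: "nat \<Rightarrow> nat \<Rightarrow> nat" where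
  "stage_s l j = min (j div l) (l - 1 - j mod l)"

fun network :: "nat \<Rightarrow> nat \<Rightarrow> (nat \<Rightarrow> bool) \<Rightarrow> nat \<Rightarrow> nat \<Rightarrow> bool" where
  "network k l X 0 = X"
| "network k l X (Suc j) = phase k (j div l) (stage_s l j) (network k l X j)"

lemma network_round:
  assumes k: "k > 0" and t: "t < l" and cols: "cols_sorted k t w (network k l X (t * l))"
  shows "cols_sorted k (Suc t) (\<lambda>hi. \<Sum>a<k. w (hi * k + a)) (network k l X (Suc t * l))"
proof -
  have wt: "w c \<le> k ^ t" for c using cols by (auto simp: cols_sorted_def)
  have "j < l \<Longrightarrow> rows_sorted k t (min t (l - 1 - j)) w (network k l X (Suc (t * l + j)))" for j
  proof (induction j)
    case 0
    then show ?case using phase_first[OF k cols] t by (simp add: stage_s_def min_absorb1)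
  next
    case (Suc j)
    then have IH: "rows_sorted k t (min t (l - 1 - j)) w (network k l X (Suc (t * l + j)))" by simp
    have eq: "network k l X (Suc (t * l + Suc j)) = phase k t (min t (l - 1 - Suc j)) (network k l X (Suc (t * l + j)))"
    proof -
      have "(t * l + i) div l = t" "(t * l + i) mod l = i" if "i < l" for i using that by auto
      from this[OF Suc.prems] have "(t * l + Suc j) div l = t" "(t * l + Suc j) mod l = Suc j" .
      then show ?thesis by (simp only: network.simps add_Suc_right stage_s_def)
    qed
    show ?case
    proof (cases "t \<le> l - 1 - Suc j")
      case True
      then have "min t (l - 1 - j) = t" "min t (l - 1 - Suc j) = t" by auto
      then show ?thesis unfolding eq using IH k wt row_ones_bound[of k t t] by (auto intro!: phase_repeat)
    next
      case False
      then have "min t (l - 1 - j) = Suc (l - 1 - Suc j)" "min t (l - 1 - Suc j) = l - 1 - Suc j"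
        "l - 1 - Suc j < t" using Suc.prems by auto
      then show ?thesis unfolding eq using IH k wt by (auto intro!: phase_step)
    qed
  qed
  from this[of "l - 1"] t have "rows_sorted k t 0 w (network k l X (Suc t * l))"
    by (simp add: algebra_simps)
  then show ?thesis using wt k by (rule rows_sorted_0)
qed

theorem network_sorts:
  assumes k: "k > 0" and q: "q < k ^ l"
  shows "network k l X (l * l) q \<longleftrightarrow> q < card {i \<in> {..<k ^ l}. X i}"
proof -
  have "t \<le> l \<Longrightarrow> \<exists>w. cols_sorted k t w (network k l X (t * l)) \<and>
    (\<forall>c. w c = (\<Sum>p<k ^ t. of_bool (X (c * k ^ t + p))))" for t
  proof (induction t)
    case 0
    show ?case by (intro exI[of _ "\<lambda>c. of_bool (X c)"]) (auto simp: cols_sorted_def)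
  next
    case (Suc t)
    then obtain w where w: "cols_sorted k t w (network k l X (t * l))"
      "\<forall>c. w c = (\<Sum>p<k ^ t. of_bool (X (c * k ^ t + p)))" by auto
    have "(\<Sum>a<k. w (c * k + a)) = (\<Sum>p<k ^ Suc t. of_bool (X (c * k ^ Suc t + p)))" for c
    proof -
      have "(\<Sum>p<k ^ Suc t. of_bool (X (c * k ^ Suc t + p))) =
        (\<Sum>a<k. \<Sum>p<k ^ t. of_bool (X (c * k ^ Suc t + (a * k ^ t + p))) :: nat)"
        by (simp only: power_Suc sum_lessThan_mult)
      also have "\<dots> = (\<Sum>a<k. w (c * k + a))"
        using w(2) by (simp add: algebra_simps)
      finally show ?thesis by simp
    qed
    then show ?case using network_round[OF k _ w(1)] Suc.prems by (intro exI[of _ "\<lambda>hi. \<Sum>a<k. w (hi * k + a)"]) auto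
  qed
  from this[of l] obtain w where w: "cols_sorted k l w (network k l X (l * l))"
    "w 0 = (\<Sum>p<k ^ l. of_bool (X p))" by auto
  then have "network k l X (l * l) (0 * k ^ l + q) = (q < w 0)" using q unfolding cols_sorted_def by blast
  then show ?thesis by (simp add: w(2) Int_def)
qed

section \<open>Amplifying a majority with pairwise independent hashing\<close>

text \<open>A seed below \<open>Q\<^sup>2\<close> encodes an affine map modulo \<open>Q\<close>.\<close>

definition affine_hash :: "nat \<Rightarrow> nat \<Rightarrow> nat \<Rightarrow> nat" where
  "affine_hash Q w v = ((w mod Q) * v + w div Q) mod Q"

lemma sum_seeds:
  fixes F :: "nat \<Rightarrow> nat \<Rightarrow> real"
  shows "(\<Sum>w<Q\<^sup>2. F (w mod Q) (w div Q)) = (\<Sum>b<Q. \<Sum>a<Q. F a b)"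
proof -
  have "(\<Sum>w<Q * Q. F (w mod Q) (w div Q)) = (\<Sum>b<Q. \<Sum>a<Q. F ((b * Q + a) mod Q) ((b * Q + a) div Q))"
    by (rule sum_lessThan_mult)
  also have "\<dots> = (\<Sum>b<Q. \<Sum>a<Q. F a b)" by (intro sum.cong refl) auto
  finally show ?thesis by (simp add: power2_eq_square)
qed

lemma sum_affine_hash:
  fixes F :: "nat \<Rightarrow> real"
  assumes "Q > 0"
  shows "(\<Sum>w<Q\<^sup>2. F (affine_hash Q w v)) = Q * (\<Sum>x<Q. F x)"
proof -
  have "(\<Sum>w<Q\<^sup>2. F (affine_hash Q w v)) = (\<Sum>b<Q. \<Sum>a<Q. F ((a * v + b) mod Q))"
    unfolding affine_hash_def by (rule sum_seeds)
  also have "\<dots> = (\<Sum>a<Q. \<Sum>b<Q. F ((a * v + b) mod Q))" by (rule sum.swap)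
  also have "\<dots> = Q * (\<Sum>x<Q. F x)" by (simp add: sum_mod_shift[OF assms])
  finally show ?thesis .
qed

text \<open>Pairwise independence: seed and pair of hash values determine each other, because
  \<open>v - v'\<close> is invertible modulo the prime.\<close>

lemma sum_affine_hash_pair:
  fixes F :: "nat \<Rightarrow> nat \<Rightarrow> real"
  assumes Q: "prime Q" and v: "v < Q" "v' < Q" "v \<noteq> v'"
  shows "(\<Sum>w<Q\<^sup>2. F (affine_hash Q w v) (affine_hash Q w v')) = (\<Sum>x<Q. \<Sum>y<Q. F x y)"
proof -
  define \<phi> where "\<phi> = (\<lambda>(b, a). ((a * v + b) mod Q, (a * v' + b) mod Q))"
  have inj: "inj_on \<phi> ({..<Q} \<times> {..<Q})"
  proof (rule inj_onI)
    fix p p' assume *: "p \<in> {..<Q} \<times> {..<Q}" "p' \<in> {..<Q} \<times> {..<Q}" "\<phi> p = \<phi> p'"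
    obtain a b a' b' where p: "p = (b, a)" "p' = (b', a')" by force
    have e: "[a * v + b = a' * v + b'] (mod Q)" "[a * v' + b = a' * v' + b'] (mod Q)"
      using *(3) by (auto simp: \<phi>_def p cong_def)
    then have "[int a * v + b = int a' * v + b'] (mod int Q)" "[int a * v' + b = int a' * v' + b'] (mod int Q)"
      by (simp_all flip: cong_int_iff)
    from cong_diff[OF this] have "[(int a - int a') * (int v - int v') = 0] (mod int Q)"
      by (simp add: cong_iff_dvd_diff algebra_simps)
    then have "int Q dvd (int a - int a') * (int v - int v')" by (simp add: cong_0_iff)
    moreover have "prime (int Q)" using Q by simp
    ultimately have "int Q dvd int a - int a' \<or> int Q dvd int v - int v'"
      by (simp add: prime_dvd_mult_iff)
    then have "a mod Q = a' mod Q \<or> v mod Q = v' mod Q"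
      by (metis cong_def cong_iff_dvd_diff cong_int_iff)
    then have a: "a = a'" using v * p by auto
    with e(1) have "[b = b'] (mod Q)" by (simp add: cong_add_lcancel_nat)
    then have "b = b'" using * p by (auto simp: cong_def)
    with a show "p = p'" by (simp add: p)
  qed
  have "\<phi> ` ({..<Q} \<times> {..<Q}) \<subseteq> {..<Q} \<times> {..<Q}"
    using prime_gt_0_nat[OF Q] by (auto simp: \<phi>_def)
  then have "\<phi> ` ({..<Q} \<times> {..<Q}) = {..<Q} \<times> {..<Q}"
    by (intro card_subset_eq) (auto simp: card_image[OF inj])
  then have bij: "bij_betw \<phi> ({..<Q} \<times> {..<Q}) ({..<Q} \<times> {..<Q})" using inj by (simp add: bij_betw_def)
  have "(\<Sum>w<Q\<^sup>2. F (affine_hash Q w v) (affine_hash Q w v'))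
    = (\<Sum>b<Q. \<Sum>a<Q. F ((a * v + b) mod Q) ((a * v' + b) mod Q))"
    unfolding affine_hash_def by (rule sum_seeds)
  also have "\<dots> = (\<Sum>p\<in>{..<Q} \<times> {..<Q}. (\<lambda>(x, y). F x y) (\<phi> p))"
    by (simp add: sum.cartesian_product \<phi>_def case_prod_unfold)
  also have "\<dots> = (\<Sum>p\<in>{..<Q} \<times> {..<Q}. (\<lambda>(x, y). F x y) p)"
    by (rule sum.reindex_bij_betw[OF bij])
  also have "\<dots> = (\<Sum>x<Q. \<Sum>y<Q. F x y)" by (simp add: sum.cartesian_product)
  finally show ?thesis .
qed

text \<open>The seed \<open>z\<close> packs three hash seeds in base \<open>Q\<^sup>2\<close>, so
  only its residue modulo \<open>Q ^ 6\<close> matters.\<close>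

definition hash_maj :: "nat \<Rightarrow> (nat \<Rightarrow> bool) \<Rightarrow> nat \<Rightarrow> nat \<Rightarrow> bool" where
  "hash_maj Q Y z v = maj3 (Y (affine_hash Q (z mod Q\<^sup>2) v)) (Y (affine_hash Q (z div Q\<^sup>2 mod Q\<^sup>2) v))
     (Y (affine_hash Q (z div Q\<^sup>2 div Q\<^sup>2 mod Q\<^sup>2) v))"

text \<open>Layer \<open>j\<close> uses the base-\<open>Q\<close> digits \<open>6 * j\<close> to
  \<open>6 * j + 5\<close> of \<open>c\<close>: fresh digits, so that its samples are independent of
  all earlier layers.\<close>

fun hash_layers :: "nat \<Rightarrow> (nat \<Rightarrow> bool) \<Rightarrow> nat \<Rightarrow> nat \<Rightarrow> nat \<Rightarrow> bool" where
  "hash_layers Q y c 0 = y"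
| "hash_layers Q y c (Suc j) = hash_maj Q (hash_layers Q y c j) (c div Q ^ (6 * j))"

definition ones_frac :: "nat \<Rightarrow> (nat \<Rightarrow> bool) \<Rightarrow> real" where
  "ones_frac Q Y = (\<Sum>v<Q. of_bool (Y v)) / Q"

text \<open>The probability that at least two of three independent bits of bias \<open>p\<close> are
  one.\<close>

definition maj3_poly :: "real \<Rightarrow> real" where
  "maj3_poly p = 3 * p\<^sup>2 - 2 * p ^ 3"

lemma sum_seed_triples:
  fixes F :: "nat \<Rightarrow> nat \<Rightarrow> nat \<Rightarrow> real"
  shows "(\<Sum>z<Q ^ 6. F (z mod Q\<^sup>2) (z div Q\<^sup>2 mod Q\<^sup>2) (z div Q\<^sup>2 div Q\<^sup>2 mod Q\<^sup>2)) =
    (\<Sum>w2<Q\<^sup>2. \<Sum>w1<Q\<^sup>2. \<Sum>w0<Q\<^sup>2. F w0 w1 w2)"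
proof -
  have *: "(\<Sum>z<R * R * R. F (z mod R) (z div R mod R) (z div R div R mod R)) =
    (\<Sum>w2<R. \<Sum>w1<R. \<Sum>w0<R. F w0 w1 w2)" for R
  proof -
    have d: "(p * R + r) div R = p" "(p * R + r) mod R = r" if "r < R" for p r using that by auto
    have "(\<Sum>z<R * R * R. F (z mod R) (z div R mod R) (z div R div R mod R)) =
      (\<Sum>p<R * R. \<Sum>r<R. F ((p * R + r) mod R) ((p * R + r) div R mod R) ((p * R + r) div R div R mod R))"
      by (rule sum_lessThan_mult)
    also have "\<dots> = (\<Sum>p<R * R. \<Sum>r<R. F r (p mod R) (p div R mod R))"
      by (intro sum.cong refl) (simp add: d)
    also have "\<dots> = (\<Sum>w2<R. \<Sum>w1<R. \<Sum>r<R. F r ((w2 * R + w1) mod R) ((w2 * R + w1) div R mod R))"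
      by (rule sum_lessThan_mult)
    also have "\<dots> = (\<Sum>w2<R. \<Sum>w1<R. \<Sum>w0<R. F w0 w1 w2)"
      by (intro sum.cong refl) (simp add: d)
    finally show ?thesis .
  qed
  have "Q ^ 6 = Q\<^sup>2 * Q\<^sup>2 * Q\<^sup>2" by (simp flip: power_add)
  then show ?thesis using *[of "Q\<^sup>2"] by simp
qed

lemma sum_hash_maj_single:
  fixes F :: "nat \<Rightarrow> nat \<Rightarrow> nat \<Rightarrow> real"
  assumes "Q > 0"
  shows "(\<Sum>z<Q ^ 6. F (affine_hash Q (z mod Q\<^sup>2) v) (affine_hash Q (z div Q\<^sup>2 mod Q\<^sup>2) v)
      (affine_hash Q (z div Q\<^sup>2 div Q\<^sup>2 mod Q\<^sup>2) v)) = Q ^ 3 * (\<Sum>x2<Q. \<Sum>x1<Q. \<Sum>x0<Q. F x0 x1 x2)"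
proof -
  note h = sum_affine_hash[OF assms]
  show ?thesis
    unfolding sum_seed_triples[of "\<lambda>a b c. F (affine_hash Q a v) (affine_hash Q b v) (affine_hash Q c v)"]
      h[of "\<lambda>x0. F x0 _ _"] h[of "\<lambda>x1. Q * (\<Sum>x0<Q. F x0 x1 _)"]
      h[of "\<lambda>x2. Q * (\<Sum>x1<Q. Q * (\<Sum>x0<Q. F x0 x1 x2))"]
    by (simp add: power3_eq_cube sum_distrib_left mult.assoc)
qed

lemma sum_hash_maj_pair:
  fixes F :: "nat \<Rightarrow> nat \<Rightarrow> nat \<Rightarrow> real"
  assumes Q: "prime Q" and v: "v < Q" "v' < Q" "v \<noteq> v'"
  shows "(\<Sum>z<Q ^ 6. F (affine_hash Q (z mod Q\<^sup>2) v) (affine_hash Q (z div Q\<^sup>2 mod Q\<^sup>2) v)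
      (affine_hash Q (z div Q\<^sup>2 div Q\<^sup>2 mod Q\<^sup>2) v) *
      F (affine_hash Q (z mod Q\<^sup>2) v') (affine_hash Q (z div Q\<^sup>2 mod Q\<^sup>2) v')
      (affine_hash Q (z div Q\<^sup>2 div Q\<^sup>2 mod Q\<^sup>2) v')) = (\<Sum>x2<Q. \<Sum>x1<Q. \<Sum>x0<Q. F x0 x1 x2)\<^sup>2"
proof -
  note h = sum_affine_hash_pair[OF Q v]
  let ?G = "\<lambda>x0 y0 x1 y1 x2 y2. F x0 x1 x2 * F y0 y1 y2"
  have "(\<Sum>x2<Q. \<Sum>y2<Q. \<Sum>x1<Q. \<Sum>y1<Q. \<Sum>x0<Q. \<Sum>y0<Q. ?G x0 y0 x1 y1 x2 y2)
      = (\<Sum>x2<Q. \<Sum>y2<Q. (\<Sum>x1<Q. \<Sum>x0<Q. F x0 x1 x2) * (\<Sum>y1<Q. \<Sum>y0<Q. F y0 y1 y2))"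
    by (simp add: sum_product)
  also have "\<dots> = (\<Sum>x2<Q. \<Sum>x1<Q. \<Sum>x0<Q. F x0 x1 x2)\<^sup>2"
    by (simp add: sum_product power2_eq_square)
  finally show ?thesis
    unfolding sum_seed_triples[of "\<lambda>a b c. F (affine_hash Q a v) (affine_hash Q b v) (affine_hash Q c v) *
       F (affine_hash Q a v') (affine_hash Q b v') (affine_hash Q c v')"]
      h[of "\<lambda>x0 y0. ?G x0 y0 _ _ _ _"]
      h[of "\<lambda>x1 y1. \<Sum>x0<Q. \<Sum>y0<Q. ?G x0 y0 x1 y1 _ _"]
      h[of "\<lambda>x2 y2. \<Sum>x1<Q. \<Sum>y1<Q. \<Sum>x0<Q. \<Sum>y0<Q. ?G x0 y0 x1 y1 x2 y2"]
    by simp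
qed

lemma maj3_triples:
  assumes "Q > 0"
  shows "(\<Sum>x2<Q. \<Sum>x1<Q. \<Sum>x0<Q. of_bool (maj3 (Y x0) (Y x1) (Y x2))) = Q ^ 3 * maj3_poly (ones_frac Q Y)"
proof -
  define y :: "nat \<Rightarrow> real" where "y = (\<lambda>v. of_bool (Y v))"
  define s where "s = (\<Sum>v<Q. y v)"
  have m: "of_bool (maj3 (Y a) (Y b) (Y c)) = y a * y b + y a * y c + y b * y c - 2 * y a * y b * y c" for a b c
    by (auto simp: y_def maj3_def)
  have "(\<Sum>x2<Q. \<Sum>x1<Q. \<Sum>x0<Q. of_bool (maj3 (Y x0) (Y x1) (Y x2))) = 3 * Q * s\<^sup>2 - 2 * s ^ 3"
    unfolding m sum.distrib sum_subtractf
    by (simp add: sum_distrib_left[symmetric] sum_distrib_right[symmetric] s_def[symmetric] mult.assoc power2_eq_square power3_eq_cube)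
  also have "\<dots> = Q ^ 3 * maj3_poly (s / Q)"
    using assms by (simp add: maj3_poly_def field_simps power2_eq_square power3_eq_cube)
  finally show ?thesis by (simp add: ones_frac_def s_def y_def)
qed

lemma maj3_poly_bounds: "0 \<le> p \<Longrightarrow> p \<le> 1 \<Longrightarrow> 0 \<le> maj3_poly p \<and> maj3_poly p \<le> 1"
proof
  assume p: "0 \<le> p" "p \<le> 1"
  have "maj3_poly p = p\<^sup>2 * (3 - 2 * p)" by (simp add: maj3_poly_def power2_eq_square power3_eq_cube algebra_simps)
  then show "0 \<le> maj3_poly p" using p by simp
  have "1 - maj3_poly p = (1 - p)\<^sup>2 * (1 + 2 * p)"
    by (simp add: maj3_poly_def power2_eq_square power3_eq_cube algebra_simps)
  then have "0 \<le> 1 - maj3_poly p" using p by simp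
  then show "maj3_poly p \<le> 1" by simp
qed

lemma maj3_poly_mono: "0 \<le> p \<Longrightarrow> p \<le> q \<Longrightarrow> q \<le> 1 \<Longrightarrow> maj3_poly p \<le> maj3_poly q"
proof -
  assume p: "0 \<le> p" "p \<le> q" "q \<le> 1"
  have "maj3_poly q - maj3_poly p = (q - p) * (3 * (p * (1 - p) + q * (1 - q)) + (q - p)\<^sup>2)"
    by (simp add: maj3_poly_def power2_eq_square power3_eq_cube algebra_simps)
  also have "\<dots> \<ge> 0" using p by (intro mult_nonneg_nonneg add_nonneg_nonneg) auto
  finally show ?thesis by simp
qed

lemma ones_frac_bounds: "0 \<le> ones_frac Q Y \<and> ones_frac Q Y \<le> 1"
proof -
  have "(\<Sum>v<Q. of_bool (Y v)) \<le> (\<Sum>v<Q. 1::real)" by (intro sum_mono) auto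
  then show ?thesis by (auto simp: ones_frac_def divide_le_eq_1 intro!: sum_nonneg divide_nonneg_nonneg)
qed

text \<open>Each centred wire \<open>\<Phi> z v\<close> has mean zero over the seeds. For distinct
  wires the mixed terms vanish by pairwise independence, and only the \<open>Q\<close> diagonal
  terms remain: a variance of at most \<open>1 / Q\<close>, summed over \<open>Q ^ 6\<close>
  seeds.\<close>

lemma hash_maj_variance:
  assumes Q: "prime Q"
  shows "(\<Sum>z<Q ^ 6. (ones_frac Q (hash_maj Q Y z) - maj3_poly (ones_frac Q Y))\<^sup>2) \<le> Q ^ 5"
proof -
  have Q0: "Q > 0" using Q by (simp add: prime_gt_0_nat)
  define f where "f = maj3_poly (ones_frac Q Y)"
  have f: "0 \<le> f" "f \<le> 1" unfolding f_def using maj3_poly_bounds ones_frac_bounds by auto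
  define \<phi> where "\<phi> = (\<lambda>a b c. of_bool (maj3 (Y a) (Y b) (Y c)) - f)"
  define \<Phi> where "\<Phi> = (\<lambda>z v. \<phi> (affine_hash Q (z mod Q\<^sup>2) v) (affine_hash Q (z div Q\<^sup>2 mod Q\<^sup>2) v)
      (affine_hash Q (z div Q\<^sup>2 div Q\<^sup>2 mod Q\<^sup>2) v))"
  have sq: "(ones_frac Q (hash_maj Q Y z) - f)\<^sup>2 = (\<Sum>v<Q. \<Sum>v'<Q. \<Phi> z v * \<Phi> z v') / Q\<^sup>2" for z
  proof -
    have "ones_frac Q (hash_maj Q Y z) - f = (\<Sum>v<Q. \<Phi> z v) / Q"
      using Q0 by (simp add: ones_frac_def hash_maj_def \<Phi>_def \<phi>_def sum_subtractf field_simps)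
    then show ?thesis by (simp add: power_divide power2_eq_square sum_product)
  qed
  have zero: "(\<Sum>x2<Q. \<Sum>x1<Q. \<Sum>x0<Q. \<phi> x0 x1 x2) = 0"
    unfolding \<phi>_def sum_subtractf maj3_triples[OF Q0]
    by (simp add: f_def power3_eq_cube)
  have vv: "(\<Sum>z<Q ^ 6. \<Phi> z v * \<Phi> z v') \<le> (if v = v' then real (Q ^ 6) else 0)" if "v < Q" "v' < Q" for v v'
  proof (cases "v = v'")
    case True
    have "\<Phi> z v * \<Phi> z v \<le> 1" for z
    proof -
      have "\<bar>\<Phi> z v\<bar> \<le> 1" using f by (auto simp: \<Phi>_def \<phi>_def)
      then have "(\<Phi> z v)\<^sup>2 \<le> 1" by (simp add: abs_square_le_1)
      then show ?thesis by (simp add: power2_eq_square)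
    qed
    then have "(\<Sum>z<Q ^ 6. \<Phi> z v * \<Phi> z v) \<le> (\<Sum>z<Q ^ 6. 1)" by (intro sum_mono)
    then show ?thesis using True by simp
  next
    case False
    then show ?thesis unfolding \<Phi>_def using sum_hash_maj_pair[OF Q that False, of \<phi>] zero by simp
  qed
  have "(\<Sum>v<Q. \<Sum>v'<Q. \<Sum>z<Q ^ 6. \<Phi> z v * \<Phi> z v') \<le> (\<Sum>v<Q. \<Sum>v'<Q. if v = v' then real (Q ^ 6) else 0)"
    by (intro sum_mono vv) auto
  also have "\<dots> = real Q * Q ^ 6" by simp
  finally have le: "(\<Sum>v<Q. \<Sum>v'<Q. \<Sum>z<Q ^ 6. \<Phi> z v * \<Phi> z v') \<le> real Q * Q ^ 6" .
  have "(\<Sum>z<Q ^ 6. (ones_frac Q (hash_maj Q Y z) - f)\<^sup>2) = (\<Sum>z<Q ^ 6. \<Sum>v<Q. \<Sum>v'<Q. \<Phi> z v * \<Phi> z v') / Q\<^sup>2"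
    unfolding sq by (simp add: sum_divide_distrib)
  also have "(\<Sum>z<Q ^ 6. \<Sum>v<Q. \<Sum>v'<Q. \<Phi> z v * \<Phi> z v') = (\<Sum>v<Q. \<Sum>z<Q ^ 6. \<Sum>v'<Q. \<Phi> z v * \<Phi> z v')"
    by (rule sum.swap)
  also have "\<dots> = (\<Sum>v<Q. \<Sum>v'<Q. \<Sum>z<Q ^ 6. \<Phi> z v * \<Phi> z v')"
    by (intro sum.cong refl sum.swap)
  also have "\<dots> / Q\<^sup>2 \<le> real Q * Q ^ 6 / Q\<^sup>2" using le by (intro divide_right_mono) auto
  also have "\<dots> = Q ^ 5" using Q0 by (simp add: field_simps numeral_eq_Suc)
  finally show ?thesis by (simp add: f_def)
qed

lemma hash_maj_chebyshev:
  assumes Q: "prime Q" and \<theta>: "\<theta> > 0"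
  shows "card {z \<in> {..<Q ^ 6}. ones_frac Q (hash_maj Q Y z) < maj3_poly (ones_frac Q Y) - \<theta>} \<le> Q ^ 6 * (1 / (Q * \<theta>\<^sup>2))"
proof -
  let ?B = "{z \<in> {..<Q ^ 6}. ones_frac Q (hash_maj Q Y z) < maj3_poly (ones_frac Q Y) - \<theta>}"
  have "card ?B * \<theta>\<^sup>2 = (\<Sum>z\<in>?B. \<theta>\<^sup>2)" by simp
  also have "\<dots> \<le> (\<Sum>z\<in>?B. (ones_frac Q (hash_maj Q Y z) - maj3_poly (ones_frac Q Y))\<^sup>2)"
    using \<theta> by (intro sum_mono) (auto simp: abs_le_square_iff[symmetric])
  also have "\<dots> \<le> (\<Sum>z<Q ^ 6. (ones_frac Q (hash_maj Q Y z) - maj3_poly (ones_frac Q Y))\<^sup>2)"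
    by (intro sum_mono2) auto
  also have "\<dots> \<le> Q ^ 5" by (rule hash_maj_variance[OF Q])
  finally show ?thesis using \<theta> prime_gt_0_nat[OF Q] by (simp add: field_simps numeral_eq_Suc)
qed

lemma hash_maj_add:
  assumes "Q > 0"
  shows "hash_maj Q Y (p * Q ^ 6 + z) = hash_maj Q Y z"
proof -
  have *: "(p * (R * R * R) + z) mod R = z mod R"
    "(p * (R * R * R) + z) div R mod R = z div R mod R"
    "(p * (R * R * R) + z) div R div R mod R = z div R div R mod R" if "R > 0" for R
  proof -
    have d: "(p * (R * R * R) + z) div R = p * (R * R) + z div R"
      using that div_mult_self3[of R "p * (R * R)" z] by (simp add: algebra_simps)
    have d2: "(p * (R * R) + z div R) div R = p * R + z div R div R"
      using that div_mult_self3[of R "p * R" "z div R"] by (simp add: algebra_simps)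
    show "(p * (R * R * R) + z) mod R = z mod R"
      using mod_mult_self3[of "p * (R * R)" R z] by (simp add: algebra_simps)
    show "(p * (R * R * R) + z) div R mod R = z div R mod R"
      unfolding d using mod_mult_self3[of "p * R" R "z div R"] by (simp add: algebra_simps)
    show "(p * (R * R * R) + z) div R div R mod R = z div R div R mod R"
      unfolding d d2 by simp
  qed
  have "Q ^ 6 = Q\<^sup>2 * Q\<^sup>2 * Q\<^sup>2" by (simp flip: power_add)
  then show ?thesis using *[of "Q\<^sup>2"] assms by (intro ext) (simp add: hash_maj_def)
qed

lemma hash_layers_add:
  assumes "Q > 0" "j \<le> k"
  shows "hash_layers Q y (p * Q ^ (6 * k) + r) j = hash_layers Q y r j"
  using assms(2)
proof (induction j)
  case (Suc j)
  have "6 * k = 6 * j + (6 + 6 * (k - Suc j))" using Suc.prems by simp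
  then have "p * Q ^ (6 * k) = p * Q ^ (6 * (k - Suc j)) * Q ^ 6 * Q ^ (6 * j)"
    by (simp only: power_add mult.assoc mult.commute mult.left_commute)
  then have "(p * Q ^ (6 * k) + r) div Q ^ (6 * j) = p * Q ^ (6 * (k - Suc j)) * Q ^ 6 + r div Q ^ (6 * j)"
  proof -
    have d: "(x * m + r) div m = x + r div m" if "m > 0" for x m r :: nat using that by simp
    show ?thesis using assms(1) \<open>p * Q ^ (6 * k) = _\<close> by (simp only: d zero_less_power)
  qed
  then show ?case using Suc by (simp add: hash_maj_add[OF assms(1)])
qed simp

lemma hash_layers_split:
  assumes "Q > 0" "r < Q ^ (6 * j)"
  shows "hash_layers Q y (z * Q ^ (6 * j) + r) j = hash_layers Q y r j"
    and "hash_layers Q y (z * Q ^ (6 * j) + r) (Suc j) = hash_maj Q (hash_layers Q y r j) z"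
proof -
  show *: "hash_layers Q y (z * Q ^ (6 * j) + r) j = hash_layers Q y r j"
    using assms(1) by (rule hash_layers_add) simp
  have "(z * Q ^ (6 * j) + r) div Q ^ (6 * j) = z" using assms by simp
  then show "hash_layers Q y (z * Q ^ (6 * j) + r) (Suc j) = hash_maj Q (hash_layers Q y r j) z"
    using * by simp
qed

lemma card_seeds_split:
  fixes Q :: nat
  shows "real (card {c \<in> {..<Q ^ (6 * Suc j)}. P c}) =
    (\<Sum>r<Q ^ (6 * j). real (card {z \<in> {..<Q ^ 6}. P (z * Q ^ (6 * j) + r)}))"
proof -
  have "Q ^ (6 * Suc j) = Q ^ 6 * Q ^ (6 * j)" by (simp only: mult_Suc_right power_add)
  then have "real (card {c \<in> {..<Q ^ (6 * Suc j)}. P c}) =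
     (\<Sum>z<Q ^ 6. \<Sum>r<Q ^ (6 * j). of_bool (P (z * Q ^ (6 * j) + r)))"
    by (simp only: card_of_bool_sum sum_lessThan_mult)
  also have "\<dots> = (\<Sum>r<Q ^ (6 * j). \<Sum>z<Q ^ 6. of_bool (P (z * Q ^ (6 * j) + r)))"
    by (rule sum.swap)
  finally show ?thesis by (simp only: card_of_bool_sum)
qed

text \<open>A union bound conditioned on the seed \<open>r\<close> of the earlier layers: bad
  prefixes count in full, good ones lose the fraction \<open>e\<close>.\<close>

lemma count_seeds_split:
  fixes Q :: nat and d e :: real
  assumes good: "\<And>r. r < Q ^ (6 * j) \<Longrightarrow> \<not> bad r \<Longrightarrow>
      real (card {z \<in> {..<Q ^ 6}. P (z * Q ^ (6 * j) + r)}) \<le> real Q ^ 6 * e"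
    and bad: "card {r \<in> {..<Q ^ (6 * j)}. bad r} \<le> real Q ^ (6 * j) * d" and e: "e \<ge> 0"
  shows "real (card {c \<in> {..<Q ^ (6 * Suc j)}. P c}) \<le> real Q ^ (6 * Suc j) * (d + e)"
proof -
  have "real (card {z \<in> {..<Q ^ 6}. P (z * Q ^ (6 * j) + r)}) \<le> real Q ^ 6 * of_bool (bad r) + real Q ^ 6 * e"
    if r: "r < Q ^ (6 * j)" for r
  proof (cases "bad r")
    case True
    have "card {z \<in> {..<Q ^ 6}. P (z * Q ^ (6 * j) + r)} \<le> card {..<Q ^ 6}"
      by (intro card_mono) auto
    then have "real (card {z \<in> {..<Q ^ 6}. P (z * Q ^ (6 * j) + r)}) \<le> real (Q ^ 6)"
      by (simp only: of_nat_le_iff card_lessThan)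
    also have "\<dots> \<le> real Q ^ 6 * of_bool (bad r) + real Q ^ 6 * e" using True e by simp
    finally show ?thesis .
  qed (use good[OF r] in simp)
  then have "real (card {c \<in> {..<Q ^ (6 * Suc j)}. P c})
    \<le> (\<Sum>r<Q ^ (6 * j). real Q ^ 6 * of_bool (bad r) + Q ^ 6 * e)"
    unfolding card_seeds_split by (intro sum_mono) auto
  also have "\<dots> = real Q ^ 6 * real (card {r \<in> {..<Q ^ (6 * j)}. bad r}) + real Q ^ (6 * j) * (real Q ^ 6 * e)"
    unfolding card_of_bool_sum by (simp only: sum.distrib sum_distrib_left[symmetric] sum_constant card_lessThan) simp
  also have "\<dots> \<le> real Q ^ 6 * (real Q ^ (6 * j) * d) + real Q ^ (6 * j) * (real Q ^ 6 * e)"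
    using bad by (intro add_right_mono mult_left_mono) auto
  also have "\<dots> = real Q ^ (6 * Suc j) * (d + e)" by (simp add: power_add algebra_simps)
  finally show ?thesis .
qed

text \<open>The guaranteed fraction of ones after each layer, except for few seeds.\<close>

fun threshold :: "real \<Rightarrow> real \<Rightarrow> nat \<Rightarrow> real" where
  "threshold \<theta> p 0 = p"
| "threshold \<theta> p (Suc j) = maj3_poly (threshold \<theta> p j) - \<theta>"

lemma few_bad_seeds:
  assumes Q: "prime Q" and \<theta>: "\<theta> > 0" and p: "p \<le> ones_frac Q y"
    and t: "\<And>i. i \<le> j \<Longrightarrow> 0 \<le> threshold \<theta> p i \<and> threshold \<theta> p i \<le> 1"
  shows "card {c \<in> {..<Q ^ (6 * j)}. ones_frac Q (hash_layers Q y c j) < threshold \<theta> p j}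
    \<le> Q ^ (6 * j) * (j / (Q * \<theta>\<^sup>2))"
  using t
proof (induction j)
  case 0
  then show ?case using p by (auto simp: not_less)
next
  case (Suc j)
  have Q0: "Q > 0" using Q by (simp add: prime_gt_0_nat)
  let ?bad = "\<lambda>r. ones_frac Q (hash_layers Q y r j) < threshold \<theta> p j"
  have "real (card {c \<in> {..<Q ^ (6 * Suc j)}. ones_frac Q (hash_layers Q y c (Suc j)) < threshold \<theta> p (Suc j)})
    \<le> real Q ^ (6 * Suc j) * (j / (Q * \<theta>\<^sup>2) + 1 / (Q * \<theta>\<^sup>2))"
  proof (rule count_seeds_split[where bad = ?bad])
    fix r assume r: "r < Q ^ (6 * j)" "\<not> ?bad r"
    then have "maj3_poly (threshold \<theta> p j) \<le> maj3_poly (ones_frac Q (hash_layers Q y r j))"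
      using Suc.prems[of j] ones_frac_bounds by (intro maj3_poly_mono) auto
    then have "card {z \<in> {..<Q ^ 6}. ones_frac Q (hash_layers Q y (z * Q ^ (6 * j) + r) (Suc j)) < threshold \<theta> p (Suc j)}
      \<le> card {z \<in> {..<Q ^ 6}. ones_frac Q (hash_maj Q (hash_layers Q y r j) z) < maj3_poly (ones_frac Q (hash_layers Q y r j)) - \<theta>}"
      unfolding hash_layers_split(2)[OF Q0 r(1)] by (intro card_mono) auto
    from order_trans[OF of_nat_mono[OF this] hash_maj_chebyshev[OF Q \<theta>]]
    show "real (card {z \<in> {..<Q ^ 6}. ones_frac Q (hash_layers Q y (z * Q ^ (6 * j) + r) (Suc j)) < threshold \<theta> p (Suc j)})
      \<le> real Q ^ 6 * (1 / (Q * \<theta>\<^sup>2))" by (simp only: of_nat_power)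
  qed (use Suc in simp_all)
  then show ?case by (simp add: add_divide_distrib algebra_simps)
qed

text \<open>Only one wire of the last layer matters, and over uniform seeds its three samples are
  independent and uniform. It is one with probability exactly \<open>maj3_poly\<close> of the
  fraction below, without a further loss of \<open>\<theta>\<close>.\<close>

lemma few_wrong_seeds:
  assumes Q: "prime Q" and \<theta>: "\<theta> > 0" and p: "p \<le> ones_frac Q y"
    and t: "\<And>i. i \<le> j \<Longrightarrow> 0 \<le> threshold \<theta> p i \<and> threshold \<theta> p i \<le> 1"
  shows "card {c \<in> {..<Q ^ (6 * Suc j)}. \<not> hash_layers Q y c (Suc j) v}
    \<le> Q ^ (6 * Suc j) * (j / (Q * \<theta>\<^sup>2) + (1 - maj3_poly (threshold \<theta> p j)))"
proof (rule count_seeds_split)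
  have Q0: "Q > 0" using Q by (simp add: prime_gt_0_nat)
  show "card {r \<in> {..<Q ^ (6 * j)}. ones_frac Q (hash_layers Q y r j) < threshold \<theta> p j} \<le> real Q ^ (6 * j) * (j / (Q * \<theta>\<^sup>2))"
    using few_bad_seeds[OF Q \<theta> p, of j] t by simp
  show "0 \<le> 1 - maj3_poly (threshold \<theta> p j)" using maj3_poly_bounds t[of j] by auto
  fix r assume r: "r < Q ^ (6 * j)" "\<not> ones_frac Q (hash_layers Q y r j) < threshold \<theta> p j"
  define Y where "Y = hash_layers Q y r j"
  have m: "maj3_poly (threshold \<theta> p j) \<le> maj3_poly (ones_frac Q Y)"
    unfolding Y_def using r(2) t[of j] ones_frac_bounds by (intro maj3_poly_mono) auto
  have "real (card {z \<in> {..<Q ^ 6}. \<not> hash_layers Q y (z * Q ^ (6 * j) + r) (Suc j) v})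
    = (\<Sum>z<Q ^ 6. 1 - (of_bool (hash_maj Q Y z v) :: real))"
    unfolding hash_layers_split(2)[OF Q0 r(1)] card_of_bool_sum Y_def by (intro sum.cong) auto
  also have "\<dots> = real (Q ^ 6) - (\<Sum>z<Q ^ 6. (of_bool (hash_maj Q Y z v) :: real))"
    by (simp only: sum_subtractf) simp
  also have "(\<Sum>z<Q ^ 6. of_bool (hash_maj Q Y z v)) = real (Q ^ 3 * Q ^ 3) * maj3_poly (ones_frac Q Y)"
    unfolding hash_maj_def
    using sum_hash_maj_single[OF Q0, of "\<lambda>a b c. of_bool (maj3 (Y a) (Y b) (Y c))" v] maj3_triples[OF Q0, of Y] by simp
  also have "real (Q ^ 3 * Q ^ 3) = Q ^ 6" by (simp flip: power_add)
  also have "real (Q ^ 6) - real (Q ^ 6) * maj3_poly (ones_frac Q Y) \<le> real Q ^ 6 * (1 - maj3_poly (threshold \<theta> p j))"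
    using mult_left_mono[OF m, of "real (Q ^ 6)"] by (simp add: algebra_simps)
  finally show "real (card {z \<in> {..<Q ^ 6}. \<not> hash_layers Q y (z * Q ^ (6 * j) + r) (Suc j) v}) \<le>
    real Q ^ 6 * (1 - maj3_poly (threshold \<theta> p j))" by simp
qed

text \<open>The advantage \<open>b\<close> over 1/2 becomes
  \<open>b * (3 / 2 - 2 * b\<^sup>2)\<close>, at least \<open>11 / 8 * b\<close> while
  \<open>b\<close> is below 1/4. The loss \<open>\<theta>\<close> is at most \<open>b / 8\<close>,
  which leaves \<open>5 / 4 * b\<close>. From 3/4 on, \<open>27 / 32 - 1 / 16\<close> is again at
  least 3/4.\<close>

lemma threshold_grows:
  assumes \<theta>: "0 < \<theta>" "\<theta> \<le> 1 / 16" and \<beta>: "8 * \<theta> \<le> \<beta>" "1 / 2 + \<beta> \<le> 1"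
  shows "threshold \<theta> (1 / 2 + \<beta>) j \<le> 1 \<and>
    (threshold \<theta> (1 / 2 + \<beta>) j \<ge> 3 / 4 \<or> threshold \<theta> (1 / 2 + \<beta>) j \<ge> 1 / 2 + (5 / 4) ^ j * \<beta>)"
proof (induction j)
  case 0
  then show ?case using \<beta> by simp
next
  case (Suc j)
  define t where "t = threshold \<theta> (1 / 2 + \<beta>) j"
  have g: "\<beta> \<le> (5 / 4) ^ j * \<beta>"
    using mult_right_mono[of 1 "(5 / 4) ^ j" \<beta>] \<theta> \<beta> by simp
  then have t: "t \<le> 1" "t \<ge> 3 / 4 \<or> t \<ge> 1 / 2 + (5 / 4) ^ j * \<beta>" "t \<ge> 0"
    using Suc \<theta> \<beta> unfolding t_def by linarith+
  have "maj3_poly t \<le> 1" using t maj3_poly_bounds by auto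
  moreover have "maj3_poly t - \<theta> \<ge> 3 / 4 \<or> maj3_poly t - \<theta> \<ge> 1 / 2 + (5 / 4) ^ Suc j * \<beta>"
  proof (cases "t \<ge> 3 / 4")
    case True
    then have "maj3_poly (3 / 4) \<le> maj3_poly t" using t by (intro maj3_poly_mono) auto
    moreover have "maj3_poly (3 / 4) = 27 / 32" by (simp add: maj3_poly_def power2_eq_square power3_eq_cube)
    ultimately show ?thesis using \<theta> by auto
  next
    case False
    define b where "b = t - 1 / 2"
    have b: "b \<ge> (5 / 4) ^ j * \<beta>" "b \<ge> 8 * \<theta>" "b < 1 / 4"
      using False t g \<beta> unfolding b_def by linarith+
    have "maj3_poly t = 1 / 2 + b * (3 / 2 - 2 * b\<^sup>2)"
      by (simp add: maj3_poly_def b_def power2_eq_square power3_eq_cube algebra_simps)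
    moreover have "b * (3 / 2 - 2 * b\<^sup>2) \<ge> b * (11 / 8)"
    proof (intro mult_left_mono)
      have "b\<^sup>2 \<le> (1 / 4)\<^sup>2" using b \<theta> by (intro power_mono) auto
      then show "11 / 8 \<le> 3 / 2 - 2 * b\<^sup>2" by (simp add: power2_eq_square)
    qed (use b \<theta> in auto)
    ultimately have "maj3_poly t - \<theta> \<ge> 1 / 2 + 5 / 4 * b" using b by simp
    then show ?thesis using b(1) by simp
  qed
  ultimately show ?case using \<theta> by (simp add: t_def)
qed

lemma threshold_bounds:
  assumes "0 < \<theta>" "\<theta> \<le> 1 / 16" "8 * \<theta> \<le> \<beta>" "1 / 2 + \<beta> \<le> 1"
  shows "0 \<le> threshold \<theta> (1 / 2 + \<beta>) j \<and> threshold \<theta> (1 / 2 + \<beta>) j \<le> 1"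
proof -
  have "0 \<le> (5 / 4) ^ j * \<beta>" using assms by (intro mult_nonneg_nonneg) auto
  then show ?thesis using threshold_grows[OF assms, of j] by linarith
qed

text \<open>An error \<open>e\<close> of at most 1/4 becomes at most
  \<open>3 * e\<^sup>2 + \<theta>\<close>, hence at most \<open>3 / 4 * e + \<theta>\<close>. The
  fixed point of this recursion is \<open>4 * \<theta>\<close>.\<close>

lemma threshold_converges:
  assumes \<theta>: "0 < \<theta>" "\<theta> \<le> 1 / 16" and \<beta>: "8 * \<theta> \<le> \<beta>" "1 / 2 + \<beta> \<le> 1"
    and h1: "(5 / 4) ^ h1 * \<beta> \<ge> 1 / 4"
  shows "1 - threshold \<theta> (1 / 2 + \<beta>) (h1 + i) \<le> (3 / 4) ^ i / 4 + 4 * \<theta>"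
proof (induction i)
  case 0
  then show ?case using threshold_grows[OF \<theta> \<beta>, of h1] h1 \<theta> by auto
next
  case (Suc i)
  define e where "e = 1 - threshold \<theta> (1 / 2 + \<beta>) (h1 + i)"
  have "(5 / 4 :: real) ^ (h1 + i) * \<beta> \<ge> (5 / 4) ^ h1 * \<beta>"
    using \<theta> \<beta> by (intro mult_right_mono power_increasing) auto
  then have e: "0 \<le> e" "e \<le> 1 / 4"
    using threshold_grows[OF \<theta> \<beta>, of "h1 + i"] h1 by (auto simp: e_def)
  have "1 - threshold \<theta> (1 / 2 + \<beta>) (h1 + Suc i) = 3 * e\<^sup>2 - 2 * e ^ 3 + \<theta>"
    by (simp add: e_def maj3_poly_def power2_eq_square power3_eq_cube algebra_simps)
  also have "\<dots> \<le> 3 * (1 / 4 * e) + \<theta>"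
    using mult_right_mono[OF e(2,1)] zero_le_power[OF e(1), of 3] unfolding power2_eq_square by linarith
  also have "\<dots> \<le> 3 * (1 / 4 * ((3 / 4) ^ i / 4 + 4 * \<theta>)) + \<theta>"
    using Suc by (simp add: e_def)
  finally show ?case by simp
qed

text \<open>Before the last layer the error is at most \<open>\<theta> + 4 * \<theta>\<close>, and
  the last layer turns it into at most \<open>3 * (5 * \<theta>)\<^sup>2\<close>. The other summand
  collects the Chebyshev failures of the earlier layers.\<close>

theorem hash_layers_amplify_ones:
  assumes Q: "prime Q" and \<theta>: "0 < \<theta>" "\<theta> \<le> 1 / 16" and \<beta>: "8 * \<theta> \<le> \<beta>" "1 / 2 + \<beta> \<le> ones_frac Q y"
    and h1: "(5 / 4) ^ h1 * \<beta> \<ge> 1 / 4" and h2: "(3 / 4) ^ h2 \<le> 4 * \<theta>"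
  shows "card {c \<in> {..<Q ^ (6 * Suc (h1 + h2))}. \<not> hash_layers Q y c (Suc (h1 + h2)) v}
    \<le> Q ^ (6 * Suc (h1 + h2)) * ((h1 + h2) / (Q * \<theta>\<^sup>2) + 75 * \<theta>\<^sup>2)"
proof -
  have \<beta>1: "1 / 2 + \<beta> \<le> 1" using \<beta> ones_frac_bounds[of Q y] by linarith
  note t = threshold_bounds[OF \<theta> \<beta>(1) \<beta>1]
  define e where "e = 1 - threshold \<theta> (1 / 2 + \<beta>) (h1 + h2)"
  have e: "0 \<le> e" "e \<le> 5 * \<theta>"
    using t[of "h1 + h2"] threshold_converges[OF \<theta> \<beta>(1) \<beta>1 h1, of h2] h2 by (auto simp: e_def)
  have "1 - maj3_poly (threshold \<theta> (1 / 2 + \<beta>) (h1 + h2)) = 3 * e\<^sup>2 - 2 * e ^ 3"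
    by (simp add: e_def maj3_poly_def power2_eq_square power3_eq_cube algebra_simps)
  also have "\<dots> \<le> 3 * (5 * \<theta>)\<^sup>2" using power_mono[OF e(2,1), of 2] zero_le_power[OF e(1), of 3] by linarith
  finally have m: "1 - maj3_poly (threshold \<theta> (1 / 2 + \<beta>) (h1 + h2)) \<le> 75 * \<theta>\<^sup>2" by (simp add: power_mult_distrib)
  have "real (card {c \<in> {..<Q ^ (6 * Suc (h1 + h2))}. \<not> hash_layers Q y c (Suc (h1 + h2)) v})
    \<le> Q ^ (6 * Suc (h1 + h2)) * (real (h1 + h2) / (Q * \<theta>\<^sup>2) + (1 - maj3_poly (threshold \<theta> (1 / 2 + \<beta>) (h1 + h2))))"
    using few_wrong_seeds[OF Q \<theta>(1) \<beta>(2), of "h1 + h2"] t by (simp only: of_nat_add) auto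
  also have "\<dots> \<le> Q ^ (6 * Suc (h1 + h2)) * (real (h1 + h2) / (Q * \<theta>\<^sup>2) + 75 * \<theta>\<^sup>2)"
    using m by (intro mult_left_mono add_left_mono) auto
  finally show ?thesis by simp
qed

section \<open>Duality between ones and zeros\<close>

lemma maj3_not: "maj3 (\<not> a) (\<not> b) (\<not> c) = (\<not> maj3 a b c)" by (auto simp: maj3_def)

lemma hash_layers_not: "hash_layers Q (\<lambda>v. \<not> y v) c j = (\<lambda>v. \<not> hash_layers Q y c j v)"
  by (induction j) (simp_all add: hash_maj_def maj3_not fun_eq_iff)

lemma ones_frac_not: "Q > 0 \<Longrightarrow> ones_frac Q (\<lambda>v. \<not> y v) = 1 - ones_frac Q y"
  by (simp add: ones_frac_def of_bool_not_iff sum_subtractf field_simps)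

theorem hash_layers_amplify:
  assumes Q: "prime Q" and \<theta>: "0 < \<theta>" "\<theta> \<le> 1 / 16" and \<beta>: "8 * \<theta> \<le> \<beta>"
    and y: "if b then 1 / 2 + \<beta> \<le> ones_frac Q y else ones_frac Q y \<le> 1 / 2 - \<beta>"
    and h: "(5 / 4) ^ h1 * \<beta> \<ge> 1 / 4" "(3 / 4) ^ h2 \<le> 4 * \<theta>"
  shows "card {c \<in> {..<Q ^ (6 * Suc (h1 + h2))}. hash_layers Q y c (Suc (h1 + h2)) v \<noteq> b}
    \<le> Q ^ (6 * Suc (h1 + h2)) * ((h1 + h2) / (Q * \<theta>\<^sup>2) + 75 * \<theta>\<^sup>2)"
proof (cases b)
  case True
  then show ?thesis using hash_layers_amplify_ones[OF Q \<theta> \<beta> _ h, of y v] y by simp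
next
  case False
  have "1 / 2 + \<beta> \<le> ones_frac Q (\<lambda>v. \<not> y v)"
    using y False ones_frac_not[of Q y] prime_gt_0_nat[OF Q] by simp
  from hash_layers_amplify_ones[OF Q \<theta> \<beta> this h, of v] show ?thesis
    using False unfolding hash_layers_not by simp
qed

section \<open>Correcting errors along lines\<close>

definition digit :: "nat \<Rightarrow> nat \<Rightarrow> nat \<Rightarrow> nat" where
  "digit Q c i = c div Q ^ i mod Q"

definition of_digits :: "nat \<Rightarrow> nat \<Rightarrow> (nat \<Rightarrow> nat) \<Rightarrow> nat" where
  "of_digits Q m d = (\<Sum>i<m. Q ^ i * d i)"

lemma of_digits_less: "(\<And>i. i < m \<Longrightarrow> d i < Q) \<Longrightarrow> of_digits Q m d < Q ^ m"
proof (induction m)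
  case (Suc m)
  then have "of_digits Q m d < Q ^ m" by simp
  moreover have "Q ^ m * d m \<le> Q ^ m * (Q - 1)" using Suc.prems[of m] by (intro mult_left_mono) auto
  moreover have "Q ^ Suc m = Q ^ m * (Q - 1) + Q ^ m" using Suc.prems[of m] by (cases Q) auto
  ultimately show ?case unfolding of_digits_def sum.lessThan_Suc by linarith
qed (simp add: of_digits_def)

lemma digit_of_digits:
  assumes "\<And>i. i < m \<Longrightarrow> d i < Q" "j < m"
  shows "digit Q (of_digits Q m d) j = d j"
proof -
  have Q: "Q > 0" using assms by fastforce
  obtain k where k: "m = j + Suc k" using assms(2) by (metis add_Suc_right less_imp_Suc_add)
  have "of_digits Q (j + Suc k) d = of_digits Q j d + Q ^ j * (d j + Q * of_digits Q k (\<lambda>i. d (j + Suc i)))"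
    by (induction k) (simp_all add: of_digits_def power_add algebra_simps)
  moreover have "of_digits Q j d < Q ^ j" using assms by (intro of_digits_less) auto
  ultimately have "of_digits Q m d div Q ^ j = d j + Q * of_digits Q k (\<lambda>i. d (j + Suc i))"
    using Q by (simp add: k)
  then show ?thesis using assms by (simp add: digit_def)
qed

lemma of_digits_digit: "c < Q ^ m \<Longrightarrow> of_digits Q m (digit Q c) = c"
proof -
  have "of_digits Q m (digit Q c) = c mod Q ^ m" for m
  proof (induction m)
    case (Suc m)
    then show ?case using mod_mult2_eq[of c "Q ^ m" Q]
      by (simp add: of_digits_def digit_def mult.commute)
  qed (simp add: of_digits_def)
  then show "c < Q ^ m \<Longrightarrow> of_digits Q m (digit Q c) = c" by simp
qed

lemma digit_less: "Q > 0 \<Longrightarrow> digit Q c i < Q"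
  by (simp add: digit_def)

lemma eq_by_digits:
  assumes "c < Q ^ m" "c' < Q ^ m" "\<And>i. i < m \<Longrightarrow> digit Q c i = digit Q c' i"
  shows "c = c'"
proof -
  have "of_digits Q m (digit Q c) = of_digits Q m (digit Q c')"
    unfolding of_digits_def using assms(3) by (intro sum.cong) auto
  then show ?thesis using assms by (simp add: of_digits_digit)
qed

text \<open>Numbers below \<open>Q ^ m\<close> stand for the vectors of their digits over the integers modulo \<open>Q\<close>.\<close>

definition shift :: "nat \<Rightarrow> nat \<Rightarrow> nat \<Rightarrow> (nat \<Rightarrow> nat) \<Rightarrow> nat" where
  "shift Q m c z = of_digits Q m (\<lambda>i. (digit Q c i + z i) mod Q)"

fun maj_tree :: "nat \<Rightarrow> (nat \<Rightarrow> bool) \<Rightarrow> nat \<Rightarrow> bool" where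
  "maj_tree 0 f j = f j"
| "maj_tree (Suc h) f j = maj3 (maj_tree h f (3 * j)) (maj_tree h f (3 * j + 1)) (maj_tree h f (3 * j + 2))"

text \<open>A wrong node has at least two wrong children.\<close>

lemma maj_tree_errors:
  "maj_tree h f j \<noteq> b \<Longrightarrow> 2 ^ h \<le> card {x \<in> {j * 3 ^ h..<(j + 1) * 3 ^ h}. f x \<noteq> b}"
proof (induction h arbitrary: j)
  case 0
  then have "{x \<in> {j * 3 ^ 0..<(j + 1) * 3 ^ 0}. f x \<noteq> b} = {j}" by auto
  then show ?case by simp
next
  case (Suc h)
  define E where "E = (\<lambda>j. {x \<in> {j * 3 ^ h..<(j + 1) * 3 ^ h}. f x \<noteq> b})"
  have fin: "finite (E i)" for i by (simp add: E_def)
  have disj: "E i \<inter> E i' = {}" if "i < i'" for i i'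
  proof -
    have "(i + 1) * 3 ^ h \<le> i' * 3 ^ h" using that by (intro mult_right_mono) auto
    then show ?thesis by (auto simp: E_def)
  qed
  have sub: "E (3 * j + r) \<subseteq> {x \<in> {j * 3 ^ Suc h..<(j + 1) * 3 ^ Suc h}. f x \<noteq> b}" if "r < 3" for r
  proof -
    have "j * 3 ^ Suc h \<le> (3 * j + r) * 3 ^ h" by simp
    moreover have "(3 * j + r + 1) * 3 ^ h \<le> (3 * j + 3) * 3 ^ h" using that by (intro mult_right_mono) auto
    moreover have "(3 * j + 3) * 3 ^ h = (j + 1) * 3 ^ Suc h" by (simp add: algebra_simps)
    ultimately have "{(3 * j + r) * 3 ^ h..<(3 * j + r + 1) * 3 ^ h} \<subseteq> {j * 3 ^ Suc h..<(j + 1) * 3 ^ Suc h}"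
      unfolding ivl_subset by linarith
    then show ?thesis unfolding E_def by blast
  qed
  obtain r r' where r: "r < r'" "r' < (3::nat)" "maj_tree h f (3 * j + r) \<noteq> b" "maj_tree h f (3 * j + r') \<noteq> b"
  proof -
    have "(maj_tree h f (3 * j + 0) \<noteq> b \<and> maj_tree h f (3 * j + 1) \<noteq> b) \<or>
      (maj_tree h f (3 * j + 0) \<noteq> b \<and> maj_tree h f (3 * j + 2) \<noteq> b) \<or>
      (maj_tree h f (3 * j + 1) \<noteq> b \<and> maj_tree h f (3 * j + 2) \<noteq> b)"
      using Suc.prems by (auto simp: maj3_def)
    then show ?thesis using that[of 0 1] that[of 0 2] that[of 1 2] by auto
  qed
  have "2 ^ Suc h \<le> card (E (3 * j + r)) + card (E (3 * j + r'))"
    using Suc.IH[OF r(3)] Suc.IH[OF r(4)] by (simp add: E_def)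
  also have "\<dots> = card (E (3 * j + r) \<union> E (3 * j + r'))"
    using disj[of "3 * j + r" "3 * j + r'"] r by (subst card_Un_disjoint) (auto simp: fin)
  also have "\<dots> \<le> card {x \<in> {j * 3 ^ Suc h..<(j + 1) * 3 ^ Suc h}. f x \<noteq> b}"
    using sub[of r] sub[of r'] r by (intro card_mono) auto
  finally show ?case .
qed

text \<open>
  Commuting orthogonal projections such that every \<open>j + 1\<close> of them annihilate \<open>f\<close>: in a common
  eigenbasis each component of \<open>f\<close> survives at most \<open>j\<close> of them.
\<close>

lemma sum_projections_le:
  fixes P :: "'b \<Rightarrow> ('a \<Rightarrow> real) \<Rightarrow> 'a \<Rightarrow> real" and N :: "('a \<Rightarrow> real) \<Rightarrow> real"
  assumes N: "\<And>f. N f \<ge> 0" "N (\<lambda>_. 0) = 0"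
    and pyth: "\<And>y f. y \<in> A \<Longrightarrow> N f = N (P y f) + N (\<lambda>c. f c - P y f c)"
    and lin: "\<And>y f g. y \<in> A \<Longrightarrow> P y (\<lambda>c. f c - g c) = (\<lambda>c. P y f c - P y g c)"
    and comm: "\<And>y y' f. y \<in> A \<Longrightarrow> y' \<in> A \<Longrightarrow> P y (P y' f) = P y' (P y f)"
    and "finite Y" "Y \<subseteq> A"
    and "\<And>ys. distinct ys \<Longrightarrow> set ys \<subseteq> Y \<Longrightarrow> length ys = Suc j \<Longrightarrow> foldr P ys f = (\<lambda>_. 0)"
  shows "(\<Sum>y\<in>Y. N (P y f)) \<le> j * N f"
  using assms(6-)
proof (induction Y arbitrary: f j rule: finite_induct)
  case empty
  then show ?case using N(1)[of f] by simp
next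
  case (insert y0 Y)
  show ?case
  proof (cases j)
    case 0
    have "N (P y f) = 0" if "y \<in> insert y0 Y" for y
      using insert.prems(2)[of "[y]"] that 0 N(2) by simp
    then show ?thesis using 0 by simp
  next
    case (Suc i)
    have y0: "y0 \<in> A" and YA: "Y \<subseteq> A" using insert.prems(1) by auto
    have P0: "P y (\<lambda>_. 0) = (\<lambda>_. 0)" if "y \<in> A" for y
      using lin[OF that, of "\<lambda>_. 0" "\<lambda>_. 0"] by simp
    have fl: "foldr P ys (\<lambda>c. f c - P y0 f c) = (\<lambda>c. foldr P ys f c - P y0 (foldr P ys f) c)" if "set ys \<subseteq> A" for ys
      using that y0 by (induction ys) (auto simp: lin comm)
    have fr: "foldr P ys (P y0 f) = (\<lambda>_. 0)" if "distinct ys" "set ys \<subseteq> Y" "length ys = Suc i" for ys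
    proof -
      have "foldr P (ys @ [y0]) f = (\<lambda>_. 0)"
        using that insert.hyps(2) by (intro insert.prems(2)) (auto simp: Suc)
      then show ?thesis by simp
    qed
    \<comment> \<open>On the image of \<open>P y0\<close> one of the allowed survivals is spent,
      which leaves \<open>i\<close>; on the complementary part all \<open>j\<close> are still
      available.\<close>
    have "(\<Sum>y\<in>Y. N (P y (P y0 f))) \<le> i * N (P y0 f)"
      by (rule insert.IH) (use YA fr in auto)
    moreover have "(\<Sum>y\<in>Y. N (P y (\<lambda>c. f c - P y0 f c))) \<le> j * N (\<lambda>c. f c - P y0 f c)"
    proof (rule insert.IH)
      fix ys assume ys: "distinct ys" "set ys \<subseteq> Y" "length ys = Suc j"
      then have "foldr P ys f = (\<lambda>_. 0)" by (intro insert.prems(2)) auto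
      then show "foldr P ys (\<lambda>c. f c - P y0 f c) = (\<lambda>_. 0)"
        using fl[of ys] ys YA P0[OF y0] by auto
    qed (use YA in auto)
    moreover have "N (P y f) = N (P y (P y0 f)) + N (P y (\<lambda>c. f c - P y0 f c))" if "y \<in> Y" for y
    proof -
      have y: "y \<in> A" using that YA by auto
      show ?thesis using pyth[OF y0, of "P y f"] by (simp add: comm[OF y0 y] lin[OF y])
    qed
    ultimately have "(\<Sum>y\<in>insert y0 Y. N (P y f)) \<le> N (P y0 f) + (i * N (P y0 f) + j * N (\<lambda>c. f c - P y0 f c))"
      using insert.hyps by (simp add: sum.distrib)
    also have "\<dots> = j * (N (P y0 f) + N (\<lambda>c. f c - P y0 f c))" by (simp add: Suc algebra_simps)
    also have "\<dots> = j * N f" using pyth[OF y0, of f] by simp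
    finally show ?thesis .
  qed
qed

locale prime_vectors =
  fixes Q m :: nat
  assumes Q: "prime Q" and m: "m > 0"
begin

abbreviation "M \<equiv> Q ^ m"

section \<open>Translations of digit vectors\<close>

lemma Q0: "Q > 0" using Q by (simp add: prime_gt_0_nat)

lemma shift_less: "shift Q m c z < M"
  unfolding shift_def using Q0 by (intro of_digits_less) auto

lemma digit_shift: "i < m \<Longrightarrow> digit Q (shift Q m c z) i = (digit Q c i + z i) mod Q"
  unfolding shift_def using Q0 by (intro digit_of_digits) auto

lemma shift_shift: "shift Q m (shift Q m c z) z' = shift Q m c (\<lambda>i. z i + z' i)"
  by (rule eq_by_digits[OF shift_less shift_less]) (simp add: digit_shift mod_simps add.assoc)

lemma shift_cong: "(\<And>i. i < m \<Longrightarrow> z i mod Q = z' i mod Q) \<Longrightarrow> shift Q m c z = shift Q m c z'"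
  by (rule eq_by_digits[OF shift_less shift_less]) (simp add: digit_shift, metis mod_add_right_eq)

lemma shift_0: "c < M \<Longrightarrow> shift Q m c (\<lambda>i. 0) = c"
  by (rule eq_by_digits[OF shift_less]) (simp_all add: digit_shift digit_less Q0)

lemma shift_cancel: "c < M \<Longrightarrow> c' < M \<Longrightarrow> shift Q m c z = shift Q m c' z \<Longrightarrow> c = c'"
proof -
  assume *: "c < M" "c' < M" "shift Q m c z = shift Q m c' z"
  \<comment> \<open>\<open>Q * z i - z i\<close> is the negative of \<open>z i\<close> modulo
    \<open>Q\<close> within the natural numbers.\<close>
  have inv: "shift Q m (shift Q m a z) (\<lambda>i. Q * z i - z i) = a" if "a < M" for a
  proof -
    have "shift Q m (shift Q m a z) (\<lambda>i. Q * z i - z i) = shift Q m a (\<lambda>i. 0)"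
      unfolding shift_shift using Q0 by (intro shift_cong) auto
    then show ?thesis using that by (simp add: shift_0)
  qed
  show ?thesis by (rule trans[OF inv[OF *(1), symmetric]]) (simp only: *(3) inv[OF *(2)])
qed

lemma sum_shift: "(\<Sum>c<M. F (shift Q m c z)) = (\<Sum>c<M. F c)"
proof (rule sum.reindex_bij_betw)
  have inj: "inj_on (\<lambda>c. shift Q m c z) {..<M}" by (rule inj_onI) (auto dest: shift_cancel)
  moreover have "(\<lambda>c. shift Q m c z) ` {..<M} = {..<M}"
    by (intro card_subset_eq) (auto simp: card_image[OF inj] shift_less)
  ultimately show "bij_betw (\<lambda>c. shift Q m c z) {..<M} {..<M}" by (simp add: bij_betw_def)
qed

text \<open>The \<open>x\<close>-fold of the point \<open>(1, y, y\<^sup>2, ...)\<close> of the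
  moment curve. Coordinate 0 is \<open>x\<close>, also for \<open>y = 0\<close>.\<close>

definition along :: "nat \<Rightarrow> nat \<Rightarrow> nat \<Rightarrow> nat" where
  "along y x = (\<lambda>i. x * y ^ i)"

text \<open>The value 0 outside the domain serves \<open>sum_projections_le\<close>, which speaks of
  equality of functions and not only of their values below \<open>M\<close>.\<close>

definition line_avg :: "nat \<Rightarrow> (nat \<Rightarrow> real) \<Rightarrow> nat \<Rightarrow> real" where
  "line_avg y f c = (if c < M then (\<Sum>x<Q. f (shift Q m c (along y x))) / Q else 0)"

definition sq_norm :: "(nat \<Rightarrow> real) \<Rightarrow> real" where
  "sq_norm f = (\<Sum>c<M. (f c)\<^sup>2)"

lemma line_avg_invariant:
  assumes "c < M"
  shows "line_avg y f (shift Q m c (along y x)) = line_avg y f c"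
proof -
  have "(\<Sum>x'<Q. f (shift Q m (shift Q m c (along y x)) (along y x')))
    = (\<Sum>x'<Q. f (shift Q m c (along y ((x + x') mod Q))))"
    unfolding shift_shift
    by (intro sum.cong refl arg_cong[where f = f] shift_cong) (simp add: along_def mod_mult_left_eq flip: add_mult_distrib)
  also have "\<dots> = (\<Sum>x'<Q. f (shift Q m c (along y x')))"
    by (rule sum_mod_shift[OF Q0])
  finally show ?thesis using assms shift_less by (simp add: line_avg_def)
qed

lemma shift_commute: "shift Q m (shift Q m c z) w = shift Q m (shift Q m c w) z"
  unfolding shift_shift by (rule shift_cong) (simp add: add.commute)

lemma line_avg_shift_invariant:
  assumes "c < M" "\<And>c. c < M \<Longrightarrow> g (shift Q m c z) = g c"
  shows "line_avg y g (shift Q m c z) = line_avg y g c"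
proof -
  have "(\<Sum>x<Q. g (shift Q m (shift Q m c z) (along y x))) = (\<Sum>x<Q. g (shift Q m c (along y x)))"
    by (intro sum.cong refl, subst shift_commute) (rule assms(2)[OF shift_less])
  then show ?thesis using assms shift_less by (simp add: line_avg_def)
qed

lemma line_avg_commute: "line_avg y (line_avg y' f) = line_avg y' (line_avg y f)"
proof
  fix c
  have "(\<Sum>x<Q. \<Sum>x'<Q. f (shift Q m (shift Q m c (along y x)) (along y' x')))
    = (\<Sum>x'<Q. \<Sum>x<Q. f (shift Q m (shift Q m c (along y x)) (along y' x')))"
    by (rule sum.swap)
  also have "\<dots> = (\<Sum>x'<Q. \<Sum>x<Q. f (shift Q m (shift Q m c (along y' x')) (along y x)))"
    by (intro sum.cong refl arg_cong[where f = f] shift_commute)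
  finally show "line_avg y (line_avg y' f) c = line_avg y' (line_avg y f) c"
    by (simp add: line_avg_def shift_less sum_divide_distrib[symmetric])
qed

lemma line_avg_diff: "line_avg y (\<lambda>c. f c - g c) = (\<lambda>c. line_avg y f c - line_avg y g c)"
  by (auto simp: line_avg_def sum_subtractf diff_divide_distrib)

lemma sum_line_avg: "(\<Sum>c<M. line_avg y f c) = (\<Sum>c<M. f c)"
proof -
  have "(\<Sum>c<M. line_avg y f c) = (\<Sum>c<M. \<Sum>x<Q. f (shift Q m c (along y x))) / Q"
    by (simp add: line_avg_def sum_divide_distrib)
  also have "(\<Sum>c<M. \<Sum>x<Q. f (shift Q m c (along y x))) = (\<Sum>x<Q. \<Sum>c<M. f (shift Q m c (along y x)))"
    by (rule sum.swap)
  also have "\<dots> = Q * (\<Sum>c<M. f c)" unfolding sum_shift by simp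
  finally show ?thesis using Q0 by simp
qed

text \<open>The average is constant along its lines, so \<open>f\<close> and
  \<open>line_avg y f\<close> have the same inner product with \<open>line_avg y f\<close>; the two
  parts are orthogonal.\<close>

lemma sq_norm_pythagoras: "sq_norm f = sq_norm (line_avg y f) + sq_norm (\<lambda>c. f c - line_avg y f c)"
proof -
  let ?g = "line_avg y f"
  have "(\<Sum>c<M. ?g c * ?g c) = (\<Sum>c<M. \<Sum>x<Q. f (shift Q m c (along y x)) * ?g (shift Q m c (along y x))) / Q"
  proof -
    have "?g c * ?g c = (\<Sum>x<Q. f (shift Q m c (along y x)) * ?g (shift Q m c (along y x))) / Q" if "c < M" for c
    proof -
      have "?g c * ?g c = (\<Sum>x<Q. f (shift Q m c (along y x))) / Q * ?g c"
        using that by (simp add: line_avg_def)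
      then show ?thesis using line_avg_invariant[OF that] by (simp add: sum_distrib_right)
    qed
    then show ?thesis by (simp add: sum_divide_distrib)
  qed
  also have "(\<Sum>c<M. \<Sum>x<Q. f (shift Q m c (along y x)) * ?g (shift Q m c (along y x)))
     = (\<Sum>x<Q. \<Sum>c<M. f (shift Q m c (along y x)) * ?g (shift Q m c (along y x)))"
    by (rule sum.swap)
  also have "\<dots> = Q * (\<Sum>c<M. f c * ?g c)"
    unfolding sum_shift[of "\<lambda>c. f c * ?g c"] by simp
  finally have "(\<Sum>c<M. ?g c * ?g c) = (\<Sum>c<M. f c * ?g c)" using Q0 by simp
  moreover have "sq_norm (\<lambda>c. f c - ?g c) = (\<Sum>c<M. f c * f c) - 2 * (\<Sum>c<M. f c * ?g c) + (\<Sum>c<M. ?g c * ?g c)"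
    unfolding sq_norm_def sum_distrib_left sum_subtractf[symmetric] sum.distrib[symmetric]
    by (intro sum.cong refl) (simp add: power2_eq_square algebra_simps)
  ultimately show ?thesis by (simp add: sq_norm_def power2_eq_square)
qed

text \<open>The Vandermonde matrix is invertible modulo a prime. Instead of a determinant, the
  coefficients of the polynomial \<open>p\<close> that vanishes at all nodes but one combine the
  equations into one that isolates \<open>a j0\<close>.\<close>

lemma vandermonde:
  assumes ys: "distinct ys" "length ys = m" "set ys \<subseteq> {..<Q}"
    and e: "\<And>i. i < m \<Longrightarrow> int Q dvd (\<Sum>j<m. a j * int (ys ! j) ^ i)"
    and j0: "j0 < m"
  shows "int Q dvd a j0"
proof -
  define p where "p = (\<Prod>j\<in>{..<m} - {j0}. [:- int (ys ! j), 1:])"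
  have deg: "degree p < m"
  proof -
    have "degree p \<le> sum (degree \<circ> (\<lambda>j. [:- int (ys ! j), 1:])) ({..<m} - {j0})"
      unfolding p_def by (rule degree_prod_sum_le) simp
    also have "\<dots> = m - 1" using j0 by simp
    finally show ?thesis using m by linarith
  qed
  have pp: "poly p x = (\<Sum>i<m. Polynomial.coeff p i * x ^ i)" for x
  proof -
    have "poly p x = (\<Sum>i\<le>degree p. Polynomial.coeff p i * x ^ i)" by (rule poly_altdef)
    also have "\<dots> = (\<Sum>i<m. Polynomial.coeff p i * x ^ i)"
      using deg by (intro sum.mono_neutral_left) (auto simp: coeff_eq_0)
    finally show ?thesis .
  qed
  have z: "poly p (int (ys ! j)) = 0" if "j < m" "j \<noteq> j0" for j
    unfolding p_def poly_prod using that by (intro prod_zero) auto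
  have "int Q dvd (\<Sum>i<m. Polynomial.coeff p i * (\<Sum>j<m. a j * int (ys ! j) ^ i))"
  proof (rule dvd_sum)
    fix i assume "i \<in> {..<m}"
    then show "int Q dvd Polynomial.coeff p i * (\<Sum>j<m. a j * int (ys ! j) ^ i)"
      using e by (intro dvd_mult) auto
  qed
  also have "(\<Sum>i<m. Polynomial.coeff p i * (\<Sum>j<m. a j * int (ys ! j) ^ i)) = (\<Sum>j<m. a j * poly p (int (ys ! j)))"
  proof -
    have "(\<Sum>i<m. Polynomial.coeff p i * (\<Sum>j<m. a j * int (ys ! j) ^ i))
      = (\<Sum>i<m. \<Sum>j<m. a j * (Polynomial.coeff p i * int (ys ! j) ^ i))"
      by (simp only: sum_distrib_left mult.left_commute)
    also have "\<dots> = (\<Sum>j<m. \<Sum>i<m. a j * (Polynomial.coeff p i * int (ys ! j) ^ i))"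
      by (rule sum.swap)
    finally show ?thesis by (simp only: pp sum_distrib_left)
  qed
  also have "\<dots> = a j0 * poly p (int (ys ! j0))"
    using j0 z by (subst sum.remove[of _ j0]) auto
  finally have "int Q dvd a j0 * (\<Prod>j\<in>{..<m} - {j0}. int (ys ! j0) - int (ys ! j))"
    by (simp add: p_def poly_prod)
  moreover have Qp: "prime (int Q)" using Q by simp
  moreover have "\<not> int Q dvd (\<Prod>j\<in>{..<m} - {j0}. int (ys ! j0) - int (ys ! j))"
  proof
    assume "int Q dvd (\<Prod>j\<in>{..<m} - {j0}. int (ys ! j0) - int (ys ! j))"
    then obtain j where j: "j < m" "j \<noteq> j0" "int Q dvd int (ys ! j0) - int (ys ! j)"
      using Qp by (auto simp: prime_dvd_prod_iff)
    then have "[ys ! j0 = ys ! j] (mod Q)" by (simp add: cong_iff_dvd_diff flip: cong_int_iff)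
    moreover have "ys ! j0 < Q" "ys ! j < Q" using ys j j0 by (auto simp: subset_iff)
    ultimately have "ys ! j0 = ys ! j" by (simp add: cong_def)
    then show False using ys j j0 by (simp add: nth_eq_iff_index_eq)
  qed
  ultimately show ?thesis by (simp add: prime_dvd_mult_iff)
qed

text \<open>By \<open>vandermonde\<close> the combinations of \<open>m\<close> distinct directions
  are pairwise different, and there are as many of them as vectors.\<close>

lemma directions_span:
  assumes ys: "distinct ys" "length ys = m" "set ys \<subseteq> {..<Q}" and c: "c < M"
  obtains x where "shift Q m 0 (\<lambda>i. \<Sum>j<m. x j * (ys ! j) ^ i) = c"
proof -
  define \<Psi> where "\<Psi> = (\<lambda>c. shift Q m 0 (\<lambda>i. \<Sum>j<m. digit Q c j * (ys ! j) ^ i))"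
  have "inj_on \<Psi> {..<M}"
  proof (rule inj_onI)
    fix a b assume ab: "a \<in> {..<M}" "b \<in> {..<M}" "\<Psi> a = \<Psi> b"
    have "int Q dvd int (digit Q a j) - int (digit Q b j)" if "j < m" for j
    proof (rule vandermonde[OF ys _ that])
      fix i assume i: "i < m"
      have "digit Q (\<Psi> a) i = digit Q (\<Psi> b) i" using ab by simp
      then have "[\<Sum>j<m. digit Q a j * (ys ! j) ^ i = \<Sum>j<m. digit Q b j * (ys ! j) ^ i] (mod Q)"
        using i by (simp add: \<Psi>_def digit_shift cong_def) (simp add: digit_def)
      then have "int Q dvd int (\<Sum>j<m. digit Q a j * (ys ! j) ^ i) - int (\<Sum>j<m. digit Q b j * (ys ! j) ^ i)"
        by (simp add: cong_iff_dvd_diff flip: cong_int_iff)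
      then show "int Q dvd (\<Sum>j<m. (int (digit Q a j) - int (digit Q b j)) * int (ys ! j) ^ i)"
        by (simp add: left_diff_distrib sum_subtractf)
    qed
    then have "[digit Q a j = digit Q b j] (mod Q)" if "j < m" for j
      using that by (simp add: cong_iff_dvd_diff flip: cong_int_iff)
    then have "digit Q a j = digit Q b j" if "j < m" for j
      using that by (simp add: cong_def digit_def)
    then show "a = b" using ab eq_by_digits[of a Q m b] by auto
  qed
  moreover have "\<Psi> ` {..<M} \<subseteq> {..<M}" by (auto simp: \<Psi>_def shift_less)
  ultimately have "\<Psi> ` {..<M} = {..<M}" by (intro endo_inj_surj) auto
  then obtain a where "\<Psi> a = c" using c by (metis imageE lessThan_iff)
  then show ?thesis using that unfolding \<Psi>_def by blast
qed

text \<open>After averaging along a spanning set of directions a function is constant, with its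
  total unchanged, here zero.\<close>

lemma line_avgs_annihilate:
  assumes ys: "distinct ys" "length ys = m" "set ys \<subseteq> {..<Q}" and f: "(\<Sum>c<M. f c) = 0"
  shows "foldr line_avg ys f = (\<lambda>_. 0)"
proof -
  define g where "g = foldr line_avg ys f"
  have "y \<in> set ys' \<Longrightarrow> c < M \<Longrightarrow> foldr line_avg ys' f (shift Q m c (along y x)) = foldr line_avg ys' f c" for ys' y x c
  proof (induction ys' arbitrary: c)
    case (Cons y' ys')
    show ?case
    proof (cases "y = y'")
      case True
      then show ?thesis using line_avg_invariant[OF Cons.prems(2)] by simp
    next
      case False
      then show ?thesis using Cons by (auto intro!: line_avg_shift_invariant)
    qed
  qed simp
  then have inv: "g (shift Q m c (along (ys ! j) x)) = g c" if "j < m" "c < M" for c j x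
    using that ys unfolding g_def by simp
  have inv': "k \<le> m \<Longrightarrow> g (shift Q m 0 (\<lambda>i. \<Sum>j<k. x j * (ys ! j) ^ i)) = g 0" for k x
  proof (induction k)
    case 0
    then show ?case using Q0 shift_0[of 0] by simp
  next
    case (Suc k)
    have "shift Q m 0 (\<lambda>i. \<Sum>j<Suc k. x j * (ys ! j) ^ i) =
      shift Q m (shift Q m 0 (\<lambda>i. \<Sum>j<k. x j * (ys ! j) ^ i)) (along (ys ! k) (x k))"
      by (simp add: shift_shift along_def)
    then show ?case using Suc inv[of k "shift Q m 0 (\<lambda>i. \<Sum>j<k. x j * (ys ! j) ^ i)"] shift_less by simp
  qed
  have const: "g c = g 0" if "c < M" for c
    using directions_span[OF ys that] inv'[of m] by (metis order.refl)
  have "(\<Sum>c<M. foldr line_avg ys' f c) = 0" for ys'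
    by (induction ys') (simp_all add: f sum_line_avg)
  then have "(\<Sum>c<M. g c) = 0" by (simp add: g_def)
  moreover have "(\<Sum>c<M. g c) = M * g 0" using const by simp
  ultimately have "g 0 = 0" using Q0 by simp
  \<comment> \<open>The list \<open>ys\<close> is nonempty because \<open>m > 0\<close>, so the
    outermost average vanishes outside the domain.\<close>
  moreover have "g c = 0" if "\<not> c < M" for c
    using that ys m unfolding g_def by (cases ys) (auto simp: line_avg_def)
  ultimately have "g c = 0" for c using const[of c] by (cases "c < M") simp_all
  then have "g = (\<lambda>_. 0)" by (rule ext)
  then show ?thesis by (simp only: g_def)
qed

text \<open>As averages are contractions, \<open>Q * sq_norm f\<close> is the trivial bound. With
  \<open>m\<close> in place of \<open>Q\<close>, averages along a random direction of the curve
  almost annihilate functions of mean zero.\<close>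

lemma sum_line_avg_norms:
  assumes "(\<Sum>c<M. f c) = 0"
  shows "(\<Sum>y<Q. sq_norm (line_avg y f)) \<le> m * sq_norm f"
proof -
  have "(\<Sum>y<Q. sq_norm (line_avg y f)) \<le> (m - 1) * sq_norm f"
  proof (rule sum_projections_le[where A = UNIV and P = line_avg and N = sq_norm and f = f])
    fix ys assume "distinct ys" "set ys \<subseteq> {..<Q}" "length ys = Suc (m - 1)"
    then show "foldr line_avg ys f = (\<lambda>_. 0)"
      using line_avgs_annihilate[OF _ _ _ assms, of ys] m by simp
  next
    show "sq_norm g = sq_norm (line_avg y g) + sq_norm (\<lambda>c. g c - line_avg y g c)" for y g
      by (rule sq_norm_pythagoras)
    show "line_avg y (line_avg y' g) = line_avg y' (line_avg y g)" for y y' g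
      by (rule line_avg_commute)
    show "line_avg y (\<lambda>c. g c - h c) = (\<lambda>c. line_avg y g c - line_avg y h c)" for y g h
      by (rule line_avg_diff)
  qed (simp_all add: sq_norm_def sum_nonneg)
  also have "\<dots> \<le> m * sq_norm f" by (intro mult_right_mono) (auto simp: sq_norm_def sum_nonneg)
  finally show ?thesis .
qed

text \<open>Line \<open>c\<close> has direction \<open>digit Q c 0\<close>; its parameter \<open>x\<close> is the digit 0 of the point.\<close>

definition line_point :: "nat \<Rightarrow> nat \<Rightarrow> nat" where
  "line_point c x = shift Q m (c div Q * Q) (along (c mod Q) x)"

lemma M_eq: "M = Q ^ (m - 1) * Q"
  using m by (cases m) auto

text \<open>Directions have coordinate 0 equal to 1, so each line meets the hyperplane of vectors
  with digit 0 equal to zero, the multiples of \<open>Q\<close>, exactly once.\<close>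

lemma sum_lines:
  fixes H :: "nat \<Rightarrow> real"
  assumes "\<And>c x. c < M \<Longrightarrow> H (shift Q m c (along y x)) = H c"
  shows "(\<Sum>c<M. H c) = Q * (\<Sum>p<Q ^ (m - 1). H (p * Q))"
proof -
  let ?D = "{..<Q ^ (m - 1)} \<times> {..<Q}"
  define \<phi> where "\<phi> = (\<lambda>(p, x). shift Q m (p * Q) (along y x))"
  have pM: "p * Q < M" if "p < Q ^ (m - 1)" for p
    unfolding M_eq using that Q0 by simp
  have inj: "inj_on \<phi> ?D"
  proof (rule inj_onI)
    fix a b assume ab: "a \<in> ?D" "b \<in> ?D" "\<phi> a = \<phi> b"
    obtain p x p' x' where p: "a = (p, x)" "b = (p', x')" by force
    have "digit Q (\<phi> a) 0 = digit Q (\<phi> b) 0" using ab by simp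
    then have "x = x'" using ab m by (simp add: p \<phi>_def digit_shift along_def) (simp add: digit_def)
    then have "shift Q m (p * Q) (along y x) = shift Q m (p' * Q) (along y x)"
      using ab by (simp add: p \<phi>_def)
    then have "p * Q = p' * Q" using ab by (intro shift_cancel[OF pM pM]) (auto simp: p)
    with \<open>x = x'\<close> show "a = b" using Q0 by (simp add: p)
  qed
  moreover have "\<phi> ` ?D = {..<M}"
  proof (rule card_subset_eq)
    show "\<phi> ` ?D \<subseteq> {..<M}" by (auto simp: \<phi>_def shift_less)
    have "card (\<phi> ` ?D) = card ?D" by (rule card_image[OF inj])
    then show "card (\<phi> ` ?D) = card {..<M}" using M_eq by simp
  qed simp
  ultimately have "bij_betw \<phi> ?D {..<M}" by (simp add: bij_betw_def)
  then have "(\<Sum>c<M. H c) = (\<Sum>q\<in>?D. H (\<phi> q))" by (rule sum.reindex_bij_betw[symmetric])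
  also have "\<dots> = (\<Sum>q\<in>?D. H (fst q * Q))"
    using assms pM by (intro sum.cong) (auto simp: \<phi>_def)
  also have "\<dots> = (\<Sum>p<Q ^ (m - 1). \<Sum>x<Q. H (p * Q))"
    by (simp only: sum.cartesian_product case_prod_unfold)
  finally show ?thesis by (simp add: sum_distrib_left)
qed

text \<open>Chebyshev's inequality over all lines. The mean number of errors on a line is
  \<open>Q * \<delta>\<close>, at most \<open>T / 2\<close> by assumption, so a bad line deviates by
  at least \<open>T / 2\<close>; \<open>sum_line_avg_norms\<close> bounds the total of the squared
  deviations.\<close>

theorem few_bad_lines:
  assumes T: "T > 0" and E: "2 * Q * real (card {c \<in> {..<M}. E c}) \<le> T * M"
  shows "card {c \<in> {..<M}. T \<le> real (card {x \<in> {..<Q}. E (line_point c x)})}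
    \<le> 4 * Q * m * card {c \<in> {..<M}. E c} / T\<^sup>2"
proof -
  define K where "K = real (card {c \<in> {..<M}. E c})"
  define \<delta> where "\<delta> = K / M"
  define f where "f = (\<lambda>c. of_bool (E c) - \<delta>)"
  define e where "e = (\<lambda>c. real (card {x \<in> {..<Q}. E (line_point c x)}))"
  have Ks: "K = (\<Sum>c<M. of_bool (E c))" unfolding K_def by (rule card_of_bool_sum)
  have M0: "real M > 0" using Q0 by simp
  have f0: "(\<Sum>c<M. f c) = 0" using M0 by (simp only: f_def sum_subtractf Ks[symmetric]) (simp add: \<delta>_def)
  have nf: "sq_norm f \<le> K"
  proof -
    have "(f c)\<^sup>2 = (1 - 2 * \<delta>) * of_bool (E c) + \<delta>\<^sup>2" for c
      by (cases "E c") (simp_all add: f_def power2_eq_square algebra_simps)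
    then have "sq_norm f = (1 - 2 * \<delta>) * K + M * \<delta>\<^sup>2"
      unfolding sq_norm_def Ks by (simp only: sum.distrib sum_distrib_left) simp
    also have "\<dots> = K - K * \<delta>" using M0 by (simp add: \<delta>_def power2_eq_square field_simps)
    also have "\<dots> \<le> K" unfolding \<delta>_def K_def by simp
    finally show ?thesis .
  qed
  have ee: "e c - Q * \<delta> = Q * line_avg (c mod Q) f (c div Q * Q)" if "c < M" for c
  proof -
    have "c div Q * Q < M" using that by (meson div_times_less_eq_dividend order_le_less_trans)
    then have "Q * line_avg (c mod Q) f (c div Q * Q) = (\<Sum>x<Q. f (line_point c x))"
      using Q0 by (simp add: line_avg_def line_point_def)
    also have "\<dots> = (\<Sum>x<Q. of_bool (E (line_point c x))) - Q * \<delta>"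
      by (simp only: f_def sum_subtractf) simp
    finally show ?thesis by (simp only: e_def card_of_bool_sum)
  qed
  have "(\<Sum>c<M. (e c - Q * \<delta>)\<^sup>2) = (\<Sum>c<M. (Q * line_avg (c mod Q) f (c div Q * Q))\<^sup>2)"
    using ee by (intro sum.cong) auto
  \<comment> \<open>Writing \<open>c\<close> as \<open>p * Q + y\<close> separates the base point
    \<open>p * Q\<close> from the direction \<open>y\<close>.\<close>
  also have "\<dots> = (\<Sum>c<Q ^ (m - 1) * Q. (Q * line_avg (c mod Q) f (c div Q * Q))\<^sup>2)"
    by (simp only: M_eq[symmetric])
  also have "\<dots> = (\<Sum>p<Q ^ (m - 1). \<Sum>y<Q. (Q * line_avg y f (p * Q))\<^sup>2)"
    unfolding sum_lessThan_mult by (intro sum.cong refl) auto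
  also have "\<dots> = (\<Sum>y<Q. \<Sum>p<Q ^ (m - 1). (Q * line_avg y f (p * Q))\<^sup>2)" by (rule sum.swap)
  also have "\<dots> = (\<Sum>y<Q. Q * sq_norm (line_avg y f))"
  proof (intro sum.cong refl)
    fix y
    have "sq_norm (line_avg y f) = Q * (\<Sum>p<Q ^ (m - 1). (line_avg y f (p * Q))\<^sup>2)"
      using sum_lines[where H = "\<lambda>c. (line_avg y f c)\<^sup>2" and y = y] by (simp add: sq_norm_def line_avg_invariant)
    then show "(\<Sum>p<Q ^ (m - 1). (Q * line_avg y f (p * Q))\<^sup>2) = Q * sq_norm (line_avg y f)"
      by (simp only: power_mult_distrib sum_distrib_left[symmetric]) (simp add: power2_eq_square)
  qed
  also have "\<dots> = Q * (\<Sum>y<Q. sq_norm (line_avg y f))" by (simp add: sum_distrib_left)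
  also have "\<dots> \<le> Q * (m * sq_norm f)" using sum_line_avg_norms[OF f0] by (intro mult_left_mono) auto
  also have "\<dots> \<le> Q * (m * K)" using nf by (intro mult_left_mono) auto
  finally have tot: "(\<Sum>c<M. (e c - Q * \<delta>)\<^sup>2) \<le> Q * m * K" by (simp add: mult.assoc)
  have QT: "Q * \<delta> \<le> T / 2" using E M0 by (simp add: \<delta>_def K_def field_simps)
  have "card {c \<in> {..<M}. T \<le> e c} * (T / 2)\<^sup>2 = (\<Sum>c\<in>{c \<in> {..<M}. T \<le> e c}. (T / 2)\<^sup>2)" by simp
  also have "\<dots> \<le> (\<Sum>c\<in>{c \<in> {..<M}. T \<le> e c}. (e c - Q * \<delta>)\<^sup>2)"
    using QT T by (intro sum_mono power_mono) auto
  also have "\<dots> \<le> (\<Sum>c<M. (e c - Q * \<delta>)\<^sup>2)" by (intro sum_mono2) auto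
  also have "\<dots> \<le> Q * m * K" by (rule tot)
  finally show ?thesis using T by (simp add: e_def K_def power_divide field_simps)
qed

end

section \<open>Primes between a number and its square\<close>

text \<open>
  The numbers \<open>L n k = 1 / (n * (n - 1 choose k))\<close> form Leibniz's harmonic triangle, in which
  \<open>L n (k + 1) = L (n - 1) k - L n k\<close>; so all \<open>D * L n k\<close> are integers if the \<open>D * L n 0\<close> are.
\<close>

lemma leibniz_triangle_dvd:
  fixes D :: nat
  assumes "\<And>j. 1 \<le> j \<Longrightarrow> j \<le> n \<Longrightarrow> j dvd D"
  shows "k < n \<Longrightarrow> n * ((n - 1) choose k) dvd D"
  using assms
proof (induction k arbitrary: n)
  case 0
  then show ?case by auto
next
  case (Suc k)
  define b where "b = (n - 1) choose k"
  have "n * b dvd D"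
    unfolding b_def using Suc by auto
  then obtain A where A: "D = n * b * A" by (elim dvdE)
  have "(n - 1) * ((n - 1 - 1) choose k) dvd D"
    using Suc.prems by (intro Suc.IH) auto
  then obtain B where B: "D = (n - 1) * ((n - 1 - 1) choose k) * B" by (elim dvdE)
  have c: "(n - 1) * ((n - 1 - 1) choose k) = (n - 1 - k) * b"
    unfolding b_def using binomial_absorb_comp[of "n - 1" k] by simp
  have bs: "Suc k * ((n - 1) choose Suc k) = (n - 1 - k) * b"
    unfolding b_def
    by (metis binomial_absorb_comp binomial_absorption)
  have b0: "b > 0" "n - 1 - k > 0" "n > 0"
    using Suc.prems by (auto simp: b_def zero_less_binomial_iff)
  have "int (n - 1 - k) * int b * int B = int n * int b * int A"
    using A B c by (metis of_nat_mult)
  then have e: "int (n - 1 - k) * int B = int n * int A"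
    using b0 by (simp add: mult.commute mult.left_commute)
  have nk: "int n = int (n - 1 - k) + int (Suc k)"
    using Suc.prems by auto
  \<comment> \<open>The cofactor is \<open>B - A\<close>, since \<open>A\<close> is
    \<open>D * L n k\<close> and \<open>B\<close> is \<open>D * L (n - 1) k\<close>. Integers avoid
    truncated subtraction.\<close>
  have "int (Suc k) * (int (n * ((n - 1) choose Suc k)) * (int B - int A))
      = int n * (int (n - 1 - k) * int b) * (int B - int A)"
    using bs by (metis (no_types, lifting) mult.assoc mult.left_commute of_nat_mult)
  also have "\<dots> = int n * int b * (int (n - 1 - k) * int B - int (n - 1 - k) * int A)"
    by (simp add: algebra_simps)
  also have "\<dots> = int n * int b * (int (Suc k) * int A)"
  proof -
    have "int (n - 1 - k) * int B - int (n - 1 - k) * int A = int (Suc k) * int A"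
      unfolding e by (subst nk) (simp only: algebra_simps)
    then show ?thesis by (simp only:)
  qed
  also have "\<dots> = int (Suc k) * int D"
    by (simp add: A algebra_simps)
  finally have "int (n * ((n - 1) choose Suc k)) * (int B - int A) = int D"
    by simp
  then have "int (n * ((n - 1) choose Suc k)) dvd int D" by (metis dvd_triv_left)
  then show ?case by (simp only: of_nat_dvd_iff)
qed

text \<open>If all primes up to \<open>n = X\<^sup>2\<close> were at most \<open>X\<close>, the
  product \<open>D\<close> of their largest powers up to \<open>n\<close> would be a common multiple
  of 1 to \<open>n\<close> and at most \<open>n ^ X\<close>. But the largest binomial coefficient of
  row \<open>n - 1\<close> forces \<open>D\<close> to be at least \<open>2 ^ (n - 1)\<close>. So
  weak a form of Bertrand's postulate suffices because \<open>Q\<close> matters only up to a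
  constant factor in its logarithm.\<close>

lemma exists_prime_le_square:
  assumes "X \<ge> 16"
  shows "\<exists>p::nat. prime p \<and> X < p \<and> p \<le> X\<^sup>2"
proof (rule ccontr)
  assume no: "\<not> ?thesis"
  define n where "n = X\<^sup>2"
  define e where "e = (\<lambda>p::nat. Max {i. p ^ i \<le> n})"
  define D where "D = (\<Prod>p | prime p \<and> p \<le> X. p ^ e p)"
  have n: "n > 0" "X \<le> n" using assms by (auto simp: n_def power2_eq_square)
  have fin: "finite {i. p ^ i \<le> n}" if "prime p" for p
  proof (rule finite_subset)
    show "{i. p ^ i \<le> n} \<subseteq> {..n}"
    proof
      fix i assume "i \<in> {i. p ^ i \<le> n}"
      moreover have "i < p ^ i" using prime_ge_2_nat[OF that] by (simp add: power_gt_expt)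
      ultimately show "i \<in> {..n}" by simp
    qed
  qed simp
  have e: "p ^ e p \<le> n" if "prime p" for p
  proof -
    have "e p \<in> {i. p ^ i \<le> n}" unfolding e_def
      using n by (intro Max_in fin that) (auto intro!: exI[of _ 0])
    then show ?thesis by simp
  qed
  have le: "i \<le> e p" if "prime p" "p ^ i \<le> n" for p i
    unfolding e_def using that fin by (intro Max_ge) auto
  have D0: "D > 0" unfolding D_def by (auto intro!: prod_pos prime_gt_0_nat)
  have "j dvd D" if "1 \<le> j" "j \<le> n" for j
  proof (rule multiplicity_le_imp_dvd)
    show "j \<noteq> 0" using that by simp
    fix p :: nat assume p: "prime p"
    show "multiplicity p j \<le> multiplicity p D"
    proof (cases "p dvd j")
      case False
      then show ?thesis by (simp add: not_dvd_imp_multiplicity_0)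
    next
      case True
      then have "p \<le> j" using that by (simp add: dvd_imp_le)
      then have "p \<le> n" using that by simp
      then have pX: "p \<le> X" using no p unfolding n_def by (meson not_le)
      have "p ^ multiplicity p j \<le> j"
        using that by (intro dvd_imp_le multiplicity_dvd) auto
      then have "multiplicity p j \<le> e p" using that by (intro le p) auto
      moreover have "p ^ e p dvd D"
        unfolding D_def using p pX by (intro dvd_prodI) auto
      ultimately show ?thesis
        using D0 p by (metis multiplicity_geI order_trans not_gr_zero not_prime_unit)
    qed
  qed
  then have dv: "n * ((n - 1) choose ((n - 1) div 2)) dvd D"
    using n by (intro leibniz_triangle_dvd) auto
  have "(2::nat) ^ (n - 1) = (\<Sum>k\<le>n - 1. (n - 1) choose k)" by (simp add: choose_row_sum)
  also have "\<dots> \<le> (\<Sum>k\<le>n - 1. (n - 1) choose ((n - 1) div 2))"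
    by (intro sum_mono binomial_maximum)
  also have "\<dots> = n * ((n - 1) choose ((n - 1) div 2))" using n by simp
  also have "\<dots> \<le> D" using dv D0 by (rule dvd_imp_le)
  also have "D \<le> (\<Prod>p | prime p \<and> p \<le> X. n)"
    unfolding D_def by (intro prod_mono) (auto intro: e)
  also have "\<dots> = n ^ card {p. prime p \<and> p \<le> X}" by simp
  also have "\<dots> \<le> n ^ X"
  proof -
    have "card {p::nat. prime p \<and> p \<le> X} \<le> card {1..X}"
      by (intro card_mono) (auto dest: prime_gt_0_nat)
    then show ?thesis using n by (intro power_increasing) auto
  qed
  also have "n ^ X = X ^ (2 * X)" by (simp add: n_def power_mult)
  also have "\<dots> \<le> (2 ^ (X div 4 + 2)) ^ (2 * X)"
  proof (intro power_mono)
    \<comment> \<open>For \<open>t = X div 4\<close>, where \<open>X\<close> is at most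
      \<open>4 * t + 3\<close>.\<close>
    have "4 * t + 3 \<le> 2 ^ (t + 2)" if "t \<ge> 2" for t :: nat
      using that by (induction t rule: dec_induct) auto
    from this[of "X div 4"] assms show "X \<le> 2 ^ (X div 4 + 2)" by linarith
  qed simp
  finally have "(2::nat) ^ (n - 1) \<le> 2 ^ ((X div 4 + 2) * (2 * X))"
    by (simp only: power_mult)
  then have "n - 1 \<le> (X div 4 + 2) * (2 * X)"
    by (rule power_le_imp_le_exp[rotated]) simp
  also have "\<dots> = (4 * (X div 4) + 8) * X div 2"
  proof -
    have "(4 * d + 8) * X = 2 * ((d + 2) * (2 * X))" for d by (simp add: algebra_simps)
    then show ?thesis by (simp only: nonzero_mult_div_cancel_left[of 2])
  qed
  also have "\<dots> \<le> (X + 8) * X div 2"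
    by (intro div_le_mono mult_right_mono add_right_mono) auto
  finally have "X * X \<le> (X + 8) * X div 2 + 1"
    by (simp add: n_def power2_eq_square)
  then have "X * X \<le> 8 * X + 2"
    by (simp add: algebra_simps) 
  moreover have "16 * X \<le> X * X" using assms by (intro mult_right_mono) auto
  ultimately show False using assms by linarith
qed

section \<open>The noisy network\<close>

lemma phase_window_position:
  fixes k i e :: nat
  assumes k: "k > 0" and s: "s \<le> t" "t < l" and i: "i < k ^ l"
    and e: "\<not> (i mod k ^ (t + 1)) div k ^ s + e < k\<^sup>2" "(i mod k ^ (t + 1)) div k ^ s + e - k\<^sup>2 < k ^ (t + 1 - s)"
  shows "i + e * k ^ s - k\<^sup>2 * k ^ s < k ^ l"
proof -
  define q where "q = (i mod k ^ (t + 1)) div k ^ s"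
  define lo where "lo = i mod k ^ (t + 1) mod k ^ s"
  define hi where "hi = i div k ^ (t + 1)"
  have i_eq: "i = hi * k ^ (t + 1) + (q * k ^ s + lo)"
    unfolding hi_def q_def lo_def by (simp only: div_mult_mod_eq)
  have lo: "lo < k ^ s" using k by (simp add: lo_def)
  have kl: "k ^ l = k ^ (l - (t + 1)) * k ^ (t + 1)"
    using s by (metis Suc_eq_plus1 Suc_leI le_add_diff_inverse2 power_add)
  then have hi: "hi < k ^ (l - (t + 1))" using i unfolding hi_def by (metis less_mult_imp_div_less)
  have le: "k\<^sup>2 * k ^ s \<le> q * k ^ s + e * k ^ s"
    using e by (simp add: q_def flip: add_mult_distrib)
  have "i + e * k ^ s - k\<^sup>2 * k ^ s = hi * k ^ (t + 1) + ((q + e - k\<^sup>2) * k ^ s + lo)"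
    using le unfolding i_eq by (simp add: diff_mult_distrib add_mult_distrib)
  also have "(q + e - k\<^sup>2) * k ^ s + lo < Suc (q + e - k\<^sup>2) * k ^ s" using lo by simp
  also have "Suc (q + e - k\<^sup>2) * k ^ s \<le> k ^ (t + 1 - s) * k ^ s" using e unfolding q_def by (intro mult_right_mono) auto
  also have "\<dots> = k ^ (t + 1)" using s by (simp flip: power_add)
  finally have "i + e * k ^ s - k\<^sup>2 * k ^ s < Suc hi * k ^ (t + 1)" by simp
  also have "\<dots> \<le> k ^ (l - (t + 1)) * k ^ (t + 1)" using hi by (intro mult_right_mono) auto
  also have "\<dots> = k ^ l" by (rule kl[symmetric])
  finally show ?thesis .
qed

lemma card_periodic_ge:
  assumes K: "K > 0" and a: "a \<le> card {e \<in> {..<K}. Y e}"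
  shows "Q div K * a \<le> card {v \<in> {..<Q}. Y (v mod K)}"
proof -
  have "Q div K * a \<le> (\<Sum>p<Q div K. card {e \<in> {..<K}. Y e})" using a by simp
  also have "\<dots> = (\<Sum>p<Q div K. \<Sum>r<K. of_bool (Y ((p * K + r) mod K)))"
    by (intro sum.cong refl) (simp add: Int_def)
  also have "\<dots> = (\<Sum>v<Q div K * K. of_bool (Y (v mod K)))" by (rule sum_lessThan_mult[symmetric])
  also have "\<dots> \<le> (\<Sum>v<Q. of_bool (Y (v mod K)))"
    by (intro sum_mono2) (auto elim: order_less_le_trans)
  finally show ?thesis by (simp add: Int_def)
qed

text \<open>The window is repeated periodically on the \<open>Q\<close> wires. The incomplete last
  period costs at most half of the advantage \<open>1 / (2 * K)\<close>, for windows of size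
  \<open>K\<close>, once \<open>Q\<close> is at least \<open>4 * K\<^sup>2\<close>.\<close>

lemma ones_frac_periodic:
  fixes Q :: nat
  assumes Q: "Q \<ge> 4 * (2 * b + 1)\<^sup>2" and a: "b + 1 \<le> card {e \<in> {..<2 * b + 1}. Y e}"
  shows "1 / 2 + 1 / (4 * real (2 * b + 1)) \<le> ones_frac Q (\<lambda>v. Y (v mod (2 * b + 1)))"
proof -
  define K where "K = 2 * b + 1"
  have K: "K > 0" by (simp add: K_def)
  have Q0: "Q > 0" using Q by (auto simp: power2_eq_square)
  have "real Q < (Q div K + 1) * K"
    using K by (metis dividend_less_div_times of_nat_less_iff Suc_eq_plus1 mult_Suc add.commute)
  then have d: "real Q / K - 1 \<le> Q div K" using K by (simp add: field_simps)
  have "(real Q / K - 1) * (b + 1) \<le> real (Q div K) * (b + 1)"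
    using d by (intro mult_right_mono) auto
  also have "\<dots> = real (Q div K * (b + 1))" by (simp only: of_nat_mult of_nat_add of_nat_1)
  also have "\<dots> \<le> real (card {v \<in> {..<Q}. Y (v mod K)})"
    using card_periodic_ge[OF K, of "b + 1" Y Q] a by (simp only: K_def of_nat_le_iff)
  also have "\<dots> = Q * ones_frac Q (\<lambda>v. Y (v mod K))"
    using Q0 by (simp only: ones_frac_def card_of_bool_sum) simp
  finally have 1: "(real Q / K - 1) * (b + 1) \<le> Q * ones_frac Q (\<lambda>v. Y (v mod K))" .
  have bK: "real (b + 1) = (real K + 1) / 2" by (simp add: K_def)
  have "real (4 * K\<^sup>2) \<le> real Q" using Q by (simp only: K_def of_nat_le_iff)
  then have "4 * real K * K \<le> Q" by (simp add: power2_eq_square)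
  then have "real K \<le> Q / (4 * real K)" using K by (simp add: field_simps)
  moreover have "(real Q / K - 1) * ((real K + 1) / 2) = Q / 2 + Q / (2 * real K) - (real K + 1) / 2"
    using K by (simp add: field_simps)
  moreover have "Q / (2 * real K) = Q / (4 * real K) + Q / (4 * real K)" by simp
  moreover have "real K \<ge> 1" using K by simp
  ultimately have "Q / 2 + Q / (4 * real K) \<le> (real Q / K - 1) * ((real K + 1) / 2)"
  proof -
    have "H + A \<le> H + (A + A) - (r + 1) / 2" if "r \<le> A" "1 \<le> r" for H A r :: real
    proof -
      have "r + 1 \<le> 2 * A" using that by linarith
      then show ?thesis by (simp add: field_simps)
    qed
    then show ?thesis
      unfolding \<open>(real Q / K - 1) * ((real K + 1) / 2) = _\<close> \<open>Q / (2 * real K) = _\<close>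
      using \<open>real K \<le> Q / (4 * real K)\<close> \<open>real K \<ge> 1\<close> by blast
  qed
  also have "\<dots> \<le> Q * ones_frac Q (\<lambda>v. Y (v mod K))" using 1 unfolding bK .
  finally have "Q / 2 + Q / (4 * real K) \<le> Q * ones_frac Q (\<lambda>v. Y (v mod K))" .
  then have "Q * (1 / 2 + 1 / (4 * real K)) \<le> Q * ones_frac Q (\<lambda>v. Y (v mod K))" by (simp add: field_simps)
  then show ?thesis using Q0 unfolding K_def by simp
qed

lemma ones_frac_window:
  assumes Q: "Q \<ge> 4 * (2 * k\<^sup>2 + 1)\<^sup>2"
  shows "if window_majority k Y then 1 / 2 + 1 / (4 * real (2 * k\<^sup>2 + 1)) \<le> ones_frac Q (\<lambda>v. Y (v mod (2 * k\<^sup>2 + 1)))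
    else ones_frac Q (\<lambda>v. Y (v mod (2 * k\<^sup>2 + 1))) \<le> 1 / 2 - 1 / (4 * real (2 * k\<^sup>2 + 1))"
proof -
  let ?K = "2 * k\<^sup>2 + 1"
  have set_eq: "{..2 * k\<^sup>2} = {..<?K}" by auto
  show ?thesis
  proof (cases "window_majority k Y")
    case True
    then show ?thesis using ones_frac_periodic[OF Q, of Y] by (simp add: window_majority_def set_eq)
  next
    case False
    have "card {..<?K} = card ({e \<in> {..<?K}. Y e} \<union> {e \<in> {..<?K}. \<not> Y e})"
      by (rule arg_cong[where f = card]) auto
    also have "\<dots> = card {e \<in> {..<?K}. Y e} + card {e \<in> {..<?K}. \<not> Y e}"
      by (rule card_Un_disjoint) auto
    finally have "k\<^sup>2 + 1 \<le> card {e \<in> {..<?K}. \<not> Y e}"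
      using False by (simp only: window_majority_def set_eq card_lessThan)
    from ones_frac_periodic[OF Q this] have
      "1 / 2 + 1 / (4 * real (2 * k\<^sup>2 + 1)) \<le> ones_frac Q (\<lambda>v. \<not> Y (v mod ?K))" by simp
    moreover have "Q > 0" using Q by (auto simp: power2_eq_square)
    ultimately show ?thesis using False ones_frac_not[of Q "\<lambda>v. Y (v mod ?K)"] by simp
  qed
qed

text \<open>\<open>hp\<close> is the logarithm of \<open>Q\<close> to base 3, rounded down: the
  height of the largest ternary tree with leaves on a line. The bound \<open>3 ^ (10 * l)\<close>
  makes \<open>hp\<close> at least \<open>10 * l\<close>, and \<open>(4 / 3) ^ 10\<close> exceeds
  16, which pays for the factor \<open>16 ^ l\<close> in \<open>gain\<close>. The bound on
  \<open>l\<close> is what \<open>l_bounds\<close> needs.\<close>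

locale majority_parameters =
  fixes l Q hp :: nat
  assumes l: "l \<ge> 10" and Q_prime: "prime Q" and Q_ge: "3 ^ (10 * l) \<le> Q" and Q_le: "Q \<le> 3 ^ (20 * l)"
    and hp: "3 ^ hp \<le> Q" "Q < 3 ^ (hp + 1)"
begin

definition "k = (2::nat) ^ l"
definition "K = 2 * k\<^sup>2 + 1"
text \<open>
  The first \<open>20 * l - 1\<close> hashing layers raise the advantage of the majority from about \<open>1 / K\<close> to \<open>1 / 4\<close>,
  the others reduce the fraction of errors to about \<open>1 / sqrt (sqrt Q)\<close>. Each layer uses 6 digits of
  the seed.
\<close>

definition "h = 40 * l"
definition "m = 240 * l"

sublocale prime_vectors Q m
  by unfold_locales (use Q_prime l in \<open>auto simp: m_def\<close>)

lemma k0: "k > 0" by (simp add: k_def)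

lemma M0: "real M > 0" using Q0 by simp

section \<open>Inequalities between the parameters\<close>

lemma K_le: "K \<le> 4 ^ (l + 1)"
proof -
  have "k\<^sup>2 = 4 ^ l" by (simp add: k_def power_mult[symmetric] mult.commute[of l 2]) (simp add: power_mult)
  moreover have "(1::nat) \<le> 4 ^ l" by simp
  ultimately show ?thesis unfolding K_def by simp
qed

lemma l_bounds: "40 * l + 75 \<le> 2 ^ l" "32 * l \<le> 2 ^ l" "720 \<le> (2::nat) ^ l"
  using l by (induction l rule: dec_induct) auto

lemma hp_ge: "hp \<ge> 10 * l"
proof -
  have "(3::nat) ^ (10 * l) < 3 ^ (hp + 1)" using Q_ge hp(2) by linarith
  then show ?thesis by (subst (asm) power_strict_increasing_iff) auto
qed

lemma four_thirds: "16 ^ l \<le> (4 / 3 :: real) ^ hp"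
proof -
  have "(16::real) ^ l \<le> ((4 / 3) ^ 10) ^ l" by (intro power_mono) (auto simp: power_divide)
  also have "\<dots> = (4 / 3) ^ (10 * l)" by (simp add: power_mult)
  also have "\<dots> \<le> (4 / 3) ^ hp" using hp_ge by (intro power_increasing) auto
  finally show ?thesis .
qed

lemma four_hp: "(4::real) ^ hp = (4 / 3) ^ hp * 3 ^ hp" by (simp add: power_divide)

text \<open>Roughly, \<open>sqrt Q\<close> is \<open>sqrt 3 ^ hp\<close>, exponentially below
  \<open>2 ^ hp\<close>. With this the failure rate of a hashing gadget,
  \<open>(40 * l + 75) / sqrt Q\<close>, is at most half of the error density that
  \<open>line_correction\<close> admits.\<close>

lemma sqrt_Q: "4 * (40 * l + 75) * sqrt Q \<le> 2 ^ hp"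
proof -
  have "real (48 * (40 * l + 75)\<^sup>2) \<le> 64 * (2 ^ l)\<^sup>2"
  proof -
    have "(40 * l + 75)\<^sup>2 \<le> (2 ^ l)\<^sup>2" using l_bounds by (intro power_mono) auto
    then have "48 * (40 * l + 75)\<^sup>2 \<le> 64 * (2 ^ l)\<^sup>2" by linarith
    then have "real (48 * (40 * l + 75)\<^sup>2) \<le> real (64 * (2 ^ l)\<^sup>2)" by (simp only: of_nat_le_iff)
    then show ?thesis by simp
  qed
  also have "\<dots> = 4 ^ 3 * 4 ^ l" by (simp add: power2_eq_square flip: power_mult_distrib)
  also have "\<dots> \<le> 4 ^ l * 4 ^ l" using l by (intro mult_right_mono power_increasing) auto
  also have "\<dots> = (16 :: real) ^ l" by (simp flip: power_mult_distrib)
  also note four_thirds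
  finally have A: "48 * (40 * real l + 75)\<^sup>2 \<le> (4 / 3) ^ hp" by simp
  have "(4 * (40 * l + 75) * sqrt Q)\<^sup>2 = 16 * (40 * real l + 75)\<^sup>2 * Q"
    by (simp add: power_mult_distrib) (simp add: power2_eq_square algebra_simps)
  also have "\<dots> \<le> 16 * (40 * real l + 75)\<^sup>2 * (3 * 3 ^ hp)"
  proof -
    have "real Q \<le> real (3 ^ (hp + 1))" using hp(2) by (simp only: of_nat_le_iff)
    then show ?thesis by (intro mult_left_mono) auto
  qed
  also have "\<dots> = 48 * (40 * real l + 75)\<^sup>2 * 3 ^ hp" by simp
  also have "\<dots> \<le> (4 / 3) ^ hp * 3 ^ hp" using A by (intro mult_right_mono) auto
  also have "\<dots> = (2 ^ hp)\<^sup>2" by (simp flip: four_hp add: power2_eq_square power_mult_distrib[symmetric])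
  finally show ?thesis by (rule power2_le_imp_le) simp
qed

text \<open>A line correction multiplies the number of errors by \<open>4 * Q * m / 4 ^ hp\<close>,
  roughly \<open>m * (3 / 4) ^ hp\<close>. This has to make up for the factor \<open>K\<close> of a
  union bound over the window.\<close>

lemma gain: "8 * real m * K * Q \<le> 4 ^ hp"
proof -
  have "5760 * l * K \<le> 5760 * l * 4 ^ (l + 1)" using K_le by (intro mult_left_mono) auto
  also have "\<dots> = 720 * (32 * l) * 4 ^ l" by simp
  also have "\<dots> \<le> 2 ^ l * 2 ^ l * 4 ^ l" using l_bounds by (intro mult_mono) auto
  also have "\<dots> = 16 ^ l" by (simp flip: power_mult_distrib)
  finally have "real (5760 * l * K) \<le> real (16 ^ l)" by (simp only: of_nat_le_iff)
  then have "24 * real m * K \<le> (4 / 3) ^ hp" using four_thirds by (simp add: m_def)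
  have "real Q \<le> real (3 ^ (hp + 1))" using hp(2) by (simp only: of_nat_le_iff)
  then have "8 * real m * K * Q \<le> 8 * real m * K * (3 * 3 ^ hp)" by (intro mult_left_mono) auto
  also have "\<dots> = (24 * real m * K) * 3 ^ hp" by simp
  also have "\<dots> \<le> (4 / 3) ^ hp * 3 ^ hp" using \<open>24 * real m * K \<le> (4 / 3) ^ hp\<close> by (intro mult_right_mono) auto
  finally show ?thesis by (simp flip: four_hp)
qed

lemma K_Q: "32 * real K \<le> sqrt (sqrt Q)"
proof -
  have "(32 * K) ^ 4 \<le> (32 * 4 ^ (l + 1)) ^ 4" using K_le by (intro power_mono) auto
  also have "32 * 4 ^ (l + 1) = (2::nat) ^ (2 * l + 7)" by (simp add: power_add power_mult)
  also have "(2 ^ (2 * l + 7)) ^ 4 = (2::nat) ^ (8 * l + 28)" by (simp flip: power_mult)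
  also have "\<dots> \<le> 2 ^ (12 * l)" using l by (intro power_increasing) auto
  also have "\<dots> = 4096 ^ l" by (simp add: power_mult)
  also have "\<dots> \<le> (3 ^ 10) ^ l" by (intro power_mono) auto
  also have "\<dots> \<le> Q" using Q_ge by (simp add: power_mult)
  finally have "real ((32 * K) ^ 4) \<le> real Q" by (simp only: of_nat_le_iff)
  then have "((32 * real K)\<^sup>2)\<^sup>2 \<le> real Q" by (simp flip: power_mult)
  then have "(32 * real K)\<^sup>2 \<le> sqrt Q" by (rule real_le_rsqrt)
  then show ?thesis by (rule real_le_rsqrt)
qed

lemma gadget_errors:
  "card {c \<in> {..<M}. hash_layers Q (\<lambda>v. Y (v mod K)) c h 0 \<noteq> window_majority k Y} \<le> M * 2 ^ hp / (4 * Q)"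
proof -
  \<comment> \<open>This choice balances the two error terms:
    \<open>1 / (Q * \<theta>\<^sup>2)\<close> and \<open>\<theta>\<^sup>2\<close> are both
    \<open>1 / sqrt Q\<close>.\<close>
  define \<theta> where "\<theta> = 1 / sqrt (sqrt Q)"
  define \<beta> where "\<beta> = 1 / (4 * real K)"
  define h1 where "h1 = 20 * l - 1"
  define h2 where "h2 = 20 * l"
  have hh: "h = Suc (h1 + h2)" using l by (simp add: h_def h1_def h2_def)
  have Qr: "real Q > 0" using Q0 by simp
  have K1: "real K \<ge> 1" by (simp add: K_def)
  have \<theta>0: "\<theta> > 0" using Qr by (simp add: \<theta>_def)
  have \<theta>K: "\<theta> \<le> 1 / (32 * K)" unfolding \<theta>_def using K_Q K1 Qr by (intro divide_left_mono mult_pos_pos) auto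
  have "1 / (32 * real K) \<le> 1 / 16" using K1 by (intro divide_left_mono) auto
  then have \<theta>1: "\<theta> \<le> 1 / 16" using \<theta>K by linarith
  have \<beta>: "8 * \<theta> \<le> \<beta>" using \<theta>K by (simp add: \<beta>_def)
  have \<theta>2: "\<theta>\<^sup>2 = 1 / sqrt Q" using Qr by (simp add: \<theta>_def power_divide)
  have h1: "(5 / 4) ^ h1 * \<beta> \<ge> 1 / 4"
  proof -
    have "real K \<le> real (4 ^ (l + 1))" using K_le by (simp only: of_nat_le_iff)
    also have "\<dots> \<le> ((5 / 4) ^ 7) ^ (l + 1)" unfolding of_nat_power by (intro power_mono) (auto simp: power_divide)
    also have "\<dots> = (5 / 4) ^ (7 * (l + 1))" by (simp only: power_mult)
    also have "\<dots> \<le> (5 / 4) ^ h1" using l by (intro power_increasing) (auto simp: h1_def)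
    finally show ?thesis using K1 by (simp add: \<beta>_def field_simps)
  qed
  have h2: "(3 / 4) ^ h2 \<le> 4 * \<theta>"
  proof -
    have "(3 / 4 :: real) ^ h2 = ((3 / 4) ^ 20) ^ l" by (simp add: h2_def power_mult)
    also have "\<dots> \<le> (1 / 3 ^ 5) ^ l" by (intro power_mono) (auto simp: power_divide)
    also have "\<dots> = 1 / 3 ^ (5 * l)" by (simp add: power_mult power_divide)
    also have "\<dots> \<le> \<theta>"
    proof -
      have "real Q \<le> real (3 ^ (20 * l))" using Q_le by (simp only: of_nat_le_iff)
      also have "\<dots> = ((3 ^ (5 * l))\<^sup>2)\<^sup>2" by (simp flip: power_mult)
      finally have "sqrt Q \<le> (3 ^ (5 * l))\<^sup>2" by (rule real_le_lsqrt[rotated]) simp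
      then have "sqrt (sqrt Q) \<le> 3 ^ (5 * l)" by (rule real_le_lsqrt[rotated]) simp
      then show ?thesis unfolding \<theta>_def using Qr by (intro divide_left_mono) auto
    qed
    finally show ?thesis using \<theta>0 by linarith
  qed
  have Q4: "4 * (2 * k\<^sup>2 + 1)\<^sup>2 \<le> Q"
  proof -
    have "(32 * real K)\<^sup>2 \<le> (sqrt (sqrt Q))\<^sup>2" using K_Q by (intro power_mono) auto
    then have "1024 * (real K)\<^sup>2 \<le> sqrt Q" using Qr by (simp add: power_mult_distrib)
    also have "sqrt Q \<le> Q"
    proof -
      have "1 \<le> real Q" using Q0 by simp
      then have "sqrt Q * 1 \<le> sqrt Q * sqrt Q" by (intro mult_left_mono) auto
      then show ?thesis using Qr by simp
    qed
    finally have "real (4 * K\<^sup>2) \<le> real Q" by simp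
    then show ?thesis by (simp only: K_def of_nat_le_iff)
  qed
  have y: "if window_majority k Y then 1 / 2 + \<beta> \<le> ones_frac Q (\<lambda>v. Y (v mod K)) else ones_frac Q (\<lambda>v. Y (v mod K)) \<le> 1 / 2 - \<beta>"
    using ones_frac_window[OF Q4, of Y] by (simp only: \<beta>_def K_def)
  have QM: "Q ^ (6 * h) = M" "real Q ^ (6 * h) = real M" by (simp_all add: m_def h_def)
  have "real (card {c \<in> {..<M}. hash_layers Q (\<lambda>v. Y (v mod K)) c h 0 \<noteq> window_majority k Y})
    \<le> M * ((h1 + h2) / (Q * \<theta>\<^sup>2) + 75 * \<theta>\<^sup>2)"
    using hash_layers_amplify[OF Q_prime \<theta>0 \<theta>1 \<beta> y h1 h2, of 0] unfolding hh[symmetric] by (simp only: QM of_nat_add)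
  also have "\<dots> = M * ((h1 + h2 + 75) / sqrt Q)"
    using Qr unfolding \<theta>2 by (simp add: field_simps real_sqrt_mult_self power2_eq_square)
  also have "\<dots> \<le> M * ((40 * l + 75) / sqrt Q)"
    by (intro mult_left_mono divide_right_mono) (auto simp: h1_def h2_def)
  also have "\<dots> = real M * (4 * (40 * l + 75) * sqrt Q) / (4 * real Q)"
  proof -
    have "x * (y / r) = x * (4 * y * r) / (4 * (r * r))" if "r > 0" for x y r :: real
      using that by (simp add: field_simps)
    from this[of "sqrt Q" "real M" "real (40 * l + 75)"] Qr show ?thesis by simp
  qed
  also have "\<dots> \<le> real M * 2 ^ hp / (4 * real Q)"
    using sqrt_Q by (intro divide_right_mono mult_left_mono) auto
  finally show ?thesis by simp
qed

text \<open>After \<open>l * l\<close> phases the network is idle while the lines remove the remaining errors.\<close>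

definition stage_window :: "nat \<Rightarrow> (nat \<Rightarrow> bool) \<Rightarrow> nat \<Rightarrow> nat \<Rightarrow> bool" where
  "stage_window j X i e = (if j < l * l then phase_window k (j div l) (stage_s l j) X i e else X i)"

text \<open>A point of the line names both the copy that is read and the seed of its hashing gadget;
  the same seeds recur in every stage.\<close>

fun copies :: "(nat \<Rightarrow> bool) \<Rightarrow> nat \<Rightarrow> nat \<Rightarrow> nat \<Rightarrow> bool" where
  "copies X 0 i c = X i"
| "copies X (Suc j) i c = maj_tree hp (\<lambda>x. hash_layers Q
     (\<lambda>v. stage_window j (\<lambda>i. copies X j i (line_point c x)) i (v mod K)) (line_point c x) h 0) 0"

definition ideal :: "(nat \<Rightarrow> bool) \<Rightarrow> nat \<Rightarrow> nat \<Rightarrow> bool" where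
  "ideal X j = network k l X (min j (l * l))"

text \<open>By \<open>maj_tree_errors\<close> a wrong tree lies on a line with at least
  \<open>2 ^ hp\<close> errors, so \<open>few_bad_lines\<close> applies with
  \<open>T = 2 ^ hp\<close>.\<close>

lemma line_correction:
  assumes "2 * Q * real (card {c \<in> {..<M}. G c \<noteq> b}) \<le> 2 ^ hp * M"
  shows "card {c \<in> {..<M}. maj_tree hp (\<lambda>x. G (line_point c x)) 0 \<noteq> b}
    \<le> 4 * Q * m * card {c \<in> {..<M}. G c \<noteq> b} / 4 ^ hp"
proof -
  have "card {c \<in> {..<M}. maj_tree hp (\<lambda>x. G (line_point c x)) 0 \<noteq> b}
    \<le> card {c \<in> {..<M}. 2 ^ hp \<le> real (card {x \<in> {..<Q}. G (line_point c x) \<noteq> b})}"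
  proof (intro card_mono subsetI)
    fix c assume "c \<in> {c \<in> {..<M}. maj_tree hp (\<lambda>x. G (line_point c x)) 0 \<noteq> b}"
    then have c: "c < M" "maj_tree hp (\<lambda>x. G (line_point c x)) 0 \<noteq> b" by auto
    note maj_tree_errors[OF c(2)]
    also have "card {x \<in> {0 * 3 ^ hp..<(0 + 1) * 3 ^ hp}. G (line_point c x) \<noteq> b} \<le> card {x \<in> {..<Q}. G (line_point c x) \<noteq> b}"
      using hp(1) by (intro card_mono) auto
    finally have "real (2 ^ hp) \<le> real (card {x \<in> {..<Q}. G (line_point c x) \<noteq> b})" by (simp only: of_nat_le_iff)
    then show "c \<in> {c \<in> {..<M}. 2 ^ hp \<le> real (card {x \<in> {..<Q}. G (line_point c x) \<noteq> b})}"
      using c(1) by simp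
  qed simp
  then have "real (card {c \<in> {..<M}. maj_tree hp (\<lambda>x. G (line_point c x)) 0 \<noteq> b})
    \<le> real (card {c \<in> {..<M}. 2 ^ hp \<le> real (card {x \<in> {..<Q}. G (line_point c x) \<noteq> b})})"
    by (simp only: of_nat_le_iff)
  also have "\<dots> \<le> 4 * Q * m * card {c \<in> {..<M}. G c \<noteq> b} / (2 ^ hp)\<^sup>2"
    using few_bad_lines[of "2 ^ hp" "\<lambda>c. G c \<noteq> b"] assms by simp
  also have "(2 ^ hp)\<^sup>2 = (4::real) ^ hp" by (simp add: power2_eq_square flip: power_mult_distrib)
  finally show ?thesis by simp
qed

lemma stage_window_errors:
  fixes e :: real
  assumes i: "i < k ^ l" and err: "\<And>i. i < k ^ l \<Longrightarrow> card {c \<in> {..<M}. Z i c \<noteq> X i} \<le> e"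
  shows "card {c \<in> {..<M}. stage_window j (\<lambda>i. Z i c) i a \<noteq> stage_window j X i a} \<le> e"
proof -
  have "{c \<in> {..<M}. stage_window j (\<lambda>i. Z i c) i a \<noteq> stage_window j X i a} \<subseteq> {} \<or>
    (\<exists>i'<k ^ l. {c \<in> {..<M}. stage_window j (\<lambda>i. Z i c) i a \<noteq> stage_window j X i a} \<subseteq> {c \<in> {..<M}. Z i' c \<noteq> X i'})"
  proof (cases "j < l * l")
    case True
    have t: "stage_s l j \<le> j div l" "j div l < l"
      using True l by (auto simp: stage_s_def less_mult_imp_div_less)
    show ?thesis
      using True phase_window_position[OF k0 t i, of a]
      by (auto simp: stage_window_def phase_window_def Let_def not_le)
  next
    case False
    then show ?thesis using i by (auto simp: stage_window_def)
  qed
  then obtain i' where i': "i' < k ^ l" "{c \<in> {..<M}. stage_window j (\<lambda>i. Z i c) i a \<noteq> stage_window j X i a} \<subseteq> {c \<in> {..<M}. Z i' c \<noteq> X i'}"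
    using i by blast
  then have "card {c \<in> {..<M}. stage_window j (\<lambda>i. Z i c) i a \<noteq> stage_window j X i a} \<le> card {c \<in> {..<M}. Z i' c \<noteq> X i'}"
    by (intro card_mono) auto
  then show ?thesis using err[OF i'(1)] by linarith
qed

text \<open>The bound \<open>e\<close> is what \<open>line_correction\<close> returns for the
  largest error set that it admits. In a stage, the union bound over the window gives
  \<open>K * e\<close>, by \<open>gain\<close> at most half of that set, and the gadget failures
  fill at most the other half. As \<open>ideal\<close> is fixed, \<open>gadget_errors\<close> can be
  used anew in every stage with the same seeds.\<close>

lemma copies_errors:
  assumes "j \<le> l * l" "i < k ^ l"
  shows "card {c \<in> {..<M}. copies X j i c \<noteq> ideal X j i} \<le> 2 * m * M / 2 ^ hp"
  using assms
proof (induction j arbitrary: i)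
  case 0
  then show ?case by (simp add: ideal_def)
next
  case (Suc j)
  define e where "e = 2 * m * M / (2 ^ hp :: real)"
  have IH: "card {c \<in> {..<M}. copies X j i c \<noteq> ideal X j i} \<le> e" if "i < k ^ l" for i
    unfolding e_def using Suc that by simp
  define G where "G = (\<lambda>c. hash_layers Q (\<lambda>v. stage_window j (\<lambda>i. copies X j i c) i (v mod K)) c h 0)"
  define Y where "Y = stage_window j (ideal X j) i"
  have ideal: "ideal X (Suc j) i = window_majority k Y"
  proof -
    have "Y = phase_window k (j div l) (stage_s l j) (ideal X j) i"
      using Suc.prems by (intro ext) (simp add: Y_def stage_window_def)
    then show ?thesis using Suc.prems by (simp add: ideal_def phase_def)
  qed
  have "{c \<in> {..<M}. G c \<noteq> ideal X (Suc j) i} \<subseteq>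
    (\<Union>a<K. {c \<in> {..<M}. stage_window j (\<lambda>i. copies X j i c) i a \<noteq> stage_window j (ideal X j) i a}) \<union>
    {c \<in> {..<M}. hash_layers Q (\<lambda>v. Y (v mod K)) c h 0 \<noteq> window_majority k Y}"
  proof
    fix c assume c: "c \<in> {c \<in> {..<M}. G c \<noteq> ideal X (Suc j) i}"
    show "c \<in> (\<Union>a<K. {c \<in> {..<M}. stage_window j (\<lambda>i. copies X j i c) i a \<noteq> stage_window j (ideal X j) i a}) \<union>
      {c \<in> {..<M}. hash_layers Q (\<lambda>v. Y (v mod K)) c h 0 \<noteq> window_majority k Y}"
    proof (cases "\<forall>a<K. stage_window j (\<lambda>i. copies X j i c) i a = Y a")
      case True
      then have "stage_window j (\<lambda>i. copies X j i c) i (v mod K) = Y (v mod K)" for v by (simp add: K_def)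
      then show ?thesis using c by (simp add: G_def ideal)
    next
      case False
      then show ?thesis using c by (auto simp: Y_def)
    qed
  qed
  then have "card {c \<in> {..<M}. G c \<noteq> ideal X (Suc j) i} \<le>
    card ((\<Union>a<K. {c \<in> {..<M}. stage_window j (\<lambda>i. copies X j i c) i a \<noteq> stage_window j (ideal X j) i a}) \<union>
    {c \<in> {..<M}. hash_layers Q (\<lambda>v. Y (v mod K)) c h 0 \<noteq> window_majority k Y})"
    by (intro card_mono) auto
  also have "\<dots> \<le> card (\<Union>a<K. {c \<in> {..<M}. stage_window j (\<lambda>i. copies X j i c) i a \<noteq> stage_window j (ideal X j) i a}) +
    card {c \<in> {..<M}. hash_layers Q (\<lambda>v. Y (v mod K)) c h 0 \<noteq> window_majority k Y}"
    by (rule card_Un_le)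
  also have "\<dots> \<le> (\<Sum>a<K. card {c \<in> {..<M}. stage_window j (\<lambda>i. copies X j i c) i a \<noteq> stage_window j (ideal X j) i a}) +
    card {c \<in> {..<M}. hash_layers Q (\<lambda>v. Y (v mod K)) c h 0 \<noteq> window_majority k Y}"
    by (intro add_right_mono card_UN_le) simp
  finally have "real (card {c \<in> {..<M}. G c \<noteq> ideal X (Suc j) i}) \<le>
    (\<Sum>a<K. real (card {c \<in> {..<M}. stage_window j (\<lambda>i. copies X j i c) i a \<noteq> stage_window j (ideal X j) i a})) +
    real (card {c \<in> {..<M}. hash_layers Q (\<lambda>v. Y (v mod K)) c h 0 \<noteq> window_majority k Y})"
    by (simp only: of_nat_le_iff of_nat_add[symmetric] of_nat_sum[symmetric])
  also have "\<dots> \<le> (\<Sum>a<K. e) + M * 2 ^ hp / (4 * Q)"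
    by (intro add_mono sum_mono gadget_errors stage_window_errors[OF Suc.prems(2) IH])
  also have "\<dots> = K * e + M * 2 ^ hp / (4 * Q)" by simp
  also have "K * e \<le> M * 2 ^ hp / (4 * Q)"
  proof -
    have "K * e = M * (8 * real m * K * Q) / (4 * Q * 2 ^ hp)" using Q0 by (simp add: e_def field_simps)
    also have "\<dots> \<le> real M * 4 ^ hp / (4 * Q * 2 ^ hp)" using gain by (intro divide_right_mono mult_left_mono) auto
    also have "(4::real) ^ hp = 2 ^ hp * 2 ^ hp" by (simp flip: power_mult_distrib)
    finally show ?thesis by simp
  qed
  finally have G: "real (card {c \<in> {..<M}. G c \<noteq> ideal X (Suc j) i}) \<le> M * 2 ^ hp / (2 * Q)" by simp
  then have "2 * Q * real (card {c \<in> {..<M}. G c \<noteq> ideal X (Suc j) i}) \<le> 2 ^ hp * M"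
    using Q0 by (simp add: field_simps)
  from line_correction[OF this] have "real (card {c \<in> {..<M}. copies X (Suc j) i c \<noteq> ideal X (Suc j) i})
    \<le> 4 * Q * m * card {c \<in> {..<M}. G c \<noteq> ideal X (Suc j) i} / 4 ^ hp"
    by (simp add: G_def)
  also have "\<dots> = 4 * real Q * real m * real (card {c \<in> {..<M}. G c \<noteq> ideal X (Suc j) i}) / 4 ^ hp" by simp
  also have "\<dots> \<le> 4 * real Q * real m * (M * 2 ^ hp / (2 * Q)) / 4 ^ hp"
    by (rule divide_right_mono[OF mult_left_mono[OF G]]) simp_all
  also have "(4::real) ^ hp = 2 ^ hp * 2 ^ hp" by (simp flip: power_mult_distrib)
  also have "4 * real Q * real m * (M * 2 ^ hp / (2 * Q)) / (2 ^ hp * 2 ^ hp) = 2 * m * M / (2 ^ hp :: real)"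
    using Q0 by (simp add: field_simps)
  finally show ?case .
qed

lemma errors_small: "2 * m * M / 2 ^ hp \<le> M * 2 ^ hp / (2 * Q :: real)" "2 * m * M / 2 ^ hp \<le> (M :: real)"
proof -
  have "4 * real m * 1 * Q \<le> 8 * real m * K * Q"
    by (intro mult_right_mono mult_mono) (auto simp: K_def)
  then have g: "4 * real m * Q \<le> 4 ^ hp" using gain by linarith
  have e: "(4::real) ^ hp = 2 ^ hp * 2 ^ hp" by (simp flip: power_mult_distrib)
  have "2 * m * M / 2 ^ hp = real M * (4 * real m * Q) / (2 * real Q * 2 ^ hp)" using Q0 by (simp add: field_simps)
  also have "\<dots> \<le> real M * 4 ^ hp / (2 * real Q * 2 ^ hp)" by (rule divide_right_mono[OF mult_left_mono[OF g]]) simp_all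
  also have "\<dots> = M * 2 ^ hp / (2 * Q :: real)" by (simp add: e)
  finally show 1: "2 * m * M / 2 ^ hp \<le> M * 2 ^ hp / (2 * Q :: real)" .
  have "(2::nat) ^ hp \<le> 3 ^ hp" by (intro power_mono) auto
  then have "2 ^ hp \<le> 2 * Q" using hp(1) by linarith
  then have "real (2 ^ hp) \<le> real (2 * Q)" by (simp only: of_nat_le_iff)
  then have "2 ^ hp \<le> 2 * real Q" by simp
  then have "real M * 2 ^ hp / (2 * Q) \<le> real M * (2 * real Q) / (2 * Q)"
    by (intro divide_right_mono mult_left_mono) auto
  also have "\<dots> = M" using Q0 by simp
  finally show "2 * m * M / 2 ^ hp \<le> (M :: real)" using 1 by simp
qed

section \<open>Removing the last errors\<close>

lemma maj3_same: "maj3 a a a = a" by (auto simp: maj3_def)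

lemma hash_layers_const: "hash_layers Q (\<lambda>v. b) c j = (\<lambda>v. b)"
  by (induction j) (simp_all add: hash_maj_def maj3_same fun_eq_iff)

text \<open>In an idle stage all window entries are the same bit, so the hashing layers pass it on
  and only the lines act; by \<open>gain\<close> they at least halve the number of errors.\<close>

lemma copies_errors_idle:
  assumes i: "i < k ^ l"
  shows "card {c \<in> {..<M}. copies X (l * l + j) i c \<noteq> ideal X (l * l) i} \<le> 2 * m * M / 2 ^ hp / 2 ^ j"
proof (induction j)
  case 0
  then show ?case using copies_errors[OF order.refl i, of X] by simp
next
  case (Suc j)
  define G where "G = copies X (l * l + j) i"
  define b where "b = ideal X (l * l) i"
  have cp: "copies X (l * l + Suc j) i c = maj_tree hp (\<lambda>x. G (line_point c x)) 0" for c
    by (simp add: stage_window_def hash_layers_const G_def)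
  have "real (card {c \<in> {..<M}. G c \<noteq> b}) \<le> 2 * m * M / 2 ^ hp / 2 ^ j" using Suc by (simp add: G_def b_def)
  also have "\<dots> \<le> 2 * m * M / 2 ^ hp / 1" by (intro divide_left_mono) auto
  finally have "real (card {c \<in> {..<M}. G c \<noteq> b}) \<le> M * 2 ^ hp / (2 * Q)" using errors_small by simp
  then have "2 * Q * real (card {c \<in> {..<M}. G c \<noteq> b}) \<le> 2 ^ hp * M"
    using Q0 by (simp add: field_simps)
  from line_correction[OF this] have "real (card {c \<in> {..<M}. copies X (l * l + Suc j) i c \<noteq> b})
    \<le> 4 * Q * m * card {c \<in> {..<M}. G c \<noteq> b} / 4 ^ hp" by (simp only: cp)
  also have "\<dots> = (4 * real m * Q) * card {c \<in> {..<M}. G c \<noteq> b} / 4 ^ hp" by simp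
  also have "\<dots> \<le> (4 ^ hp / 2) * card {c \<in> {..<M}. G c \<noteq> b} / 4 ^ hp"
  proof (intro divide_right_mono mult_right_mono)
    have "8 * real m * 1 * Q \<le> 8 * real m * K * Q"
      by (intro mult_right_mono mult_left_mono) (auto simp: K_def)
    then show "4 * real m * Q \<le> 4 ^ hp / 2" using gain by simp
  qed auto
  also have "\<dots> = card {c \<in> {..<M}. G c \<noteq> b} / 2" by simp
  also have "\<dots> \<le> (2 * m * M / 2 ^ hp / 2 ^ j) / 2"
    using Suc by (intro divide_right_mono) (simp_all add: G_def b_def)
  finally show ?case by (simp add: b_def)
qed

text \<open>The idle stages number \<open>10000 * (l * l)\<close>, more than \<open>log 2 M\<close>,
  so that less than one erroneous copy remains. They leave the order of the depth unchanged.\<close>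

definition "num_stages = 10001 * (l * l)"

lemma M_less: "real M < 2 ^ (10000 * (l * l))"
proof -
  have "M \<le> (3 ^ (20 * l)) ^ m" using Q_le by (intro power_mono) auto
  also have "\<dots> = 3 ^ (4800 * (l * l))" by (simp add: m_def flip: power_mult)
  also have "(3::nat) ^ (4800 * (l * l)) \<le> 4 ^ (4800 * (l * l))" by (intro power_mono) auto
  also have "\<dots> = (2\<^sup>2) ^ (4800 * (l * l))" by simp
  also have "\<dots> = 2 ^ (9600 * (l * l))" by (simp only: power_mult[symmetric] mult.assoc[symmetric]) simp
  also have "\<dots> < 2 ^ (10000 * (l * l))" using l by (intro power_strict_increasing) auto
  finally have "real M < real (2 ^ (10000 * (l * l)))" by (simp only: of_nat_less_iff)
  then show ?thesis by simp
qed

theorem copies_correct: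
  assumes "i < k ^ l" "c < M"
  shows "copies X num_stages i c = (i < card {p \<in> {..<k ^ l}. X p})"
proof -
  let ?E = "{c \<in> {..<M}. copies X (l * l + 10000 * (l * l)) i c \<noteq> ideal X (l * l) i}"
  have "real (card ?E) \<le> 2 * m * M / 2 ^ hp / 2 ^ (10000 * (l * l))"
    by (rule copies_errors_idle[OF assms(1)])
  also have "\<dots> \<le> M / 2 ^ (10000 * (l * l))" using errors_small by (intro divide_right_mono) auto
  also have "\<dots> < 1" using M_less by simp
  finally have "card ?E = 0" by simp
  then have "?E = {}" by simp
  then have "copies X (l * l + 10000 * (l * l)) i c = ideal X (l * l) i" using assms(2) by blast
  moreover have "num_stages = l * l + 10000 * (l * l)" by (simp add: num_stages_def)
  ultimately show ?thesis using network_sorts[OF k0 assms(1)] by (simp add: ideal_def)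
qed

end

section \<open>The circuit\<close>

text \<open>
  Wire \<open>(i * M + c) * Q + v\<close> of a layer belongs to position \<open>i\<close>, copy \<open>c\<close> and \<open>v < Q\<close>. A stage
  consists of a layer that reads the window, \<open>40 * l\<close> hashing layers, a layer that reads the
  points of a line, and \<open>hp\<close> layers of the tree; its result is at \<open>v = 0\<close>.
\<close>

definition maj_src :: "nat \<Rightarrow> nat \<Rightarrow> nat \<Rightarrow> nat \<Rightarrow> nat \<Rightarrow> nat \<Rightarrow> nat" where
  "maj_src l Q hp L w r = (let k = 2 ^ l; M = Q ^ (240 * l); S = 40 * l + 2 + hp; j = L div S; p = L mod S;
     v = w mod Q; c = w div Q mod M; i = w div Q div M in
     if p = 0 then
       (if j < l * l then
          (let t = j div l; s = stage_s l j; q = i mod k ^ (t + 1) div k ^ s; e = v mod (2 * k\<^sup>2 + 1) in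
           if q + e < k\<^sup>2 then 1 else if k ^ (t + 1 - s) \<le> q + e - k\<^sup>2 then 0
           else 2 + ((i + e * k ^ s - k\<^sup>2 * k ^ s) * M + c) * Q)
        else 2 + (i * M + c) * Q)
     else if p \<le> 40 * l then 2 + ((i * M + c) * Q + affine_hash Q (c div Q ^ (6 * (p - 1)) div (Q\<^sup>2) ^ r mod Q\<^sup>2) v)
     else if p = 40 * l + 1 then 2 + (i * M + prime_vectors.line_point Q (240 * l) c v) * Q
     else 2 + ((i * M + c) * Q + (3 * v + r) mod Q))"

lemma read_source_simps: "read_source V (2 + u) = V u" "read_source V 0 = False" "read_source V 1 = True"
  by (simp_all add: read_source_def)

lemma decode:
  fixes v Q c M :: nat
  assumes "v < Q" "c < M"
  shows "((i * M + c) * Q + v) mod Q = v" "((i * M + c) * Q + v) div Q mod M = c"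
    "((i * M + c) * Q + v) div Q div M = i"
  using assms by simp_all

lemma encode_less:
  fixes v Q c M :: nat
  assumes "v < Q" "c < M" "i < N"
  shows "(i * M + c) * Q + v < N * M * Q"
proof -
  have "i * M + c < Suc i * M" using assms by simp
  also have "\<dots> \<le> N * M" using assms by (intro mult_right_mono) auto
  finally have "Suc (i * M + c) * Q \<le> N * M * Q" by (intro mult_right_mono) auto
  then show ?thesis using assms by simp
qed

context majority_parameters
begin

definition "N = k ^ l"
definition "W = N * M * Q"
definition "S = h + 2 + hp"

abbreviation "src \<equiv> maj_src l Q hp"

lemma m_eq: "240 * l = m" by (simp add: m_def)
lemma h_eq: "40 * l = h" by (simp add: h_def)

lemma line_point_less: "line_point c x < M"
  unfolding line_point_def by (rule shift_less)

lemma src_at: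
  assumes "p < S" "v < Q" "c < M"
  shows "src (j * S + p) ((i * M + c) * Q + v) r =
    (if p = 0 then
       (if j < l * l then
          (let t = j div l; s = stage_s l j; q = i mod k ^ (t + 1) div k ^ s; e = v mod K in
           if q + e < k\<^sup>2 then 1 else if k ^ (t + 1 - s) \<le> q + e - k\<^sup>2 then 0
           else 2 + ((i + e * k ^ s - k\<^sup>2 * k ^ s) * M + c) * Q)
        else 2 + (i * M + c) * Q)
     else if p \<le> h then 2 + ((i * M + c) * Q + affine_hash Q (c div Q ^ (6 * (p - 1)) div (Q\<^sup>2) ^ r mod Q\<^sup>2) v)
     else if p = h + 1 then 2 + (i * M + line_point c v) * Q
     else 2 + ((i * M + c) * Q + (3 * v + r) mod Q))"
proof -
  have "(j * S + p) div S = j" "(j * S + p) mod S = p" using assms(1) by auto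
  note * = this
  show ?thesis
    unfolding maj_src_def Let_def m_eq h_eq k_def[symmetric] S_def[symmetric] K_def[symmetric] decode[OF assms(2,3)] *
    by (rule refl)
qed

lemma affine_hash_less: "affine_hash Q w v < Q"
  using Q0 by (simp add: affine_hash_def)

lemma src_less:
  assumes w: "w < W"
  shows "src L w r < W + 2"
proof -
  define v c i where "v = w mod Q" and "c = w div Q mod M" and "i = w div Q div M"
  define j p where "j = L div S" and "p = L mod S"
  have S0: "S > 0" by (simp add: S_def)
  have vc: "v < Q" "c < M" using Q0 by (auto simp: v_def c_def)
  have "w div Q div M < N"
    using w unfolding W_def by (intro less_mult_imp_div_less) (simp add: mult.assoc mult.commute)
  then have i: "i < N" by (simp add: i_def)
  have w_eq: "w = (i * M + c) * Q + v" by (simp only: v_def c_def i_def div_mult_mod_eq)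
  have L_eq: "L = j * S + p" by (simp only: j_def p_def div_mult_mod_eq)
  have p: "p < S" using S0 by (simp add: p_def)
  have pos: "(i' * M + c') * Q + v' < W" if "i' < N" "c' < M" "v' < Q" for i' c' v'
    unfolding W_def by (rule encode_less) (use that in auto)
  have pos0: "(i' * M + c') * Q < W" if "i' < N" "c' < M" for i' c'
    using pos[OF that, of 0] Q0 by simp
  have win: "(i + e * k ^ stage_s l j - k\<^sup>2 * k ^ stage_s l j) < N"
    if "j < l * l" "\<not> i mod k ^ (j div l + 1) div k ^ stage_s l j + e < k\<^sup>2"
      "\<not> k ^ (j div l + 1 - stage_s l j) \<le> i mod k ^ (j div l + 1) div k ^ stage_s l j + e - k\<^sup>2" for e
    unfolding N_def using that i
    by (intro phase_window_position[OF k0]) (auto simp: N_def stage_s_def less_mult_imp_div_less)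
  show ?thesis
    unfolding w_eq L_eq src_at[OF p vc] Let_def
    using pos0[OF i vc(2)] pos[OF i vc(2) affine_hash_less] pos0[OF i line_point_less] pos0[OF win vc(2)] pos[OF i vc(2), of "(3 * v + r) mod Q"] Q0
    by (auto simp del: power_Suc)
qed

end

locale majority_input = majority_parameters +
  fixes X :: "nat \<Rightarrow> bool" and V :: "nat \<Rightarrow> bool"
  assumes V: "\<And>i c v. c < M \<Longrightarrow> v < Q \<Longrightarrow> V ((i * M + c) * Q + v) = X i"
begin

abbreviation "val \<equiv> layer_val src V"

lemma val_step:
  assumes "p < S" "v < Q" "c < M"
  shows "val (Suc (j * S + p)) ((i * M + c) * Q + v) =
    maj3 (read_source (val (j * S + p)) (src (j * S + p) ((i * M + c) * Q + v) 0))
     (read_source (val (j * S + p)) (src (j * S + p) ((i * M + c) * Q + v) 1))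
     (read_source (val (j * S + p)) (src (j * S + p) ((i * M + c) * Q + v) 2))"
  by simp

lemma stage_val:
  assumes IH: "\<And>i c. i < N \<Longrightarrow> c < M \<Longrightarrow> val (j * S) ((i * M + c) * Q) = copies X j i c"
    and i: "i < N" and c: "c < M"
  shows "val (Suc j * S) ((i * M + c) * Q) = copies X (Suc j) i c"
proof -
  define Y where "Y = (\<lambda>c v. stage_window j (\<lambda>i. copies X j i c) i (v mod K))"
  \<comment> \<open>The three sources of a gate coincide in this layer, so the majority is a copy;
    the same holds in the layer that reads a line.\<close>
  have first: "val (Suc (j * S + 0)) ((i * M + c) * Q + v) = Y c v" if "c < M" "v < Q" for c v
  proof -
    have p: "0 < S" by (simp add: S_def)
    have "read_source (val (j * S + 0)) (src (j * S + 0) ((i * M + c) * Q + v) r) = Y c v" for r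
    proof (cases "j < l * l")
      case False
      then show ?thesis
        unfolding src_at[OF p that(2,1)] using IH[OF i that(1)]
        by (simp add: read_source_simps Y_def stage_window_def del: add_2_eq_Suc)
    next
      case True
      define t s e q where "t = j div l" and "s = stage_s l j" and "e = v mod K" and "q = i mod k ^ (t + 1) div k ^ s"
      have ts: "s \<le> t" "t < l" using True by (auto simp: s_def t_def stage_s_def less_mult_imp_div_less)
      have pos: "i + e * k ^ s - k\<^sup>2 * k ^ s < N" if "\<not> q + e < k\<^sup>2" "\<not> k ^ (t + 1 - s) \<le> q + e - k\<^sup>2"
        unfolding N_def using that i by (intro phase_window_position[OF k0 ts]) (auto simp: N_def q_def)
      have "src (j * S + 0) ((i * M + c) * Q + v) r = (if q + e < k\<^sup>2 then 1 else if k ^ (t + 1 - s) \<le> q + e - k\<^sup>2 then 0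
           else 2 + ((i + e * k ^ s - k\<^sup>2 * k ^ s) * M + c) * Q)"
        unfolding src_at[OF p that(2,1)] using True by (simp add: Let_def t_def s_def e_def q_def)
      moreover have "Y c v = (if q + e < k\<^sup>2 then True else if k ^ (t + 1 - s) \<le> q + e - k\<^sup>2 then False
           else copies X j (i + e * k ^ s - k\<^sup>2 * k ^ s) c)"
        using True by (simp add: Y_def stage_window_def phase_window_def Let_def t_def s_def e_def q_def)
      ultimately show ?thesis
        using IH[OF pos that(1)] by (simp add: read_source_def split: if_splits)
    qed
    then show ?thesis unfolding val_step[OF p that(2,1)] by (simp only: maj3_same)
  qed
  have hash: "b \<le> h \<Longrightarrow> v < Q \<Longrightarrow> val (j * S + Suc b) ((i * M + c) * Q + v) = hash_layers Q (Y c) c b v" if "c < M" for b c v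
  proof (induction b arbitrary: v)
    case 0
    then show ?case using first[OF that] by simp
  next
    case (Suc b)
    have p: "Suc b < S" using Suc.prems by (simp add: S_def)
    define z where "z = c div Q ^ (6 * b)"
    have rd: "read_source (val (j * S + Suc b)) (src (j * S + Suc b) ((i * M + c) * Q + v) r)
      = hash_layers Q (Y c) c b (affine_hash Q (z div (Q\<^sup>2) ^ r mod Q\<^sup>2) v)" for r
      unfolding src_at[OF p Suc.prems(2) that] using Suc affine_hash_less by (simp add: read_source_simps z_def del: add_2_eq_Suc)
    have "val (j * S + Suc (Suc b)) ((i * M + c) * Q + v) = maj3
      (hash_layers Q (Y c) c b (affine_hash Q (z div (Q\<^sup>2) ^ 0 mod Q\<^sup>2) v))
      (hash_layers Q (Y c) c b (affine_hash Q (z div (Q\<^sup>2) ^ 1 mod Q\<^sup>2) v))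
      (hash_layers Q (Y c) c b (affine_hash Q (z div (Q\<^sup>2) ^ 2 mod Q\<^sup>2) v))"
      using val_step[OF p Suc.prems(2) that, of j i] unfolding rd by simp
    moreover have "z div (Q\<^sup>2) ^ 2 = z div Q\<^sup>2 div Q\<^sup>2" by (simp only: power2_eq_square[of "Q\<^sup>2"] div_mult2_eq)
    ultimately show ?case by (simp add: hash_maj_def z_def)
  qed
  define f where "f = (\<lambda>x. hash_layers Q (Y (line_point c x)) (line_point c x) h 0)"
  have line: "val (j * S + (h + 2)) ((i * M + c) * Q + v) = f v" if "v < Q" for v
  proof -
    have p: "h + 1 < S" by (simp add: S_def)
    have "read_source (val (j * S + (h + 1))) (src (j * S + (h + 1)) ((i * M + c) * Q + v) r) = f v" for r
      unfolding src_at[OF p that c] using hash[OF line_point_less order.refl Q0, of c v]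
      by (simp add: read_source_simps f_def del: add_2_eq_Suc)
    then show ?thesis using val_step[OF p that c, of j i] by (simp add: maj3_same)
  qed
  have tree: "a \<le> hp \<Longrightarrow> v < 3 ^ (hp - a) \<Longrightarrow> val (j * S + (h + 2 + a)) ((i * M + c) * Q + v) = maj_tree a f v" for a v
  proof (induction a arbitrary: v)
    case 0
    then show ?case using line[of v] hp(1) by simp
  next
    case (Suc a)
    have p: "h + 2 + a < S" using Suc.prems by (simp add: S_def)
    have e: "3 ^ (hp - a) = (3::nat) * 3 ^ (hp - Suc a)"
      using Suc.prems by (simp add: Suc_diff_Suc flip: power_Suc)
    \<comment> \<open>On the wires of the tree the sources stay below \<open>3 ^ hp\<close>, hence
      below \<open>Q\<close>, so the reduction modulo \<open>Q\<close> in \<open>maj_src\<close>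
      drops out.\<close>
    have v3: "3 * v + r < 3 ^ (hp - a)" if "r < 3" for r using Suc.prems that unfolding e by linarith
    have le: "3 ^ (hp - b) \<le> Q" for b
    proof -
      have "(3::nat) ^ (hp - b) \<le> 3 ^ hp" by (intro power_increasing) auto
      then show ?thesis using hp(1) by linarith
    qed
    have vQ: "v < Q" using Suc.prems(2) le[of "Suc a"] by linarith
    have rd: "read_source (val (j * S + (h + 2 + a))) (src (j * S + (h + 2 + a)) ((i * M + c) * Q + v) r) = maj_tree a f (3 * v + r)"
      if "r < 3" for r
    proof -
      have "3 * v + r < Q" using v3[OF that] le[of a] by linarith
      then have "src (j * S + (h + 2 + a)) ((i * M + c) * Q + v) r = 2 + ((i * M + c) * Q + (3 * v + r))"
        unfolding src_at[OF p vQ c] by simp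
      then show ?thesis using Suc.IH[OF _ v3[OF that]] Suc.prems by (simp only: read_source_simps)
    qed
    show ?case using val_step[OF p vQ c, of j i] rd[of 0] rd[of 1] rd[of 2] by simp
  qed
  have e: "j * S + (h + 2 + hp) = Suc j * S" by (simp add: S_def)
  have "val (j * S + (h + 2 + hp)) ((i * M + c) * Q + 0) = maj_tree hp f 0"
    by (rule tree) auto
  then have "val (Suc j * S) ((i * M + c) * Q) = maj_tree hp f 0" unfolding e add_0_right .
  then show ?thesis by (simp only: copies.simps f_def Y_def)
qed

lemma val_copies: "i < N \<Longrightarrow> c < M \<Longrightarrow> val (j * S) ((i * M + c) * Q) = copies X j i c"
proof (induction j arbitrary: i c)
  case 0
  then show ?case using V[of c 0 i] Q0 by simp
next
  case (Suc j)
  show ?case by (rule stage_val[OF Suc.IH Suc.prems])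
qed

end

context majority_parameters
begin

definition inp :: "nat \<Rightarrow> nat" where "inp w = w div Q div M"

definition "D = num_stages * S"

lemma layered_majority: "layered W D src"
proof
  show "W > 0" using Q0 k0 by (simp add: W_def N_def)
  show "D > 0" using l by (simp add: D_def S_def num_stages_def)
qed (rule src_less)

text \<open>The network moves ones to the front and the padding is zero, so position
  \<open>n div 2\<close> carries the majority. By then all copies agree; copy 0 is taken.\<close>

definition majority_circuit :: "nat \<Rightarrow> circuit" where
  "majority_circuit n = layered.layered_circuit W D src inp n (n div 2 * M * Q)"

lemma out_less: "n < N \<Longrightarrow> n div 2 * M * Q < W"
  using encode_less[of 0 Q 0 M "n div 2" N] Q0 by (simp add: W_def)

lemma majority_circuit_correct:
  assumes n: "n < N"
  shows "computes n (majority_circuit n) MAJ"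
proof -
  interpret layered W D src inp n by (rule layered_majority)
  have "circuit_val (majority_circuit n) xs = MAJ xs" if len: "length xs = n" for xs
  proof -
    define X where "X = (\<lambda>i. i < n \<and> xs ! i)"
    interpret majority_input l Q hp X "\<lambda>w. inp w < n \<and> xs ! inp w"
      by unfold_locales (simp add: inp_def X_def decode)
    have "circuit_val (majority_circuit n) xs = layer_val src (\<lambda>w. inp w < n \<and> xs ! inp w) (num_stages * S) ((n div 2 * M + 0) * Q)"
      unfolding majority_circuit_def circuit_val_layered[OF out_less[OF n]] by (simp add: D_def)
    also have "\<dots> = copies X num_stages (n div 2) 0"
      by (rule val_copies) (use n Q0 in auto)
    also have "\<dots> = (n div 2 < card {p \<in> {..<k ^ l}. X p})"
      by (rule copies_correct) (use n Q0 in \<open>auto simp: N_def\<close>)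
    also have "{p \<in> {..<k ^ l}. X p} = {p. p < length xs \<and> xs ! p = True}"
      using n len by (auto simp: X_def N_def)
    also have "card \<dots> = count_list xs True"
      by (simp add: count_list_eq_length_filter length_filter_conv_card eq_commute)
    also have "(n div 2 < count_list xs True) = MAJ xs"
      using len by (auto simp: MAJ_def)
    finally show ?thesis .
  qed
  moreover have "wf_circuit n (majority_circuit n)"
    unfolding majority_circuit_def by (rule wf_layered[OF out_less[OF n]])
  ultimately show ?thesis by (simp add: computes_def)
qed

lemma majority_circuit_size: "circuit_size (majority_circuit n) = 4 * (D * W)"
proof -
  interpret layered W D src inp n by (rule layered_majority)
  show ?thesis unfolding majority_circuit_def circuit_size_def by (rule length_gates)
qed

lemma hp_le: "hp \<le> 20 * l"
proof -
  have "(3::nat) ^ hp \<le> 3 ^ (20 * l)" using hp(1) Q_le by linarith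
  then show ?thesis by (subst (asm) power_increasing_iff) auto
qed

lemma D_le: "D \<le> 10001 * 62 * l ^ 3"
proof -
  have "S \<le> 62 * l" using hp_le l by (simp add: S_def h_def)
  then have "D \<le> 10001 * (l * l) * (62 * l)" unfolding D_def num_stages_def by (intro mult_left_mono) auto
  then show ?thesis by (simp add: power3_eq_cube mult.assoc)
qed

lemma majority_circuit_depth:
  assumes "n < N"
  shows "circuit_depth (majority_circuit n) \<le> 3 * (10001 * 62 * l ^ 3)"
proof -
  interpret layered W D src inp n by (rule layered_majority)
  have "circuit_depth (majority_circuit n) \<le> 3 * D"
    unfolding majority_circuit_def by (rule depth_layered[OF out_less[OF assms]])
  then show ?thesis using D_le by linarith
qed

end

section \<open>Choosing the parameters\<close>

definition log_root :: "nat \<Rightarrow> nat" where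
  "log_root n = (LEAST j. n < 2 ^ j\<^sup>2)"

definition maj_l :: "nat \<Rightarrow> nat" where
  "maj_l n = 10 + log_root n"

definition maj_Q :: "nat \<Rightarrow> nat" where
  "maj_Q n = (LEAST q. prime q \<and> 3 ^ (10 * maj_l n) \<le> q)"

definition maj_hp :: "nat \<Rightarrow> nat" where
  "maj_hp n = (LEAST h. maj_Q n < 3 ^ (h + 1))"

lemma less_two_power_square: "n < 2 ^ n\<^sup>2"
proof -
  have "n < 2 ^ n" by simp
  also have "(2::nat) ^ n \<le> 2 ^ n\<^sup>2" by (intro power_increasing) (auto simp: power2_eq_square)
  finally show ?thesis .
qed

lemma log_root: "n < 2 ^ (log_root n)\<^sup>2" "0 < log_root n \<Longrightarrow> 2 ^ (log_root n - 1)\<^sup>2 \<le> n"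
proof -
  show "n < 2 ^ (log_root n)\<^sup>2"
    unfolding log_root_def by (rule LeastI) (rule less_two_power_square)
  show "2 ^ (log_root n - 1)\<^sup>2 \<le> n" if "0 < log_root n"
    using not_less_Least[of "log_root n - 1" "\<lambda>j. n < 2 ^ j\<^sup>2"] that unfolding log_root_def by simp
qed

lemma maj_Q_exists: "\<exists>q::nat. prime q \<and> 3 ^ (10 * maj_l n) \<le> q \<and> q \<le> 3 ^ (20 * maj_l n)"
proof -
  have "(16::nat) \<le> 3 ^ 10" by simp
  also have "\<dots> \<le> 3 ^ (10 * maj_l n)" by (intro power_increasing) (auto simp: maj_l_def)
  finally obtain q :: nat where "prime q" "3 ^ (10 * maj_l n) < q" "q \<le> (3 ^ (10 * maj_l n))\<^sup>2"
    using exists_prime_le_square[of "3 ^ (10 * maj_l n)"] by blast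
  then show ?thesis by (intro exI[of _ q]) (simp flip: power_mult)
qed

lemma maj_Q: "prime (maj_Q n)" "3 ^ (10 * maj_l n) \<le> maj_Q n" "maj_Q n \<le> 3 ^ (20 * maj_l n)"
proof -
  obtain q :: nat where q: "prime q" "3 ^ (10 * maj_l n) \<le> q" "q \<le> 3 ^ (20 * maj_l n)"
    using maj_Q_exists by blast
  have *: "prime (maj_Q n) \<and> 3 ^ (10 * maj_l n) \<le> maj_Q n"
    unfolding maj_Q_def by (rule LeastI[of _ q]) (use q in simp)
  then show "prime (maj_Q n)" "3 ^ (10 * maj_l n) \<le> maj_Q n" by simp_all
  have "maj_Q n \<le> q" unfolding maj_Q_def by (rule Least_le) (use q in simp)
  then show "maj_Q n \<le> 3 ^ (20 * maj_l n)" using q by linarith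
qed

lemma less_three_power: "q < 3 ^ (q + 1)"
  by (induction q) auto

lemma maj_hp: "3 ^ maj_hp n \<le> maj_Q n" "maj_Q n < 3 ^ (maj_hp n + 1)"
proof -
  show "maj_Q n < 3 ^ (maj_hp n + 1)"
    unfolding maj_hp_def by (rule LeastI) (rule less_three_power)
  show "3 ^ maj_hp n \<le> maj_Q n"
  proof (cases "maj_hp n")
    case 0
    then show ?thesis using prime_gt_0_nat[OF maj_Q(1)[of n]] by simp
  next
    case (Suc h)
    then have "\<not> maj_Q n < 3 ^ (h + 1)"
      unfolding maj_hp_def by (intro not_less_Least) simp
    then show ?thesis by (simp add: Suc)
  qed
qed

lemma parameters: "majority_parameters (maj_l n) (maj_Q n) (maj_hp n)"
proof
  show "10 \<le> maj_l n" by (simp add: maj_l_def)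
qed (rule maj_Q maj_hp)+

text \<open>The source of all polynomial bounds. The inequality
  \<open>(11 + d)\<^sup>2 \<le> 242 + 2 * d\<^sup>2\<close> splits off the additive constant of
  \<open>maj_l\<close>; then \<open>2 ^ d\<^sup>2 \<le> n + 2\<close> is used twice and
  \<open>2 \<le> n + 2\<close> absorbs the rest: 244 = 242 + 2.\<close>

lemma two_power_l_bound: "2 ^ (c * (maj_l n)\<^sup>2) \<le> (n + 2) ^ (244 * c)"
proof -
  obtain d where d: "maj_l n \<le> 11 + d" "2 ^ d\<^sup>2 \<le> n + 2"
  proof (cases "log_root n")
    case 0
    then show ?thesis using that[of 0] by (simp add: maj_l_def)
  next
    case (Suc d)
    then show ?thesis using that[of d] log_root(2)[of n] by (simp add: maj_l_def)
  qed
  have "(maj_l n)\<^sup>2 \<le> (11 + d)\<^sup>2" using d by (intro power_mono) auto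
  also have "\<dots> \<le> 242 + 2 * d\<^sup>2"
  proof -
    have "0 \<le> (int d - 11)\<^sup>2" by simp
    then have "int ((11 + d)\<^sup>2) \<le> int (242 + 2 * d\<^sup>2)" by (simp add: power2_eq_square algebra_simps)
    then show ?thesis by (simp only: of_nat_le_iff)
  qed
  finally have "(2::nat) ^ (c * (maj_l n)\<^sup>2) \<le> 2 ^ (c * (242 + 2 * d\<^sup>2))" by (intro power_increasing mult_left_mono) auto
  also have "c * (242 + 2 * d\<^sup>2) = 242 * c + d\<^sup>2 * (2 * c)" by (simp add: algebra_simps)
  also have "(2::nat) ^ (242 * c + d\<^sup>2 * (2 * c)) = 2 ^ (242 * c) * (2 ^ d\<^sup>2) ^ (2 * c)"
    by (simp only: power_add power_mult)
  also have "\<dots> \<le> (n + 2) ^ (242 * c) * (n + 2) ^ (2 * c)"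
    using d by (intro mult_mono power_mono) auto
  also have "\<dots> = (n + 2) ^ (244 * c)" by (simp flip: power_add)
  finally show ?thesis .
qed

lemma pbound_two_power_l:
  assumes "\<And>n. f n \<le> 2 ^ (c * (maj_l n)\<^sup>2)" "i < a"
  shows "pbound a (\<lambda>xs. f (xs ! i))"
proof (rule pbound_mono)
  show "pbound a (\<lambda>xs. (xs ! i + 2) ^ (244 * c))"
    using assms by (intro pbound_power pbound_add pbound_nth pbound_const)
  show "f (xs ! i) \<le> (xs ! i + 2) ^ (244 * c)" for xs
    using assms(1) two_power_l_bound order_trans by blast
qed

lemma power_bound_two:
  fixes b :: nat
  assumes "b \<le> 2 ^ (e * maj_l n)"
  shows "b ^ (d * maj_l n) \<le> 2 ^ ((e * d) * (maj_l n)\<^sup>2)"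
proof -
  have "b ^ (d * maj_l n) \<le> (2 ^ (e * maj_l n)) ^ (d * maj_l n)" using assms by (intro power_mono) auto
  also have "\<dots> = 2 ^ ((e * d) * (maj_l n)\<^sup>2)" by (simp add: power2_eq_square algebra_simps flip: power_mult)
  finally show ?thesis .
qed

lemma three_power_le: "3 ^ e \<le> (2::nat) ^ (2 * e)"
  unfolding power_mult by (rule power_mono) auto

lemma maj_Q_le: "maj_Q n \<le> 2 ^ (40 * maj_l n)"
  using maj_Q(3)[of n] three_power_le[of "20 * maj_l n"] by (simp add: mult.assoc[symmetric])

section \<open>The algorithm\<close>

lemma ptime_at:
  assumes "ptime 1 (\<lambda>xs. f (xs ! 0))" "ptime a g"
  shows "ptime a (\<lambda>xs. f (g xs))"
  using ptime_comp1[OF assms] by simp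

lemma ptime_maj_l: "ptime 1 (\<lambda>xs. maj_l (xs ! 0))"
proof -
  \<comment> \<open>The cap at \<open>xs ! 0 + 1\<close> leaves the comparison with
    \<open>xs ! 0\<close> unchanged and keeps the power polynomial.\<close>
  have "ptime 1 (\<lambda>xs. LEAST j. xs ! 0 < min (2 ^ j\<^sup>2) (xs ! 0 + 1))"
  proof (rule ptime_Least)
    show "pdec (Suc 1) (\<lambda>ys. tl ys ! 0 < min (2 ^ (ys ! 0)\<^sup>2) (tl ys ! 0 + 1))"
      by (intro pdec_less ptime_min_power ptime_add ptime_power_const ptime_const ptime_nth ptime_nth_tl) auto
    show "ptime 1 (\<lambda>xs. xs ! 0)" by (rule ptime_nth) simp
    show "\<exists>i\<le>xs ! 0. xs ! 0 < min (2 ^ i\<^sup>2) (xs ! 0 + 1)" for xs :: "nat list"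
      by (intro exI[of _ "xs ! 0"]) (simp add: less_two_power_square)
  qed
  then have "ptime 1 (\<lambda>xs. 10 + (LEAST j. xs ! 0 < min (2 ^ j\<^sup>2) (xs ! 0 + 1)))"
    by (intro ptime_add ptime_const)
  then show ?thesis by (simp add: maj_l_def log_root_def)
qed

lemma ptime_l_power:
  assumes "b \<le> 2 ^ e"
  shows "ptime 1 (\<lambda>xs. b ^ (d * maj_l (xs ! 0)))"
proof (intro ptime_power ptime_const ptime_mult ptime_maj_l)
  have "b ^ (d * maj_l n) \<le> 2 ^ ((e * d) * (maj_l n)\<^sup>2)" for n
  proof (rule power_bound_two)
    have "b \<le> 2 ^ (e * 1)" using assms by simp
    also have "\<dots> \<le> 2 ^ (e * maj_l n)" by (intro power_increasing mult_left_mono) (auto simp: maj_l_def)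
    finally show "b \<le> 2 ^ (e * maj_l n)" .
  qed
  then show "pbound 1 (\<lambda>xs. b ^ (d * maj_l (xs ! 0)))" by (rule pbound_two_power_l) simp
qed

lemma ptime_maj_Q: "ptime 1 (\<lambda>xs. maj_Q (xs ! 0))"
proof -
  have X: "ptime 1 (\<lambda>xs. 3 ^ (10 * maj_l (xs ! 0)))" "ptime 1 (\<lambda>xs. 3 ^ (20 * maj_l (xs ! 0)))"
    by (rule ptime_l_power[of _ 2], simp)+
  have "ptime 1 (\<lambda>xs. LEAST q. prime q \<and> 3 ^ (10 * maj_l (xs ! 0)) \<le> q)"
  proof (rule ptime_Least)
    show "pdec (Suc 1) (\<lambda>ys. prime (ys ! 0) \<and> 3 ^ (10 * maj_l (tl ys ! 0)) \<le> ys ! 0)"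
      by (intro pdec_conj pdec_le ptime_at[OF pdec_prime] ptime_at[OF X(1)] ptime_nth ptime_nth_tl) auto
    show "\<exists>i\<le>(3::nat) ^ (20 * maj_l (xs ! 0)). prime i \<and> 3 ^ (10 * maj_l (xs ! 0)) \<le> i" for xs :: "nat list"
      using maj_Q_exists by blast
  qed (rule X(2))
  then show ?thesis by (simp add: maj_Q_def)
qed

lemma ptime_maj_hp: "ptime 1 (\<lambda>xs. maj_hp (xs ! 0))"
proof -
  have "ptime 1 (\<lambda>xs. LEAST h. maj_Q (xs ! 0) < min (3 ^ (h + 1)) (maj_Q (xs ! 0) + 1))"
  proof (rule ptime_Least)
    show "pdec (Suc 1) (\<lambda>ys. maj_Q (tl ys ! 0) < min (3 ^ (ys ! 0 + 1)) (maj_Q (tl ys ! 0) + 1))"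
      by (intro pdec_less ptime_min_power ptime_add ptime_const ptime_at[OF ptime_maj_Q] ptime_nth ptime_nth_tl) auto
    show "\<exists>i\<le>maj_Q (xs ! 0). maj_Q (xs ! 0) < min (3 ^ (i + 1)) (maj_Q (xs ! 0) + 1)" for xs :: "nat list"
      using less_three_power by (intro exI[of _ "maj_Q (xs ! 0)"]) auto
  qed (rule ptime_maj_Q)
  then show ?thesis by (simp add: maj_hp_def)
qed

lemma ptime_maj_k: "ptime 1 (\<lambda>xs. 2 ^ maj_l (xs ! 0))"
  using ptime_l_power[of 2 1 1] by simp

lemma ptime_maj_N: "ptime 1 (\<lambda>xs. (2 ^ maj_l (xs ! 0)) ^ maj_l (xs ! 0))"
proof (intro ptime_power[of _ "\<lambda>xs. 2 ^ maj_l (xs ! 0)"] ptime_maj_k ptime_maj_l)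
  have "(2 ^ maj_l n) ^ (1 * maj_l n) \<le> (2::nat) ^ ((1 * 1) * (maj_l n)\<^sup>2)" for n
    by (rule power_bound_two) simp
  then show "pbound 1 (\<lambda>xs. (2 ^ maj_l (xs ! 0)) ^ maj_l (xs ! 0))"
    by (intro pbound_two_power_l[of _ 1]) simp_all
qed

lemma ptime_maj_M: "ptime 1 (\<lambda>xs. maj_Q (xs ! 0) ^ (240 * maj_l (xs ! 0)))"
  by (intro ptime_power ptime_mult ptime_const ptime_maj_Q ptime_maj_l
      pbound_two_power_l[of "\<lambda>n. maj_Q n ^ (240 * maj_l n)" "40 * 240"] power_bound_two maj_Q_le) simp

lemmas ptime_arith = ptime_add ptime_sub ptime_mult ptime_div ptime_mod ptime_min ptime_if
  pdec_less pdec_le pdec_eq ptime_const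

text \<open>For arbitrary \<open>L\<close> and \<open>w\<close> the powers in \<open>maj_src\<close>
  need not be polynomial, so they are capped by the polynomial quantities \<open>N\<close> and
  \<open>M\<close>. In each branch that is taken the exponents are small enough for the caps to be
  inactive (\<open>pw\<close>).\<close>

lemma ptime_src:
  "ptime 3 (\<lambda>xs. maj_src (maj_l (xs ! 0)) (maj_Q (xs ! 0)) (maj_hp (xs ! 0)) (xs ! 1) (xs ! 2) r)"
proof -
  define l where "l = (\<lambda>xs :: nat list. maj_l (xs ! 0))"
  define Q where "Q = (\<lambda>xs :: nat list. maj_Q (xs ! 0))"
  define hp where "hp = (\<lambda>xs :: nat list. maj_hp (xs ! 0))"
  define k where "k = (\<lambda>xs. 2 ^ l xs :: nat)"
  define N where "N = (\<lambda>xs. k xs ^ l xs)"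
  define M where "M = (\<lambda>xs. Q xs ^ (240 * l xs))"
  define S where "S = (\<lambda>xs. 40 * l xs + 2 + hp xs)"
  define j where "j = (\<lambda>xs. xs ! 1 div S xs)"
  define p where "p = (\<lambda>xs. xs ! 1 mod S xs)"
  define v where "v = (\<lambda>xs. xs ! 2 mod Q xs)"
  define c where "c = (\<lambda>xs. xs ! 2 div Q xs mod M xs)"
  define i where "i = (\<lambda>xs. xs ! 2 div Q xs div M xs)"
  define t where "t = (\<lambda>xs. j xs div l xs)"
  define s where "s = (\<lambda>xs. min (j xs div l xs) (l xs - 1 - j xs mod l xs))"
  define ks where "ks = (\<lambda>xs. min (k xs ^ s xs) (N xs))"
  define kt where "kt = (\<lambda>xs. min (k xs ^ (t xs + 1)) (N xs))"
  define kd where "kd = (\<lambda>xs. min (k xs ^ (t xs + 1 - s xs)) (N xs))"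
  define q where "q = (\<lambda>xs. i xs mod kt xs div ks xs)"
  define e where "e = (\<lambda>xs. v xs mod (2 * (k xs)\<^sup>2 + 1))"
  define win where "win = (\<lambda>xs. if q xs + e xs < (k xs)\<^sup>2 then 1 else if kd xs \<le> q xs + e xs - (k xs)\<^sup>2 then 0
     else 2 + ((i xs + e xs * ks xs - (k xs)\<^sup>2 * ks xs) * M xs + c xs) * Q xs)"
  define w where "w = (\<lambda>xs. c xs div min (Q xs ^ (6 * (p xs - 1))) (M xs) div ((Q xs)\<^sup>2) ^ r mod (Q xs)\<^sup>2)"
  define hash where "hash = (\<lambda>xs. 2 + ((i xs * M xs + c xs) * Q xs + (w xs mod Q xs * v xs + w xs div Q xs) mod Q xs))"
  define pt where "pt = (\<lambda>xs. \<Sum>a<240 * l xs. min (Q xs ^ a) (M xs) *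
     ((c xs div Q xs * Q xs div min (Q xs ^ a) (M xs) mod Q xs + v xs * min ((c xs mod Q xs) ^ a) (M xs)) mod Q xs))"
  define f where "f = (\<lambda>xs. if p xs = 0 then if j xs < l xs * l xs then win xs else 2 + (i xs * M xs + c xs) * Q xs
     else if p xs \<le> 40 * l xs then hash xs
     else if p xs = 40 * l xs + 1 then 2 + (i xs * M xs + pt xs) * Q xs
     else 2 + ((i xs * M xs + c xs) * Q xs + (3 * v xs + r) mod Q xs))"
  have n: "ptime 3 (\<lambda>xs. xs ! 0)" "ptime 3 (\<lambda>xs. xs ! 1)" "ptime 3 (\<lambda>xs. xs ! 2)" by (rule ptime_nth; simp)+
  have P1: "ptime 3 l" "ptime 3 Q" "ptime 3 hp" "ptime 3 k" "ptime 3 N" "ptime 3 M"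
    unfolding l_def Q_def hp_def k_def N_def M_def
    by (rule ptime_at[OF ptime_maj_l n(1)] ptime_at[OF ptime_maj_Q n(1)] ptime_at[OF ptime_maj_hp n(1)]
        ptime_at[OF ptime_maj_k n(1)] ptime_at[OF ptime_maj_N n(1)] ptime_at[OF ptime_maj_M n(1)])+
  have P2: "ptime 3 S" unfolding S_def by (intro ptime_arith P1)
  have P3: "ptime 3 j" "ptime 3 p" unfolding j_def p_def by (intro ptime_arith P1 P2 n)+
  have P4: "ptime 3 v" "ptime 3 c" "ptime 3 i" unfolding v_def c_def i_def by (intro ptime_arith P1 n)+
  have P5: "ptime 3 t" "ptime 3 s" unfolding t_def s_def by (intro ptime_arith P1 P3)+
  have P6: "ptime 3 ks" "ptime 3 kt" "ptime 3 kd" unfolding ks_def kt_def kd_def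
    by (intro ptime_min_power ptime_add ptime_sub ptime_const P1 P5)+
  have P7: "ptime 3 q" "ptime 3 e" unfolding q_def e_def by (intro ptime_arith ptime_power_const P1 P4 P6)+
  have P8: "ptime 3 win" unfolding win_def by (intro ptime_arith ptime_power_const P1 P4 P6 P7)
  have P9: "ptime 3 w" unfolding w_def
    by (intro ptime_min_power ptime_div ptime_mod ptime_mult ptime_sub ptime_power_const ptime_const P1 P3 P4)
  have P10: "ptime 3 hash" unfolding hash_def by (intro ptime_arith P1 P4 P9)
  have P11: "ptime 3 pt" unfolding pt_def
    by (intro ptime_sum ptime_min_power ptime_div ptime_mod ptime_mult ptime_add ptime_const ptime_nth
        ptime_tl[OF P1(1)] ptime_tl[OF P1(2)] ptime_tl[OF P1(6)] ptime_tl[OF P4(1)] ptime_tl[OF P4(2)] P1) auto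
  have "ptime 3 f" unfolding f_def by (intro ptime_arith P1 P3 P4 P8 P10 P11)
  then show ?thesis
  proof (rule ptime_cong)
    fix xs :: "nat list"
    interpret mp: majority_parameters "l xs" "Q xs" "hp xs"
      unfolding l_def Q_def hp_def by (rule parameters)
    have Q1: "1 \<le> Q xs" and k1: "1 \<le> k xs" using mp.Q0 by (auto simp: k_def)
    have pw: "min (b ^ a) (b ^ a') = b ^ a" if "1 \<le> b" "a \<le> a'" for a a' b :: nat
      using that by (simp add: min_absorb1 power_increasing)
    have win: "win xs = (let t = j xs div l xs; s = stage_s (l xs) (j xs); q = i xs mod k xs ^ (t + 1) div k xs ^ s; e = v xs mod (2 * (k xs)\<^sup>2 + 1) in
           if q + e < (k xs)\<^sup>2 then 1 else if k xs ^ (t + 1 - s) \<le> q + e - (k xs)\<^sup>2 then 0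
           else 2 + ((i xs + e * k xs ^ s - (k xs)\<^sup>2 * k xs ^ s) * M xs + c xs) * Q xs)" if "j xs < l xs * l xs"
    proof -
      have t: "t xs + 1 \<le> l xs" using that by (simp add: t_def less_mult_imp_div_less Suc_le_eq)
      then have "s xs \<le> l xs" by (simp add: s_def t_def)
      then have "ks xs = k xs ^ s xs" "kt xs = k xs ^ (t xs + 1)" "kd xs = k xs ^ (t xs + 1 - s xs)"
        unfolding ks_def kt_def kd_def N_def using t k1 by (intro pw; simp)+
      note pws = this
      have t_eq: "j xs div l xs = t xs" and s_eq: "stage_s (l xs) (j xs) = s xs" by (simp_all add: s_def t_def stage_s_def)
      show ?thesis unfolding win_def Let_def q_def e_def pws t_eq s_eq by (rule refl)
    qed
    have hash: "hash xs = 2 + ((i xs * M xs + c xs) * Q xs +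
        affine_hash (Q xs) (c xs div Q xs ^ (6 * (p xs - 1)) div ((Q xs)\<^sup>2) ^ r mod (Q xs)\<^sup>2) (v xs))" if "p xs \<le> 40 * l xs"
    proof -
      have "min (Q xs ^ (6 * (p xs - 1))) (M xs) = Q xs ^ (6 * (p xs - 1))"
        unfolding M_def by (rule pw) (use Q1 that in auto)
      then show ?thesis by (simp add: hash_def w_def affine_hash_def)
    qed
    have pt: "pt xs = mp.line_point (c xs) (v xs)"
    proof -
      have "min (Q xs ^ a) (M xs) * ((c xs div Q xs * Q xs div min (Q xs ^ a) (M xs) mod Q xs + v xs * min ((c xs mod Q xs) ^ a) (M xs)) mod Q xs)
         = Q xs ^ a * ((digit (Q xs) (c xs div Q xs * Q xs) a + v xs * (c xs mod Q xs) ^ a) mod Q xs)" if "a < 240 * l xs" for a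
      proof -
        have "min (Q xs ^ a) (M xs) = Q xs ^ a"
          unfolding M_def by (rule pw) (use Q1 that in auto)
        moreover have "min ((c xs mod Q xs) ^ a) (M xs) = (c xs mod Q xs) ^ a"
        proof -
          have "(c xs mod Q xs) ^ a \<le> Q xs ^ a" using mp.Q0 by (intro power_mono) auto
          also have "\<dots> \<le> M xs" unfolding M_def using that Q1 by (intro power_increasing) auto
          finally show ?thesis by simp
        qed
        ultimately show ?thesis by (simp add: digit_def)
      qed
      then show ?thesis
        unfolding pt_def mp.line_point_def shift_def of_digits_def mp.along_def
        unfolding mp.m_eq[symmetric] by (intro sum.cong) auto
    qed
    have src: "maj_src (l xs) (Q xs) (hp xs) (xs ! 1) (xs ! 2) r =
      (if p xs = 0 then if j xs < l xs * l xs then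
          (let t = j xs div l xs; s = stage_s (l xs) (j xs); q = i xs mod k xs ^ (t + 1) div k xs ^ s; e = v xs mod (2 * (k xs)\<^sup>2 + 1) in
           if q + e < (k xs)\<^sup>2 then 1 else if k xs ^ (t + 1 - s) \<le> q + e - (k xs)\<^sup>2 then 0
           else 2 + ((i xs + e * k xs ^ s - (k xs)\<^sup>2 * k xs ^ s) * M xs + c xs) * Q xs)
        else 2 + (i xs * M xs + c xs) * Q xs
      else if p xs \<le> 40 * l xs then 2 + ((i xs * M xs + c xs) * Q xs +
        affine_hash (Q xs) (c xs div Q xs ^ (6 * (p xs - 1)) div ((Q xs)\<^sup>2) ^ r mod (Q xs)\<^sup>2) (v xs))
      else if p xs = 40 * l xs + 1 then 2 + (i xs * M xs + prime_vectors.line_point (Q xs) (240 * l xs) (c xs) (v xs)) * Q xs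
      else 2 + ((i xs * M xs + c xs) * Q xs + (3 * v xs + r) mod Q xs))"
      unfolding maj_src_def Let_def k_def M_def S_def j_def p_def v_def c_def i_def by (rule refl)
    have "f xs = maj_src (l xs) (Q xs) (hp xs) (xs ! 1) (xs ! 2) r"
      unfolding src f_def mp.m_eq by (intro if_cong refl win hash) (simp_all only: pt)
    then show "f xs = maj_src (maj_l (xs ! 0)) (maj_Q (xs ! 0)) (maj_hp (xs ! 0)) (xs ! 1) (xs ! 2) r"
      by (simp only: l_def Q_def hp_def)
  qed
qed

section \<open>The numbers of the printed circuit\<close>

lemma ptime_comp3:
  assumes "ptime 3 f" "ptime a g" "ptime a h" "ptime a k"
  shows "ptime a (\<lambda>xs. f [g xs, h xs, k xs])"
  using ptime_comp[of 3 f "[g, h, k]" a] assms by auto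

definition maj_S :: "nat \<Rightarrow> nat" where
  "maj_S n = 40 * maj_l n + 2 + maj_hp n"

definition maj_M :: "nat \<Rightarrow> nat" where
  "maj_M n = maj_Q n ^ (240 * maj_l n)"

definition maj_W :: "nat \<Rightarrow> nat" where
  "maj_W n = (2 ^ maj_l n) ^ maj_l n * maj_M n * maj_Q n"

definition maj_D :: "nat \<Rightarrow> nat" where
  "maj_D n = 10001 * (maj_l n * maj_l n) * maj_S n"

definition maj_circuit :: "nat \<Rightarrow> circuit" where
  "maj_circuit n = majority_parameters.majority_circuit (maj_l n) (maj_Q n) (maj_hp n) n"

lemma ptime_sizes:
  "ptime 1 (\<lambda>xs. maj_S (xs ! 0))" "ptime 1 (\<lambda>xs. maj_M (xs ! 0))"
  "ptime 1 (\<lambda>xs. maj_W (xs ! 0))" "ptime 1 (\<lambda>xs. maj_D (xs ! 0))"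
proof -
  show S: "ptime 1 (\<lambda>xs. maj_S (xs ! 0))" unfolding maj_S_def
    by (intro ptime_arith ptime_maj_l ptime_maj_hp)
  show M: "ptime 1 (\<lambda>xs. maj_M (xs ! 0))" unfolding maj_M_def by (rule ptime_maj_M)
  show "ptime 1 (\<lambda>xs. maj_W (xs ! 0))" unfolding maj_W_def
    by (intro ptime_mult ptime_maj_N M ptime_maj_Q)
  show "ptime 1 (\<lambda>xs. maj_D (xs ! 0))" unfolding maj_D_def
    by (intro ptime_mult ptime_const ptime_maj_l S)
qed

text \<open>The arguments are \<open>[n, G]\<close> with \<open>G\<close> the number of a block of
  four gates, which encodes layer and wire as quotient and remainder by the width.\<close>

definition wire_src :: "nat \<Rightarrow> nat list \<Rightarrow> nat" where
  "wire_src r xs = maj_src (maj_l (xs ! 0)) (maj_Q (xs ! 0)) (maj_hp (xs ! 0)) (xs ! 1 div maj_W (xs ! 0)) (xs ! 1 mod maj_W (xs ! 0)) r"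

definition wire_inp :: "nat \<Rightarrow> nat list \<Rightarrow> nat" where
  "wire_inp r xs = (wire_src r xs - 2) div maj_Q (xs ! 0) div maj_M (xs ! 0)"

definition wire_tag :: "nat \<Rightarrow> nat list \<Rightarrow> nat" where
  "wire_tag r xs = (if wire_src r xs < 2 then 0 else if xs ! 1 div maj_W (xs ! 0) = 0
     then (if wire_inp r xs < xs ! 0 then 1 else 0) else 2)"

definition wire_arg :: "nat \<Rightarrow> nat list \<Rightarrow> nat" where
  "wire_arg r xs = (if wire_src r xs < 2 then wire_src r xs else if xs ! 1 div maj_W (xs ! 0) = 0
     then (if wire_inp r xs < xs ! 0 then wire_inp r xs else 0)
     else 4 * ((xs ! 1 div maj_W (xs ! 0) - 1) * maj_W (xs ! 0) + (wire_src r xs - 2)) + 3)"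

lemma ptime_wires: "ptime 2 (wire_tag r)" "ptime 2 (wire_arg r)"
proof -
  have n: "ptime 2 (\<lambda>xs. xs ! 0)" "ptime 2 (\<lambda>xs. xs ! 1)" by (rule ptime_nth; simp)+
  note params = ptime_at[OF ptime_sizes(2) n(1)] ptime_at[OF ptime_sizes(3) n(1)] ptime_at[OF ptime_maj_Q n(1)]
  have src: "ptime 2 (wire_src r)"
    using ptime_comp3[OF ptime_src[of r] n(1) ptime_div[OF n(2) params(2)] ptime_mod[OF n(2) params(2)]]
    by (simp add: wire_src_def[abs_def])
  have inp: "ptime 2 (wire_inp r)"
    unfolding wire_inp_def[abs_def] by (intro ptime_arith src params)
  show "ptime 2 (wire_tag r)" unfolding wire_tag_def[abs_def] by (intro ptime_arith src inp params n)
  show "ptime 2 (wire_arg r)" unfolding wire_arg_def[abs_def] by (intro ptime_arith src inp params n)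
qed

definition gate_tokens :: "(nat list \<Rightarrow> nat) list" where
  "gate_tokens = [\<lambda>_. 0, wire_tag 0, wire_arg 0, wire_tag 1, wire_arg 1,
     \<lambda>_. 1, wire_tag 0, wire_arg 0, wire_tag 1, wire_arg 1,
     \<lambda>_. 0, \<lambda>_. 2, \<lambda>xs. 4 * xs ! 1 + 1, wire_tag 2, wire_arg 2,
     \<lambda>_. 1, \<lambda>_. 2, \<lambda>xs. 4 * xs ! 1, \<lambda>_. 2, \<lambda>xs. 4 * xs ! 1 + 2]"

definition output_tokens :: "(nat list \<Rightarrow> nat) list" where
  "output_tokens = [\<lambda>_. 2, \<lambda>xs. 4 * ((maj_D (xs ! 0) - 1) * maj_W (xs ! 0) + xs ! 0 div 2 * maj_M (xs ! 0) * maj_Q (xs ! 0)) + 3]"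

lemma ptime_gate_tokens: "f \<in> set gate_tokens \<Longrightarrow> ptime 2 f"
proof -
  have *: "ptime 2 (\<lambda>xs. 4 * xs ! 1 + 1)" "ptime 2 (\<lambda>xs. 4 * xs ! 1)" "ptime 2 (\<lambda>xs. 4 * xs ! 1 + 2)"
    by (intro ptime_add ptime_mult ptime_const ptime_nth; simp)+
  have "list_all (ptime 2) gate_tokens"
    unfolding gate_tokens_def list.pred_inject by (intro conjI * ptime_wires ptime_const list.pred_inject(1))
  then show "f \<in> set gate_tokens \<Longrightarrow> ptime 2 f" by (simp add: list_all_iff)
qed

lemma ptime_output_tokens: "f \<in> set output_tokens \<Longrightarrow> ptime 1 f"
proof -
  have "ptime 1 (\<lambda>xs. 4 * ((maj_D (xs ! 0) - 1) * maj_W (xs ! 0) + xs ! 0 div 2 * maj_M (xs ! 0) * maj_Q (xs ! 0)) + 3)"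
    by (intro ptime_add ptime_sub ptime_mult ptime_div ptime_const ptime_nth ptime_sizes ptime_maj_Q) simp
  then show "f \<in> set output_tokens \<Longrightarrow> ptime 1 f"
    unfolding output_tokens_def by (auto simp: ptime_const)
qed

lemma encode_maj_circuit:
  "encode_circuit (maj_circuit n) =
    concat (map (\<lambda>G. map (\<lambda>f. f [n, G]) gate_tokens) [0..<maj_D n * maj_W n]) @ map (\<lambda>f. f [n]) output_tokens"
proof -
  interpret mp: majority_parameters "maj_l n" "maj_Q n" "maj_hp n" by (rule parameters)
  interpret lay: layered mp.W mp.D "maj_src (maj_l n) (maj_Q n) (maj_hp n)" mp.inp n by (rule mp.layered_majority)
  have eqs: "mp.W = maj_W n" "mp.D = maj_D n" "maj_Q n ^ mp.m = maj_M n"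
    by (simp_all add: mp.W_def mp.N_def mp.k_def maj_W_def maj_M_def mp.m_def mp.D_def mp.num_stages_def mp.S_def mp.h_def maj_D_def maj_S_def)
  have tag: "lay.src_tag (G div mp.W) (maj_src (maj_l n) (maj_Q n) (maj_hp n) (G div mp.W) (G mod mp.W) r) = wire_tag r [n, G]"
    and arg: "lay.src_arg (G div mp.W) (maj_src (maj_l n) (maj_Q n) (maj_hp n) (G div mp.W) (G mod mp.W) r) = wire_arg r [n, G]" for G r
    unfolding lay.src_tag_def lay.src_arg_def
    unfolding wire_tag_def wire_arg_def wire_inp_def wire_src_def mp.inp_def eqs by simp_all
  show ?thesis
    unfolding maj_circuit_def mp.majority_circuit_def lay.encode_layered Let_def tag arg
    unfolding eqs by (simp add: gate_tokens_def output_tokens_def)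
qed

lemma maj_circuit_computes: "computes n (maj_circuit n) MAJ"
  and maj_circuit_size: "circuit_size (maj_circuit n) = 4 * (maj_D n * maj_W n)"
  and maj_circuit_depth: "circuit_depth (maj_circuit n) \<le> 3 * (10001 * 62 * maj_l n ^ 3)"
proof -
  interpret mp: majority_parameters "maj_l n" "maj_Q n" "maj_hp n" by (rule parameters)
  have eqs: "mp.W = maj_W n" "mp.D = maj_D n"
    by (simp_all add: mp.W_def mp.N_def mp.k_def maj_W_def maj_M_def mp.m_def mp.D_def mp.num_stages_def mp.S_def mp.h_def maj_D_def maj_S_def)
  have "n < 2 ^ (log_root n)\<^sup>2" by (rule log_root)
  also have "(2::nat) ^ (log_root n)\<^sup>2 \<le> 2 ^ (maj_l n)\<^sup>2" by (intro power_increasing power_mono) (auto simp: maj_l_def)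
  also have "\<dots> = mp.N" by (simp add: mp.N_def mp.k_def power2_eq_square power_mult)
  finally have n: "n < mp.N" .
  show "computes n (maj_circuit n) MAJ" unfolding maj_circuit_def by (rule mp.majority_circuit_correct[OF n])
  show "circuit_size (maj_circuit n) = 4 * (maj_D n * maj_W n)"
    unfolding maj_circuit_def mp.majority_circuit_size eqs by (rule refl)
  show "circuit_depth (maj_circuit n) \<le> 3 * (10001 * 62 * maj_l n ^ 3)"
    unfolding maj_circuit_def by (rule mp.majority_circuit_depth[OF n])
qed

section \<open>The depth as a function of \<open>n\<close>\<close>

lemma maj_l_le: "n \<ge> 2 \<Longrightarrow> maj_l n \<le> 12 * sqrt (log 2 n)"
proof -
  assume n: "n \<ge> 2"
  have L: "1 \<le> log 2 n" using n by simp
  then have L1: "1 \<le> sqrt (log 2 n)" by simp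
  show ?thesis
  proof (cases "log_root n")
    case 0
    then have "maj_l n = 10" by (simp add: maj_l_def)
    then show ?thesis using L1 by (simp only: of_nat_numeral)
  next
    case (Suc d)
    then have "2 ^ d\<^sup>2 \<le> n" using log_root(2)[of n] by simp
    then have "real (d\<^sup>2) \<le> log 2 n" by (intro le_log_of_power) (use n in \<open>auto simp flip: of_nat_power\<close>)
    then have "(real d)\<^sup>2 \<le> log 2 n" by simp
    then have "real d \<le> sqrt (log 2 n)" by (rule real_le_rsqrt)
    moreover have "real (maj_l n) = 11 + real d" using Suc by (simp add: maj_l_def)
    ultimately show ?thesis using L1 by linarith
  qed
qed

lemma maj_depth_bigo: "(\<lambda>n. real (circuit_depth (maj_circuit n))) \<in> O[at_top](\<lambda>n. log 2 (real n) powr (5 / 3))"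
proof (rule bigoI)
  \<comment> \<open>The constant is three gate levels per layer, \<open>10001 * 62\<close> from
    \<open>D_le\<close>, and \<open>1728 = 12 ^ 3\<close> from \<open>maj_l_le\<close>.\<close>
  show "eventually (\<lambda>n. norm (real (circuit_depth (maj_circuit n))) \<le> 3 * (10001 * 62 * 1728) * norm (log 2 (real n) powr (5 / 3))) at_top"
    using eventually_ge_at_top[of 2]
  proof eventually_elim
    case (elim n)
    define L where "L = log 2 (real n)"
    have L: "1 \<le> L" using elim by (simp add: L_def)
    have "real (maj_l n ^ 3) \<le> (12 * sqrt L) ^ 3"
      unfolding of_nat_power L_def using maj_l_le[OF elim] by (intro power_mono) auto
    also have "\<dots> = 1728 * (L powr (1 / 2)) powr 3"
      using L by (simp add: power_mult_distrib powr_half_sqrt)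
    also have "\<dots> = 1728 * L powr (3 / 2)" by (simp add: powr_powr)
    also have "\<dots> \<le> 1728 * L powr (5 / 3)" using L by (intro mult_left_mono powr_mono) auto
    finally have "real (maj_l n ^ 3) \<le> 1728 * L powr (5 / 3)" .
    moreover have "real (circuit_depth (maj_circuit n)) \<le> real (3 * (10001 * 62 * maj_l n ^ 3))"
      using maj_circuit_depth[of n] by (simp only: of_nat_le_iff)
    ultimately show ?case by (simp add: L_def)
  qed
qed

theorem theorem1:
  "\<exists>(A :: prog) (C :: nat \<Rightarrow> circuit) (T :: nat \<Rightarrow> nat).
     outputs_in_time A (\<lambda>n. encode_circuit (C n)) T \<and> poly_bounded T \<and>
     (\<forall>n. computes n (C n) MAJ) \<and>
     poly_bounded (\<lambda>n. circuit_size (C n)) \<and>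
     (\<lambda>n. real (circuit_depth (C n))) \<in> O[at_top](\<lambda>n. log 2 (real n) powr (5 / 3))"
proof -
  have len: "ptime 1 (\<lambda>xs. maj_D (xs ! 0) * maj_W (xs ! 0))" by (intro ptime_mult ptime_sizes)
  obtain A T where "outputs_in_time A (\<lambda>n. encode_circuit (maj_circuit n)) T" "poly_bounded T"
    using outputs_in_time_loop[where fs = gate_tokens and es = output_tokens,
        OF len ptime_gate_tokens ptime_output_tokens]
    unfolding encode_maj_circuit by auto
  moreover have "poly_bounded (\<lambda>n. circuit_size (maj_circuit n))"
    by (rule pbound_poly_bounded[OF pbound_mult[OF pbound_const ptime_pbound[OF len]], of _ 4])
      (simp add: maj_circuit_size)
  ultimately show ?thesis using maj_circuit_computes maj_depth_bigo by blast
qed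

end
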